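(* Let $k\ge 3$ be an integer, let $\delta>0$ be a real constant, and let $r$ be an integer such that one of the following holds: (1) $\delta>\frac12$ and $r=k-1$; (2) $\delta>0$ and $r=k$. Then there exists $\alpha>0$ such that for all sufficiently large $n\in\mathbb{N}$ the following holds. If $G=(V_1,\ldots,V_k,E)$ is a spanning subgraph of the $n$-blow-up of $K_k$ with $\delta^*(G)\ge \delta n$ and $\alpha^*_r(G)<\alpha n$, then $G$ has a transversal $K_k$-factor.
   Context: The $n$-blow-up of $K_k$ is the graph $B$ whose vertex set is partitioned into parts $V_1,\dots,V_k$ with $|V_1|=\cdots=|V_k|=n$, in which $\{u,v\}$ is an edge if and only if $u\in V_i$ and $v\in V_j$ for some $i\ne j$. A spanning subgraph $G$ of $B$ has the same vertex set and the same parts $V_1,\dots,V_k$, and we write $G=(V_1,\ldots,V_k,E)$. Define $\delta^*(G):=\min_{1\le i<j\le k}\delta(G[V_i,V_j])$, where $G[V_i,V_j]$ is the bipartite subgraph of $G$ induced by the parts $V_i$ and $V_j$, and $\delta(\cdot)$ is the minimum degree. For $2\le r\le k$, an $r$-partite hole of size $s$ in the $k$-partite graph $G$ is a collection of $r$ disjoint vertex subsets $U_1,\dots,U_r$, each of size $s$, lying inside $r$ distinct parts among $V_1,\dots,V_k$ (one subset in each), such that there is no copy of $K_r$ in $G$ with one vertex in each $U_i$, $i\in[r]$. $\alpha^*_r(G)$ is the size $s$ of the largest $r$-partite hole in $G$. A subgraph of $G$ is transversal if it intersects each part $V_i$ in exactly one vertex. A transversal $K_k$-factor of $G$ is a collection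 of vertex-disjoint transversal copies of $K_k$ in $G$ that together cover every vertex of $G$. *)

theory Defs
  imports Complex_Main "HOL-Library.Disjoint_Sets"
begin

text \<open>A k-partite graph is given by its parts \<open>V 1, \<dots>, V k\<close> (the values of \<open>V\<close> at other
  indices are irrelevant) and its edge set \<open>E\<close>, an edge being an unordered pair \<open>{u, v}\<close>.\<close>

definition blowup_parts :: "nat \<Rightarrow> nat \<Rightarrow> (nat \<Rightarrow> 'a set) \<Rightarrow> bool" where
  "blowup_parts k n V \<longleftrightarrow>
     disjoint_family_on V {1..k} \<and> (\<forall>i\<in>{1..k}. finite (V i) \<and> card (V i) = n)"

definition blowup_edges :: "nat \<Rightarrow> (nat \<Rightarrow> 'a set) \<Rightarrow> 'a set set" where
  "blowup_edges k V =
     {{u, v} | u v. \<exists>i\<in>{1..k}. \<exists>j\<in>{1..k}. i \<noteq> j \<and> u \<in> V i \<and> v \<in> V j}"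

definition spanning_subgraph_of_blowup ::
    "nat \<Rightarrow> nat \<Rightarrow> (nat \<Rightarrow> 'a set) \<Rightarrow> 'a set set \<Rightarrow> bool" where
  "spanning_subgraph_of_blowup k n V E \<longleftrightarrow> blowup_parts k n V \<and> E \<subseteq> blowup_edges k V"

definition vertex_degree :: "'a set set \<Rightarrow> 'a \<Rightarrow> nat" where
  "vertex_degree E v = card {e \<in> E. v \<in> e}"

text \<open>Only meaningful for a finite nonempty vertex set \<open>W\<close>.\<close>

definition min_degree :: "'a set \<Rightarrow> 'a set set \<Rightarrow> nat" where
  "min_degree W E = Min (vertex_degree E ` W)"

definition induced_edges :: "'a set set \<Rightarrow> 'a set \<Rightarrow> 'a set set" where
  "induced_edges E W = {e \<in> E. e \<subseteq> W}"

text \<open>The minimum, over all pairs of parts, of the minimum degree of the induced bipartite graph;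
  the vertices of both parts are taken into account.\<close>

definition delta_star :: "nat \<Rightarrow> (nat \<Rightarrow> 'a set) \<Rightarrow> 'a set set \<Rightarrow> nat" where
  "delta_star k V E =
     Min {min_degree (V i \<union> V j) (induced_edges E (V i \<union> V j)) | i j. 1 \<le> i \<and> i < j \<and> j \<le> k}"

definition is_clique :: "'a set set \<Rightarrow> 'a set \<Rightarrow> bool" where
  "is_clique E W \<longleftrightarrow> (\<forall>u\<in>W. \<forall>v\<in>W. u \<noteq> v \<longrightarrow> {u, v} \<in> E)"

text \<open>\<open>W\<close> is the vertex set of a copy of the complete graph on \<open>card I\<close> vertices that has exactly
  one vertex in each of the (pairwise disjoint) sets \<open>U i\<close>, \<open>i \<in> I\<close>.\<close>

definition transversal_clique :: "nat set \<Rightarrow> (nat \<Rightarrow> 'a set) \<Rightarrow> 'a set set \<Rightarrow> 'a set \<Rightarrow> bool" where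
  "transversal_clique I U E W \<longleftrightarrow>
     W \<subseteq> (\<Union>i\<in>I. U i) \<and> (\<forall>i\<in>I. card (W \<inter> U i) = 1) \<and> is_clique E W"

text \<open>The subsets forming a hole are indexed by the set \<open>I\<close> of (indices of) the \<open>r\<close> parts that
  contain them; they are disjoint because the parts are.\<close>

definition partite_hole ::
    "nat \<Rightarrow> (nat \<Rightarrow> 'a set) \<Rightarrow> 'a set set \<Rightarrow> nat \<Rightarrow> nat \<Rightarrow> nat set \<Rightarrow> (nat \<Rightarrow> 'a set) \<Rightarrow> bool" where
  "partite_hole k V E r s I U \<longleftrightarrow>
     I \<subseteq> {1..k} \<and> card I = r \<and>
     (\<forall>i\<in>I. U i \<subseteq> V i \<and> card (U i) = s) \<and>
     (\<nexists>W. transversal_clique I U E W)"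

text \<open>For \<open>1 \<le> r \<le> k\<close> and finite parts the set below is finite, and it contains \<open>0\<close>.\<close>

definition alpha_star :: "nat \<Rightarrow> nat \<Rightarrow> (nat \<Rightarrow> 'a set) \<Rightarrow> 'a set set \<Rightarrow> nat" where
  "alpha_star r k V E = Max {s. \<exists>I U. partite_hole k V E r s I U}"

definition has_transversal_factor :: "nat \<Rightarrow> (nat \<Rightarrow> 'a set) \<Rightarrow> 'a set set \<Rightarrow> bool" where
  "has_transversal_factor k V E \<longleftrightarrow>
     (\<exists>F. (\<forall>W\<in>F. transversal_clique {1..k} V E W) \<and> disjoint F \<and> \<Union>F = (\<Union>i\<in>{1..k}. V i))"

end

(* The proof is by absorption. In either case cliques of order k - 1 exist in all large sets of
   vertices of k - 1 parts, so every vertex can be completed to a transversal K_k inside prescribed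
   large subsets of its neighbourhoods. Any two vertices of a part can be exchanged by boundedly
   large gadgets avoiding any small set: for delta > 1/2 by a K_{k-1} in their common neighbourhood,
   and for r = k by a chain through vertices that have many twins with large common neighbourhoods.
   Hence every transversal tuple has linearly many disjoint absorbers. As the number of absorbers may
   be far below n^(k^2), a random choice does not work; they are arranged along a sparse bipartite
   template that has perfect matchings after deleting any prescribed number of flexible vertices.
   An almost perfect tiling is found greedily for r = k. For delta > 1/2, vertices of the first part
   serve as centres of stars, processed in an order that is random-like with respect to all
   neighbourhoods, and the leaves are taken first-fit from random-like pieces of the other parts. *)

theory Submission
  imports Defs "HOL-Library.FuncSet"
begin

section \<open>A bipartite graph with robust perfect matchings\<close>

text \<open>Absence of holes yields one clique inside linear-sized sets, but no positive density of
  cliques. Links and absorbers are therefore defined by the ability to avoid every forbidden set up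
  to a given size: this is all that a greedy choice needs, and it survives the composition of
  gadgets with a slightly smaller bound. The template has linearly many edges in its own size, so
  one bounded gadget per edge fits into a small fraction of the vertices. A plain greedy choice
  could end with centres whose neighbourhoods are exhausted; first fit over small pieces prevents
  this whatever leaves are returned. The constants are fixed in the order: fraction 1/N of flexible
  vertices, number q of slots of centres, number p of pieces, hole size. Each choice is made after
  those it has to beat.\<close>

lemma hall_marriage:
  fixes N :: "'b \<Rightarrow> 'c set"
  assumes "finite A" "\<And>a. a \<in> A \<Longrightarrow> finite (N a)"
    and "\<And>S. S \<subseteq> A \<Longrightarrow> card S \<le> card (\<Union>(N ` S))"
  shows "\<exists>f. inj_on f A \<and> (\<forall>a\<in>A. f a \<in> N a)"
  using assms
proof (induction "card A" arbitrary: A N rule: less_induct)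
  case less
  show ?case
  proof (cases "A = {}")
    case True
    then show ?thesis by auto
  next
    case False
    then obtain a where a: "a \<in> A" by blast
    show ?thesis
    proof (cases "\<exists>S. S \<subset> A \<and> S \<noteq> {} \<and> card (\<Union>(N ` S)) \<le> card S")
      \<comment> \<open>Every nonempty proper subset has a neighbour to spare, so \<open>a\<close>
        may take any \<open>b\<close>: removing \<open>b\<close> costs each set at most one
        neighbour.\<close>
      case False
      have "card {a} \<le> card (N a)" using less.prems(3)[of "{a}"] a by simp
      then obtain b where b: "b \<in> N a" by (metis card.empty card_1_singleton_iff card_le_Suc0_iff_eq
            ex_in_conv is_singletonI is_singleton_altdef le_0_eq zero_neq_one)
      define N' where "N' = (\<lambda>x. N x - {b})"
      have "\<exists>f. inj_on f (A - {a}) \<and> (\<forall>x\<in>A - {a}. f x \<in> N' x)"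
      proof (rule less.hyps)
        show "card (A - {a}) < card A" using a less.prems(1) by (meson card_Diff1_less)
        show "finite (A - {a})" using less.prems(1) by simp
        show "finite (N' x)" if "x \<in> A - {a}" for x using that less.prems(2) by (simp add: N'_def)
        fix S assume S: "S \<subseteq> A - {a}"
        show "card S \<le> card (\<Union>(N' ` S))"
        proof (cases "S = {}")
          case False
          with S a have "S \<subset> A" by blast
          with False \<open>\<not> (\<exists>S. _ S)\<close> have "card S < card (\<Union>(N ` S))" by (meson not_le)
          moreover have "\<Union>(N' ` S) = \<Union>(N ` S) - {b}" by (auto simp: N'_def)
          moreover have "card (\<Union>(N ` S)) - 1 \<le> card (\<Union>(N ` S) - {b})"
            by (simp add: card_Diff_singleton_if)
          ultimately show ?thesis by simp
        qed simp
      qed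
      then obtain f where f: "inj_on f (A - {a})" "\<forall>x\<in>A - {a}. f x \<in> N' x" by blast
      have "inj_on (f(a := b)) A"
        using f by (auto simp: inj_on_def N'_def)
      moreover have "\<forall>x\<in>A. (f(a := b)) x \<in> N x" using f b by (auto simp: N'_def)
      ultimately show ?thesis by blast
    next
      \<comment> \<open>A tight set \<open>S\<close> is matched within its own neighbourhood. Hall's
        condition holds for the rest after removing that neighbourhood, since a deficient set there
        together with \<open>S\<close> would be deficient in \<open>A\<close>.\<close>
      case True
      then obtain S where S: "S \<subset> A" "S \<noteq> {}" "card (\<Union>(N ` S)) \<le> card S" by blast
      have finS: "finite S" using S(1) less.prems(1) finite_subset by blast
      have "\<exists>f. inj_on f S \<and> (\<forall>x\<in>S. f x \<in> N x)"
        by (rule less.hyps) (use S less.prems psubset_card_mono finS in \<open>auto simp: subset_iff\<close>)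
      then obtain f where f: "inj_on f S" "\<forall>x\<in>S. f x \<in> N x" by blast
      define N' where "N' = (\<lambda>x. N x - \<Union>(N ` S))"
      have "\<exists>g. inj_on g (A - S) \<and> (\<forall>x\<in>A - S. g x \<in> N' x)"
      proof (rule less.hyps)
        show "card (A - S) < card A" using S less.prems(1) finS
          by (metis Diff_subset card_mono card_Diff_subset card_gt_0_iff diff_less less_le_trans psubsetE)
        show "finite (A - S)" using less.prems(1) by simp
        show "finite (N' x)" if "x \<in> A - S" for x using that less.prems(2) by (simp add: N'_def)
        fix S' assume S': "S' \<subseteq> A - S"
        have fin': "finite S'" using S' less.prems(1) finite_subset by blast
        have finN: "finite (\<Union>(N ` S))" using finS S(1) less.prems(2) by auto
        have finN': "finite (\<Union>(N' ` S'))" using fin' S' less.prems(2) by (auto simp: N'_def)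
        have "card S + card S' = card (S \<union> S')" using S' finS fin' by (subst card_Un_disjoint) auto
        also have "\<dots> \<le> card (\<Union>(N ` (S \<union> S')))" using S S' by (intro less.prems(3)) auto
        also have "\<Union>(N ` (S \<union> S')) = \<Union>(N ` S) \<union> \<Union>(N' ` S')" by (auto simp: N'_def)
        also have "card \<dots> = card (\<Union>(N ` S)) + card (\<Union>(N' ` S'))"
          using finN finN' by (intro card_Un_disjoint) (auto simp: N'_def)
        finally show "card S' \<le> card (\<Union>(N' ` S'))" using S(3) by linarith
      qed
      then obtain g where g: "inj_on g (A - S)" "\<forall>x\<in>A - S. g x \<in> N' x" by blast
      define h where "h x = (if x \<in> S then f x else g x)" for x
      have ne: "g y \<noteq> f x" if "x \<in> S" "y \<in> A" "y \<notin> S" for x y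
      proof -
        have "f x \<in> \<Union>(N ` S)" using f(2) that by blast
        moreover have "g y \<notin> \<Union>(N ` S)" using g(2) that by (simp add: N'_def)
        ultimately show ?thesis by metis
      qed
      have "inj_on h A"
      proof (rule inj_onI)
        fix x y assume xy: "x \<in> A" "y \<in> A" "h x = h y"
        show "x = y"
          using xy ne[of x y] ne[of y x] inj_onD[OF f(1), of x y] inj_onD[OF g(1), of x y]
          by (cases "x \<in> S"; cases "y \<in> S") (auto simp: h_def)
      qed
      moreover have "\<forall>x\<in>A. h x \<in> N x" using f g by (auto simp: h_def N'_def)
      ultimately show ?thesis by blast
    qed
  qed
qed

text \<open>One term of the exponential series is at most its sum, and e is at most 3. This takes
  the place of Stirling's formula.\<close>

lemma self_power_le_fact: "real s ^ s \<le> 3 ^ s * fact s"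
proof -
  have "real s ^ s / fact s = (\<Sum>j\<in>{s}. real s ^ j /\<^sub>R fact j)"
    by (simp add: field_simps)
  also have "\<dots> \<le> exp (real s)"
    unfolding exp_def using summable_exp_generic[of "real s"] by (intro sum_le_suminf) auto
  also have "\<dots> = exp 1 ^ s" by (simp add: exp_of_nat_mult[symmetric])
  also have "\<dots> \<le> 3 ^ s" by (rule power_mono) (auto simp: exp_le)
  finally show ?thesis by (simp add: field_simps)
qed

lemma binomial_le_power_div_fact: "real (n choose s) \<le> real n ^ s / fact s"
proof (cases "s \<le> n")
  case True
  have "real (n choose s) * fact s \<le> real n ^ s"
    using binomial_fact_pow[of n s] by (metis of_nat_fact of_nat_le_iff of_nat_mult of_nat_power)
  then show ?thesis by (simp add: field_simps)
qed (simp add: binomial_eq_0)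

text \<open>The left side is the expected number of pairs of \<open>s\<close>-sets such that all 12
  random choices of the first set land in the second. By s! >= (s/3)^s and p <= 2q the binomials
  contribute at most (18 (q/s)^2)^s. Two of the 12 factors s/q cancel (q/s)^2; the other ten give 18
  (2/3)^10 < 1/3, because s <= 2q/3.\<close>

lemma expander_weight:
  assumes "1 \<le> s" "3 * s \<le> 2 * q" "p \<le> 2 * q"
  shows "real (p choose s) * real (q choose s) * (real s / real q) ^ (12 * s) \<le> (1/3) ^ s"
proof -
  have q: "real q > 0" and s: "real s > 0" using assms by auto
  define F :: real where "F = fact s"
  have F: "F > 0" by (simp add: F_def)
  have "real (p choose s) \<le> real p ^ s / F" unfolding F_def by (rule binomial_le_power_div_fact)
  also have "\<dots> \<le> real (2 * q) ^ s / F"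
    using assms(3) F by (intro divide_right_mono power_mono of_nat_mono) auto
  finally have 1: "real (p choose s) \<le> (2 * real q) ^ s / F" by simp
  have 2: "real (q choose s) \<le> real q ^ s / F" unfolding F_def by (rule binomial_le_power_div_fact)
  have 3: "1 / F \<le> 3 ^ s / real s ^ s"
    using self_power_le_fact[of s] s F by (simp add: field_simps F_def)
  have "real (p choose s) * real (q choose s) \<le> ((2 * real q) ^ s / F) * (real q ^ s / F)"
    using 1 2 F by (intro mult_mono) auto
  also have "\<dots> = (2 * real q * real q) ^ s * (1 / F) * (1 / F)"
    by (simp add: power_mult_distrib)
  also have "\<dots> \<le> (2 * real q * real q) ^ s * (3 ^ s / real s ^ s) * (3 ^ s / real s ^ s)"
    using 3 F s by (intro mult_mono) auto
  also have "\<dots> = (18 * (real q / real s)\<^sup>2) ^ s"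
    by (simp add: power_mult_distrib power_divide power2_eq_square flip: power_mult)
       (simp add: power_mult_distrib[symmetric] field_simps)
  finally have 4: "real (p choose s) * real (q choose s) \<le> (18 * (real q / real s)\<^sup>2) ^ s" .
  have "real (p choose s) * real (q choose s) * (real s / real q) ^ (12 * s)
     \<le> (18 * (real q / real s)\<^sup>2) ^ s * (real s / real q) ^ (12 * s)"
    using 4 by (rule mult_right_mono) auto
  also have "\<dots> = (18 * (real q / real s)\<^sup>2 * (real s / real q) ^ 12) ^ s"
    by (simp add: power_mult power_mult_distrib)
  also have "18 * (real q / real s)\<^sup>2 * (real s / real q) ^ 12 = 18 * (real s / real q) ^ 10"
    using q s by (simp add: field_simps power2_eq_square eval_nat_numeral)
  also have "(18 * (real s / real q) ^ 10) ^ s \<le> (18 * (2/3) ^ 10) ^ s"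
    using q s assms(2) by (intro power_mono mult_left_mono) (auto simp: field_simps)
  also have "\<dots> \<le> (1/3) ^ s" by (intro power_mono) (auto simp: eval_nat_numeral)
  finally show ?thesis .
qed

text \<open>The first factor counts all maps; the second is the probability that \<open>D\<close>
  independent choices for each vertex of \<open>W\<close> all fall into \<open>T\<close>.\<close>

lemma card_PiE_confined:
  assumes "finite P" "W \<subseteq> P" "finite Q" "card T = card W" "T \<subseteq> Q" "Q \<noteq> {}"
  shows "real (card (PiE (P \<times> {..<D}) (\<lambda>z. if fst z \<in> W then T else Q)))
       = real (card Q) ^ (card P * D) * (real (card W) / real (card Q)) ^ (D * card W)"
proof -
  have q: "card Q > 0" using assms by (simp add: card_gt_0_iff)
  have "real (card (PiE (P \<times> {..<D}) (\<lambda>z. if fst z \<in> W then T else Q)))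
      = (\<Prod>z\<in>P \<times> {..<D}. real (if fst z \<in> W then card T else card Q))"
    using assms(1) by (simp add: card_PiE if_distrib cong: if_cong)
  also have "\<dots> = (\<Prod>x\<in>P. \<Prod>i<D. real (if x \<in> W then card T else card Q))"
    by (subst prod.cartesian_product) (simp add: case_prod_unfold)
  also have "\<dots> = (\<Prod>x\<in>P. real (if x \<in> W then card W else card Q) ^ D)"
    unfolding assms(4) by simp
  also have "\<dots> = (\<Prod>x\<in>P. real (card Q) ^ D * (if x \<in> W then (real (card W) / real (card Q)) ^ D else 1))"
    using q by (intro prod.cong) (auto simp: power_divide)
  also have "\<dots> = (real (card Q) ^ D) ^ card P * (\<Prod>x\<in>W. (real (card W) / real (card Q)) ^ D)"
    using assms(1,2) by (simp add: prod.distrib prod.If_cases Int_absorb1)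
  finally show ?thesis by (simp add: power_mult mult.commute)
qed

lemma geometric_third_sum: "(\<Sum>s\<in>{1..m}. (1/3::real) ^ s) < 1"
proof -
  have "(\<Sum>s\<in>{1..m}. x ^ s) * (1 - x) = x - x ^ (m + 1)" for x :: real
    by (induction m) (auto simp: distrib_right right_diff_distrib)
  from this[of "1/3"] have "(\<Sum>s\<in>{1..m}. (1/3::real) ^ s) * (2/3) = 1/3 - (1/3) ^ (m + 1)" by simp
  moreover have "(1/3::real) ^ (m + 1) > 0" by simp
  ultimately show ?thesis by linarith
qed

text \<open>A uniformly random function works: a violation confines the image of some \<open>W \<times> {..<12}\<close> to a
  set of \<open>card W\<close> elements, and 12 choices per vertex make the union bound over all such pairs
  of sets a geometric series.\<close>

lemma expander_exists:
  fixes P :: "'b set" and Q :: "'c set"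
  assumes fin: "finite P" "finite Q" and PQ: "card P \<le> 2 * card Q"
  shows "\<exists>f. f \<in> P \<times> {..<12::nat} \<rightarrow> Q \<and>
    (\<forall>W\<subseteq>P. 3 * card W \<le> 2 * card Q \<longrightarrow> card W \<le> card (f ` (W \<times> {..<12})))"
proof (cases "Q = {}")
  case True
  then have "P = {}" using PQ fin by simp
  then show ?thesis using True by auto
next
  case False
  define q where "q = card Q"
  define p where "p = card P"
  have q: "q > 0" using False fin by (simp add: q_def card_gt_0_iff)
  define Om where "Om = PiE (P \<times> {..<12::nat}) (\<lambda>_. Q)"
  define C where "C W T = PiE (P \<times> {..<12::nat}) (\<lambda>z. if fst z \<in> W then T else Q)" for W T
  define m where "m = 2 * q div 3"
  define bad where "bad = (\<Union>s\<in>{1..m}. \<Union>W\<in>{W. W \<subseteq> P \<and> card W = s}. \<Union>T\<in>{T. T \<subseteq> Q \<and> card T = s}. C W T)"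
  have cardOm: "card Om = q ^ (p * 12)"
    using fin by (simp add: Om_def card_PiE q_def p_def card_cartesian_product)
  have m: "3 * s \<le> 2 * q" if "s \<in> {1..m}" for s using that by (auto simp: m_def)
  have finsub: "finite {W. W \<subseteq> P \<and> card W = s}" "finite {T. T \<subseteq> Q \<and> card T = s}" for s
    using fin by auto
  have level: "real (card (\<Union>W\<in>{W. W \<subseteq> P \<and> card W = s}. \<Union>T\<in>{T. T \<subseteq> Q \<and> card T = s}. C W T))
      \<le> real (q ^ (p * 12)) * (1/3) ^ s" if s: "s \<in> {1..m}" for s
  proof -
    have "card (\<Union>W\<in>{W. W \<subseteq> P \<and> card W = s}. \<Union>T\<in>{T. T \<subseteq> Q \<and> card T = s}. C W T)
      \<le> (\<Sum>W\<in>{W. W \<subseteq> P \<and> card W = s}. \<Sum>T\<in>{T. T \<subseteq> Q \<and> card T = s}. card (C W T))"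
      by (rule order_trans[OF card_UN_le[OF finsub(1)]]) (intro sum_mono card_UN_le finsub)
    then have "real (card (\<Union>W\<in>{W. W \<subseteq> P \<and> card W = s}. \<Union>T\<in>{T. T \<subseteq> Q \<and> card T = s}. C W T))
      \<le> (\<Sum>W\<in>{W. W \<subseteq> P \<and> card W = s}. \<Sum>T\<in>{T. T \<subseteq> Q \<and> card T = s}. real (card (C W T)))"
      unfolding of_nat_sum[symmetric] of_nat_le_iff .
    also have "\<dots> = (\<Sum>W\<in>{W. W \<subseteq> P \<and> card W = s}. \<Sum>T\<in>{T. T \<subseteq> Q \<and> card T = s}.
        real q ^ (p * 12) * (real s / real q) ^ (12 * s))"
      using fin False by (intro sum.cong refl) (auto simp: C_def card_PiE_confined q_def p_def)
    also have "\<dots> = real q ^ (p * 12) * (real (p choose s) * real (q choose s) * (real s / real q) ^ (12 * s))"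
      by (simp add: n_subsets[OF fin(1)] n_subsets[OF fin(2)] p_def q_def)
    also have "\<dots> \<le> real q ^ (p * 12) * (1/3) ^ s"
      using s m[OF s] PQ by (intro mult_left_mono expander_weight) (auto simp: p_def q_def)
    finally show ?thesis by simp
  qed
  have "card bad \<le> (\<Sum>s\<in>{1..m}. card (\<Union>W\<in>{W. W \<subseteq> P \<and> card W = s}. \<Union>T\<in>{T. T \<subseteq> Q \<and> card T = s}. C W T))"
    unfolding bad_def by (rule card_UN_le) simp
  then have "real (card bad) \<le> (\<Sum>s\<in>{1..m}. real (card (\<Union>W\<in>{W. W \<subseteq> P \<and> card W = s}. \<Union>T\<in>{T. T \<subseteq> Q \<and> card T = s}. C W T)))"
    unfolding of_nat_sum[symmetric] of_nat_le_iff .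
  also have "\<dots> \<le> (\<Sum>s\<in>{1..m}. real (q ^ (p * 12)) * (1/3) ^ s)" by (intro sum_mono level)
  also have "\<dots> = real (q ^ (p * 12)) * (\<Sum>s\<in>{1..m}. (1/3) ^ s)" by (simp add: sum_distrib_left)
  also have "\<dots> < real (q ^ (p * 12)) * 1"
    using q by (intro mult_strict_left_mono geometric_third_sum) auto
  finally have less: "card bad < card Om" using cardOm by simp
  have "\<not> Om \<subseteq> bad"
  proof
    assume "Om \<subseteq> bad"
    moreover have "finite bad" unfolding bad_def C_def
      by (intro finite_UN_I finsub finite_PiE) (use fin in \<open>auto intro: finite_subset\<close>)
    ultimately show False using less card_mono not_le by blast
  qed
  then obtain f where f: "f \<in> Om" "f \<notin> bad" by blast
  have "card W \<le> card (f ` (W \<times> {..<12}))" if W: "W \<subseteq> P" "3 * card W \<le> 2 * card Q" for W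
  proof (rule ccontr)
    assume "\<not> ?thesis"
    then have lt: "card (f ` (W \<times> {..<12})) < card W" by simp
    have sub: "f ` (W \<times> {..<12}) \<subseteq> Q" using f(1) W(1) by (auto simp: Om_def)
    have "card W \<le> card Q" using W(2) by simp
    \<comment> \<open>The image is enlarged to exactly \<open>card W\<close> elements, so that the
      union bound runs over pairs of sets of equal size.\<close>
    with lt sub fin obtain T where T: "f ` (W \<times> {..<12}) \<subseteq> T" "T \<subseteq> Q" "card T = card W"
      by (metis exists_subset_between less_imp_le_nat)
    have "card W \<in> {1..m}" using lt W(2) by (auto simp: m_def q_def)
    moreover have "f \<in> C W T" using f(1) T by (auto simp: C_def Om_def PiE_iff extensional_def)
    ultimately have "f \<in> bad" unfolding bad_def using W T by blast
    then show False using f by simp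
  qed
  moreover have "f \<in> P \<times> {..<12::nat} \<rightarrow> Q" using f by (auto simp: Om_def)
  ultimately show ?thesis by blast
qed

text \<open>Montgomery's template graph. Hall's condition for large sets is checked from the side of \<open>Z\<close>,
  by expansion into \<open>Y\<close>, which does not depend on the choice of \<open>X'\<close>.\<close>

lemma robust_matching_template:
  fixes X Y :: "'b set" and Z :: "'c set"
  assumes fin: "finite X" "finite Y" "finite Z" "X \<inter> Y = {}"
    and sizes: "card X \<ge> 1" "card Y = 4 * card X" "e \<le> card X" "card Z + e = card X + card Y"
  shows "\<exists>G. G \<subseteq> (X \<union> Y) \<times> Z \<and> card G \<le> 120 * card X \<and>
    (\<forall>X'\<subseteq>X. card X' + e = card X \<longrightarrow> (\<exists>f. bij_betw f (X' \<union> Y) Z \<and> (\<forall>l\<in>X' \<union> Y. (l, f l) \<in> G)))"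
proof -
  define m where "m = card X"
  have cardXY: "card (X \<union> Y) = 5 * m" using fin sizes by (simp add: card_Un_disjoint m_def)
  have "card (X \<union> Y) \<le> 2 * card Z" using cardXY sizes by (simp add: m_def)
  from expander_exists[OF _ fin(3) this] fin obtain f where f: "f \<in> (X \<union> Y) \<times> {..<12::nat} \<rightarrow> Z"
    "\<And>W. W \<subseteq> X \<union> Y \<Longrightarrow> 3 * card W \<le> 2 * card Z \<Longrightarrow> card W \<le> card (f ` (W \<times> {..<12}))" by auto
  have "card Z \<le> 2 * card Y" using sizes by (simp add: m_def)
  from expander_exists[OF fin(3) fin(2) this] obtain g where g: "g \<in> Z \<times> {..<12::nat} \<rightarrow> Y"
    "\<And>W. W \<subseteq> Z \<Longrightarrow> 3 * card W \<le> 2 * card Y \<Longrightarrow> card W \<le> card (g ` (W \<times> {..<12}))" by auto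
  \<comment> \<open>\<open>f\<close> provides expansion from \<open>X \<union> Y\<close> into
    \<open>Z\<close>, and \<open>g\<close> from \<open>Z\<close> back into \<open>Y\<close> alone,
    which is never deleted. Twelve edges at each of at most 5 \<open>card X\<close> vertices on
    either side give the constant 120.\<close>
  define G where "G = (\<lambda>z. (fst z, f z)) ` ((X \<union> Y) \<times> {..<12}) \<union> (\<lambda>z. (g z, fst z)) ` (Z \<times> {..<12})"
  have Gsub: "G \<subseteq> (X \<union> Y) \<times> Z" using f(1) g(1) by (auto simp: G_def)
  have "card G \<le> card ((X \<union> Y) \<times> {..<12::nat}) + card (Z \<times> {..<12::nat})"
    unfolding G_def by (rule order_trans[OF card_Un_le]) (intro add_mono card_image_le; use fin in simp)
  also have "\<dots> = 12 * (5 * m) + 12 * card Z" by (simp add: card_cartesian_product cardXY)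
  also have "\<dots> \<le> 120 * m" using sizes by (simp add: m_def)
  finally have cardG: "card G \<le> 120 * card X" by (simp add: m_def)
  have "\<exists>\<mu>. bij_betw \<mu> (X' \<union> Y) Z \<and> (\<forall>l\<in>X' \<union> Y. (l, \<mu> l) \<in> G)"
    if X': "X' \<subseteq> X" "card X' + e = card X" for X'
  proof -
    define A where "A = X' \<union> Y"
    have finA: "finite A" using fin X' finite_subset by (auto simp: A_def)
    have "X' \<inter> Y = {}" using X'(1) fin(4) by blast
    then have cA: "card A = card Z"
      using X' fin sizes finite_subset[OF X'(1)] by (simp add: A_def card_Un_disjoint)
    define N where "N l = {z \<in> Z. (l, z) \<in> G}" for l
    have finN: "finite (\<Union>(N ` S))" for S
      by (rule finite_subset[OF _ fin(3)]) (auto simp: N_def)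
    have exp1: "card W \<le> card (\<Union>(N ` W))" if W: "W \<subseteq> A" "3 * card W \<le> 2 * card Z" for W
    proof -
      have "W \<subseteq> X \<union> Y" using W X' by (auto simp: A_def)
      then have "card W \<le> card (f ` (W \<times> {..<12}))" using f(2) W(2) by simp
      also have "\<dots> \<le> card (\<Union>(N ` W))"
      proof (rule card_mono[OF finN], clarify)
        fix x and i :: nat assume "x \<in> W" "i < 12"
        moreover from this have "x \<in> X \<union> Y" using \<open>W \<subseteq> X \<union> Y\<close> by blast
        ultimately have "f (x, i) \<in> N x" using f(1) by (force simp: N_def G_def)
        then show "f (x, i) \<in> \<Union>(N ` W)" using \<open>x \<in> W\<close> by blast
      qed
      finally show ?thesis .
    qed
    have hall: "card W \<le> card (\<Union>(N ` W))" if W: "W \<subseteq> A" for W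
    proof (rule ccontr)
      assume "\<not> ?thesis"
      then have lt: "card (\<Union>(N ` W)) < card W" by simp
      have finW: "finite W" using W finA finite_subset by blast
      have big: "3 * card W > 2 * card Z" using exp1[OF W] lt by linarith
      \<comment> \<open>\<open>b\<close> is the largest size for which \<open>f\<close> guarantees
        expansion. A subset of \<open>W\<close> of this size shows that at most (card Z + 2) / 3
        vertices of \<open>Z\<close> are not reached by \<open>W\<close>.\<close>
      obtain b where b: "3 * b \<le> 2 * card Z" "2 * card Z < 3 * b + 3"
        using that[of "2 * card Z div 3"] by linarith
      have "b \<le> card W" using b big by linarith
      then obtain W0 where W0: "W0 \<subseteq> W" "card W0 = b"
        using obtain_subset_with_card_n by metis
      have "b \<le> card (\<Union>(N ` W0))" using exp1[of W0] W0 W b by auto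
      also have "\<dots> \<le> card (\<Union>(N ` W))" using W0 finN by (intro card_mono) auto
      finally have bN: "b \<le> card (\<Union>(N ` W))" .
      define W' where "W' = Z - \<Union>(N ` W)"
      have NZ: "\<Union>(N ` W) \<subseteq> Z" by (auto simp: N_def)
      have cW': "card W' = card Z - card (\<Union>(N ` W))"
        unfolding W'_def using NZ finN by (intro card_Diff_subset) auto
      \<comment> \<open>The size of \<open>Y\<close> enters here: with m = \<open>card X\<close> at
        least 1, card Z + 2 <= 5m + 2 <= 8m = 2 card Y.\<close>
      have "3 * card W' \<le> 2 * card Y" using cW' bN sizes b by linarith
      then have "card W' \<le> card (g ` (W' \<times> {..<12}))" by (intro g(2)) (auto simp: W'_def)
      \<comment> \<open>Nothing in \<open>W\<close> is adjacent to \<open>W'\<close>, so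
        \<open>W'\<close> expands into \<open>A - W\<close>. As \<open>A\<close> and
        \<open>Z\<close> have equal size, this contradicts the deficiency of
        \<open>W\<close>.\<close>
      also have "\<dots> \<le> card (A - W)"
      proof (rule card_mono, use finA in simp, clarify)
        fix z and i :: nat assume z: "z \<in> W'" "i < 12"
        then have "z \<in> Z" by (simp add: W'_def)
        then have "(g (z, i), z) \<in> G" "g (z, i) \<in> Y" using z g(1) by (force simp: G_def)+
        then show "g (z, i) \<in> A - W" using z \<open>z \<in> Z\<close> by (auto simp: A_def W'_def N_def)
      qed
      also have "\<dots> = card Z - card W" using W finW cA by (simp add: card_Diff_subset)
      finally have "card W' \<le> card Z - card W" .
      moreover have "card W \<le> card Z" using W finA cA card_mono by metis
      moreover have "card (\<Union>(N ` W)) \<le> card Z" using NZ fin by (intro card_mono)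
      ultimately show False using cW' lt by linarith
    qed
    have "finite (N a)" for a using fin by (simp add: N_def)
    from hall_marriage[OF finA this hall] obtain \<mu> where \<mu>: "inj_on \<mu> A" "\<forall>a\<in>A. \<mu> a \<in> N a" by blast
    have "\<mu> ` A = Z"
      using \<mu> cA fin(3) by (intro card_subset_eq) (auto simp: N_def card_image)
    then show ?thesis using \<mu> by (intro exI[of _ \<mu>]) (auto simp: bij_betw_def A_def N_def)
  qed
  then show ?thesis using Gsub cardG by blast
qed

section \<open>Balanced colourings\<close>

text \<open>Chernoff's bound for the lower tail, counting colourings weighted by
  \<open>exp (- \<epsilon> / 2 * card {u \<in> A. f u = c})\<close>.\<close>

lemma card_unbalanced_colourings:
  fixes V A :: "'b set" and \<epsilon> :: real
  assumes V: "finite V" "A \<subseteq> V" and c: "c < N" and \<epsilon>: "\<epsilon> > 0"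
  shows "real (card {f \<in> PiE V (\<lambda>_. {..<N}). real (card {u \<in> A. f u = c}) < card A / N - \<epsilon> * card V})
    \<le> real N ^ card V * exp (- (\<epsilon>\<^sup>2 * card V / 4))"
proof -
  define n where "n = real (card V)"
  define a where "a = real (card A)"
  \<comment> \<open>The exponent is at most (x^2 - x \<epsilon>) n, which is smallest, namely -
    \<epsilon>^2 n / 4, for this x.\<close>
  define x where "x = \<epsilon> / 2"
  define t where "t = a / N - \<epsilon> * n"
  define Om where "Om = PiE V (\<lambda>_. {..<N})"
  define bad where "bad = {f \<in> Om. real (card {u \<in> A. f u = c}) < t}"
  have N: "N > 0" using c by simp
  have x: "x > 0" using \<epsilon> by (simp add: x_def)
  have finOm: "finite Om" unfolding Om_def using V by (intro finite_PiE) auto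
  have an: "a \<le> n" using V by (simp add: a_def n_def card_mono)
  have weight: "exp (- x * card {u \<in> A. f u = c}) = (\<Prod>u\<in>V. if u \<in> A \<and> f u = c then exp (- x) else 1)" for f
  proof -
    have "(\<Prod>u\<in>V. if u \<in> A \<and> f u = c then exp (- x) else 1) = (\<Prod>u\<in>{u \<in> A. f u = c}. exp (- x))"
      using V by (intro prod.mono_neutral_cong_right) auto
    also have "\<dots> = exp (- x * card {u \<in> A. f u = c})"
      by (simp add: exp_of_nat_mult[symmetric] mult.commute)
    finally show ?thesis by simp
  qed
  have colsum: "(\<Sum>d<N. if u \<in> A \<and> d = c then exp (- x) else 1) = real N * (if u \<in> A then 1 - (1 - exp (- x)) / N else 1)" for u
  proof (cases "u \<in> A")
    case True
    have "(\<Sum>d<N. if u \<in> A \<and> d = c then exp (- x) else 1) = (\<Sum>d<N. 1 + (if d = c then exp (- x) - 1 else 0))"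
      using True by (intro sum.cong) auto
    also have "\<dots> = N + (exp (- x) - 1)" using c by (simp add: sum.distrib)
    also have "\<dots> = real N * (1 - (1 - exp (- x)) / N)" proof -
      have "real N * (1 - z / N) = N - z" for z :: real using N by (simp add: field_simps)
      then show ?thesis by simp
    qed
    finally show ?thesis using True by simp
  qed simp
  have "real (card bad) * exp (- x * t) = (\<Sum>f\<in>bad. exp (- x * t))" by simp
  also have "\<dots> \<le> (\<Sum>f\<in>bad. exp (- x * card {u \<in> A. f u = c}))"
    using x by (intro sum_mono) (auto simp: bad_def)
  also have "\<dots> \<le> (\<Sum>f\<in>Om. exp (- x * card {u \<in> A. f u = c}))"
    using finOm by (intro sum_mono2) (auto simp: bad_def)
  also have "\<dots> = (\<Sum>f\<in>Om. \<Prod>u\<in>V. if u \<in> A \<and> f u = c then exp (- x) else 1)" by (simp only: weight)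
  also have "\<dots> = (\<Prod>u\<in>V. \<Sum>d<N. if u \<in> A \<and> d = c then exp (- x) else 1)"
    unfolding Om_def using V by (subst prod_sum_PiE) auto
  also have "\<dots> = (\<Prod>u\<in>V. real N * (if u \<in> A then 1 - (1 - exp (- x)) / N else 1))" by (simp only: colsum)
  also have "\<dots> = real N ^ card V * (1 - (1 - exp (- x)) / N) ^ card A"
    using V by (simp add: prod.distrib prod.If_cases Int_absorb1)
  also have "\<dots> \<le> real N ^ card V * exp (- (1 - exp (- x)) / N) ^ card A"
  proof (intro mult_left_mono power_mono)
    show "1 - (1 - exp (- x)) / N \<le> exp (- (1 - exp (- x)) / N)"
      using exp_ge_add_one_self[of "- (1 - exp (- x)) / N"] unfolding minus_divide_left[symmetric] by linarith
    have "(1 - exp (- x)) \<le> real N" using N by (smt (verit) exp_gt_zero of_nat_1 of_nat_le_iff Suc_leI One_nat_def)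
    then show "0 \<le> 1 - (1 - exp (- x)) / N" using N by (simp add: field_simps)
  qed simp
  also have "exp (- (1 - exp (- x)) / N) ^ card A = exp (- (1 - exp (- x)) / N * a)"
    by (simp add: a_def exp_of_nat_mult[symmetric] mult.commute)
  finally have 1: "real (card bad) * exp (- x * t) \<le> real N ^ card V * exp (- (1 - exp (- x)) / N * a)" .
  have "exp (- x) \<le> 1 - x + x\<^sup>2"
  proof -
    have "1 + x \<le> exp x" by (rule exp_ge_add_one_self)
    then have "exp (- x) * (1 + x) \<le> 1" using x
      by (metis exp_minus_inverse exp_ge_zero mult.commute mult_left_mono)
    also have "1 \<le> (1 - x + x\<^sup>2) * (1 + x)" using x by (simp add: algebra_simps power2_eq_square)
    finally show ?thesis using x by (simp add: mult_le_cancel_right)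
  qed
  then have 2: "(x - x\<^sup>2) * (a / N) \<le> (1 - exp (- x)) * (a / N)"
    by (intro mult_right_mono) (auto simp: a_def)
  have 3: "x\<^sup>2 * (a / N) \<le> x\<^sup>2 * n"
  proof (rule mult_left_mono)
    have "a / N \<le> a / 1" using N by (intro divide_left_mono) (auto simp: a_def)
    then show "a / N \<le> n" using an by simp
  qed simp
  have "real (card bad) = real (card bad) * exp (- x * t) * exp (x * t)"
    by (simp add: mult.assoc flip: exp_add)
  also have "\<dots> \<le> real N ^ card V * exp (- (1 - exp (- x)) / N * a) * exp (x * t)"
    using 1 by (intro mult_right_mono) auto
  also have "\<dots> = real N ^ card V * exp (x * t - (1 - exp (- x)) * (a / N))"
    by (simp add: mult.assoc flip: exp_add) (simp add: algebra_simps diff_divide_distrib)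
  also have "\<dots> \<le> real N ^ card V * exp (- (\<epsilon>\<^sup>2 * n / 4))"
  proof (intro mult_left_mono, subst exp_le_cancel_iff)
    have "x * t - (1 - exp (- x)) * (a / N) \<le> x * t - (x - x\<^sup>2) * (a / N)" using 2 by simp
    also have "\<dots> = x\<^sup>2 * (a / N) - x * \<epsilon> * n" by (simp add: t_def algebra_simps)
    also have "\<dots> \<le> x\<^sup>2 * n - x * \<epsilon> * n" using 3 by simp
    also have "\<dots> = - (\<epsilon>\<^sup>2 * n / 4)" by (simp add: x_def power2_eq_square field_simps)
    finally show "x * t - (1 - exp (- x)) * (a / N) \<le> - (\<epsilon>\<^sup>2 * n / 4)" .
  qed simp
  finally show ?thesis by (simp add: bad_def Om_def t_def a_def n_def)
qed

text \<open>Union bound over at most \<open>K * card V * N\<close> pairs of a set and a colour.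
  Since the family (in the applications, neighbourhoods) is only linear in \<open>card V\<close>,
  the crude estimate exp (-y) < 2 / y^2 with y = \<epsilon>^2 n / 4 suffices; it produces the
  threshold 32 K N / \<epsilon>^4.\<close>

lemma balanced_colouring:
  fixes V :: "'b set" and K N :: nat and \<epsilon> :: real
  assumes N: "N > 0" and \<epsilon>: "\<epsilon> > 0"
    and V: "finite V" "\<F> \<subseteq> Pow V" "card \<F> \<le> K * card V"
    and large: "32 * real K * real N / \<epsilon> ^ 4 < card V"
  shows "\<exists>f. f \<in> V \<rightarrow> {..<N} \<and>
    (\<forall>A\<in>\<F>. \<forall>c<N. card A / N - \<epsilon> * card V \<le> real (card {u \<in> A. f u = c}))"
proof -
  define B where "B = 32 * real K * real N / \<epsilon> ^ 4"
  define n where "n = real (card V)"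
  have "0 \<le> B" using \<epsilon> by (simp add: B_def)
  then have n: "n > B" "n > 0" using large unfolding B_def n_def by linarith+
  define bad where "bad A c = {f \<in> PiE V (\<lambda>_. {..<N}). real (card {u \<in> A. f u = c}) < card A / N - \<epsilon> * card V}" for A c
  define BAD where "BAD = (\<Union>A\<in>\<F>. \<Union>c<N. bad A c)"
  have finF: "finite \<F>" using V finite_subset by blast
  have "card BAD \<le> (\<Sum>A\<in>\<F>. \<Sum>c<N. card (bad A c))"
    unfolding BAD_def by (rule order_trans[OF card_UN_le[OF finF]]) (intro sum_mono card_UN_le finite_lessThan)
  then have "real (card BAD) \<le> (\<Sum>A\<in>\<F>. \<Sum>c<N. real (card (bad A c)))"
    unfolding of_nat_sum[symmetric] of_nat_le_iff .
  also have "\<dots> \<le> (\<Sum>A\<in>\<F>. \<Sum>c<N. real N ^ card V * exp (- (\<epsilon>\<^sup>2 * card V / 4)))"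
    unfolding bad_def using V \<epsilon> by (intro sum_mono card_unbalanced_colourings) auto
  also have "\<dots> = real (card \<F>) * real N * (real N ^ card V * exp (- (\<epsilon>\<^sup>2 * card V / 4)))" by simp
  also have "\<dots> \<le> (real K * n) * real N * (real N ^ card V * exp (- (\<epsilon>\<^sup>2 * card V / 4)))"
    using V(3) by (intro mult_right_mono) (auto simp: n_def simp flip: of_nat_mult)
  also have "\<dots> = real N ^ card V * (real K * n * real N * exp (- (\<epsilon>\<^sup>2 * n / 4)))"
    by (simp add: n_def algebra_simps)
  also have "\<dots> < real N ^ card V * 1"
  proof (rule mult_strict_left_mono)
    define y where "y = \<epsilon>\<^sup>2 * n / 4"
    have y: "y > 0" using \<epsilon> n by (simp add: y_def)
    have "y\<^sup>2 / 2 < exp y" using exp_lower_Taylor_quadratic[of y] y by linarith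
    then have e: "exp (- y) < 2 / y\<^sup>2" using y by (simp add: exp_minus field_simps)
    have "real K * n * real N * exp (- y) < 1"
    proof (cases "K = 0")
      case False
      then have "real K * n * real N * exp (- y) < real K * n * real N * (2 / y\<^sup>2)"
        using n N e by (intro mult_strict_left_mono) auto
      also have "\<dots> = B / n"
        using n \<epsilon> by (simp add: B_def y_def field_simps power2_eq_square eval_nat_numeral)
      also have "\<dots> < 1" using n by simp
      finally show ?thesis .
    qed simp
    then show "real K * n * real N * exp (- (\<epsilon>\<^sup>2 * n / 4)) < 1" by (simp add: y_def)
  qed (use N in simp)
  also have "\<dots> = real (card (PiE V (\<lambda>_. {..<N})))" using V by (simp add: card_PiE)
  finally have lt: "card BAD < card (PiE V (\<lambda>_. {..<N}))" by simp
  have "BAD \<subseteq> PiE V (\<lambda>_. {..<N})" by (auto simp: BAD_def bad_def)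
  with lt have "BAD \<subset> PiE V (\<lambda>_. {..<N})" by auto
  then obtain f where f: "f \<in> PiE V (\<lambda>_. {..<N})" "f \<notin> BAD" by blast
  have "card A / N - \<epsilon> * card V \<le> real (card {u \<in> A. f u = c})" if "A \<in> \<F>" "c < N" for A c
  proof (rule ccontr)
    assume "\<not> ?thesis"
    then have "f \<in> bad A c" using f(1) by (simp add: bad_def)
    then show False using f(2) that by (auto simp: BAD_def)
  qed
  then show ?thesis using f(1) by (intro exI[of _ f]) (auto simp: PiE_iff)
qed

text \<open>Meant for the family that a colouring of one part has to balance: the part itself and
  the neighbourhoods in it of the vertices of the other parts.\<close>

lemma card_insert_UN_image_le:
  assumes "finite I" "0 < n" and A: "\<And>i. i \<in> I \<Longrightarrow> finite (A i)" "\<And>i. i \<in> I \<Longrightarrow> card (A i) = n"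
  shows "card (insert x (\<Union>i\<in>I. f i ` A i)) \<le> Suc (card I) * n"
proof -
  have "card (\<Union>i\<in>I. f i ` A i) \<le> (\<Sum>i\<in>I. card (f i ` A i))" by (rule card_UN_le) fact
  also have "\<dots> \<le> (\<Sum>i\<in>I. n)" using card_image_le[OF A(1)] A(2) by (intro sum_mono) force
  finally have "card (\<Union>i\<in>I. f i ` A i) \<le> card I * n" by simp
  then show ?thesis
    using card_insert_le_m1[of "Suc (card I) * n" "\<Union>i\<in>I. f i ` A i" x] \<open>0 < n\<close> by simp
qed

text \<open>The classes partition \<open>V\<close>, so the lower bounds on the others leave only
  this much for the class \<open>c\<close>. Thus lower tails are the only events that the random
  colouring has to avoid.\<close>

lemma colour_class_upper:
  fixes \<gamma> :: real and N :: nat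
  assumes V: "finite V" "f \<in> V \<rightarrow> {..<N}" and c: "c < N" and \<gamma>: "0 \<le> \<gamma>"
    and lower: "\<And>c. c < N \<Longrightarrow> card V / N - \<gamma> \<le> real (card {u \<in> V. f u = c})"
  shows "real (card {u \<in> V. f u = c}) \<le> card V / N + N * \<gamma>"
proof -
  have "V = (\<Union>c<N. {u \<in> V. f u = c})" using V(2) by auto
  then have "card V = card (\<Union>c<N. {u \<in> V. f u = c})" by simp
  also have "\<dots> = (\<Sum>c<N. card {u \<in> V. f u = c})"
    using V(1) by (intro card_UN_disjoint) auto
  also have "\<dots> = card {u \<in> V. f u = c} + (\<Sum>c\<in>{..<N} - {c}. card {u \<in> V. f u = c})"
    using c by (intro sum.remove) auto
  finally have "real (card V) = card {u \<in> V. f u = c} + (\<Sum>c\<in>{..<N} - {c}. real (card {u \<in> V. f u = c}))"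
    by simp
  also have "\<dots> \<ge> card {u \<in> V. f u = c} + (\<Sum>c\<in>{..<N} - {c}. card V / N - \<gamma>)"
    using lower by (intro add_left_mono sum_mono) auto
  finally have 1: "card {u \<in> V. f u = c} + (real N - 1) * (card V / N - \<gamma>) \<le> card V"
    using c by (simp add: of_nat_diff)
  have "(real N - 1) * (v - \<gamma>) = real N * v - v - (real N - 1) * \<gamma>" for v
    by (simp add: algebra_simps)
  moreover have "real N * (card V / N) = card V" using c by simp
  ultimately have "(real N - 1) * (card V / N - \<gamma>) = card V - card V / N - (real N - 1) * \<gamma>"
    by metis
  then show ?thesis using 1 \<gamma> by (simp add: algebra_simps)
qed

section \<open>First-fit matching against an adversary\<close>

definition first_fit :: "('b \<Rightarrow> 'c set) \<Rightarrow> (nat \<Rightarrow> 'c set) \<Rightarrow> nat \<Rightarrow> nat \<Rightarrow> 'b \<Rightarrow> 'c set \<Rightarrow> nat" where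
  "first_fit N F p h u U = (LEAST g. g < p \<and> h \<le> card (N u \<inter> F g - U))"

definition servable :: "('b \<Rightarrow> 'c set) \<Rightarrow> (nat \<Rightarrow> 'c set) \<Rightarrow> nat \<Rightarrow> nat \<Rightarrow> 'b \<Rightarrow> 'c set \<Rightarrow> bool" where
  "servable N F p h u U \<longleftrightarrow> (\<exists>g<p. h \<le> card (N u \<inter> F g - U))"

lemma first_fitD:
  assumes "servable N F p h u U"
  shows "first_fit N F p h u U < p" "h \<le> card (N u \<inter> F (first_fit N F p h u U) - U)"
proof -
  have "first_fit N F p h u U < p \<and> h \<le> card (N u \<inter> F (first_fit N F p h u U) - U)"
    unfolding first_fit_def by (rule LeastI_ex) (use assms in \<open>auto simp: servable_def\<close>)
  then show "first_fit N F p h u U < p" "h \<le> card (N u \<inter> F (first_fit N F p h u U) - U)" by auto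
qed

lemma first_fit_le: "g < p \<Longrightarrow> h \<le> card (N u \<inter> F g - U) \<Longrightarrow> first_fit N F p h u U \<le> g"
  unfolding first_fit_def by (rule Least_le) simp

text \<open>A leaf \<open>b s\<close> is matched to each centre \<open>a s\<close> in turn, where an adversary chooses \<open>b s\<close> within the
  earliest piece in which \<open>a s\<close> still has \<open>h\<close> unused neighbours. Since degrees exceed one half, a piece
  is at least half used before the next one is touched, and in every slot of \<open>S\<close> centres more than
  half of them reuse the touched pieces as long as these have many unused vertices. Hence the
  number of unused vertices in touched pieces stays bounded.\<close>

locale first_fit_play =
  fixes N :: "'b \<Rightarrow> 'c set" and F :: "nat \<Rightarrow> 'c set" and p h f S q d :: nat
    and a :: "nat \<Rightarrow> 'b" and b :: "nat \<Rightarrow> 'c" and e :: nat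
  assumes finF: "g < p \<Longrightarrow> finite (F g)"
    and disjF: "disjoint_family_on F {..<p}"
    and cardF: "g < p \<Longrightarrow> card (F g) \<le> f"
    and half: "s < q * S \<Longrightarrow> g < p \<Longrightarrow> card (F g) + 2 * h \<le> 2 * card (N (a s) \<inter> F g)"
    and slot: "r < q \<Longrightarrow> x \<in> (\<Union>g<p. F g) \<Longrightarrow> d \<le> card {i \<in> {..<S}. x \<in> N (a (r * S + i))}"
    and d: "S + f + 2 * p * h \<le> 2 * d" and h: "1 \<le> h" and fS: "f \<le> S" and S: "1 \<le> S"
    and total: "q * S + 5 * S < card (\<Union>g<p. F g)"
    and e: "e < q * S"
    and play: "s < e \<Longrightarrow> servable N F p h (a s) (b ` {..<s}) \<and>
      b s \<in> N (a s) \<inter> F (first_fit N F p h (a s) (b ` {..<s})) - b ` {..<s}"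
begin

definition idx :: "nat \<Rightarrow> nat" where "idx s = first_fit N F p h (a s) (b ` {..<s})"

definition front :: "nat \<Rightarrow> nat" where "front t = Max (insert 0 ((\<lambda>s. Suc (idx s)) ` {..<t}))"

abbreviation touched :: "nat \<Rightarrow> 'c set" where "touched t \<equiv> \<Union>g<front t. F g"

abbreviation fresh :: "nat \<Rightarrow> nat \<Rightarrow> nat set" where
  "fresh t0 t \<equiv> {s \<in> {t0..<t}. b s \<notin> touched t0}"

definition garbage :: "nat \<Rightarrow> 'c set" where "garbage t = (touched t) - b ` {..<t}"

lemma idx_less: "s < e \<Longrightarrow> idx s < p"
  unfolding idx_def by (rule first_fitD(1)[OF conjunct1[OF play]])

lemma b_in: "s < e \<Longrightarrow> b s \<in> N (a s) \<inter> F (idx s) - b ` {..<s}"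
  unfolding idx_def by (rule conjunct2[OF play])

lemma idx_front: assumes "s < t" shows "idx s < front t"
proof -
  have "Suc (idx s) \<le> front t" unfolding front_def using assms by (intro Max_ge) simp_all
  then show ?thesis by simp
qed

lemma front_mono: "s \<le> t \<Longrightarrow> front s \<le> front t"
  unfolding front_def by (intro Max_mono insert_mono image_mono) simp_all

lemma front_cases: "front t = 0 \<or> (\<exists>s<t. front t = Suc (idx s))"
proof -
  have "front t \<in> insert 0 ((\<lambda>s. Suc (idx s)) ` {..<t})" unfolding front_def by (rule Max_in) auto
  then show ?thesis by auto
qed

lemma front_le: "t \<le> e \<Longrightarrow> front t \<le> p"
proof -
  assume "t \<le> e"
  then show ?thesis using front_cases[of t] idx_less by (auto simp: Suc_le_eq)
qed

lemma disjF': "g < p \<Longrightarrow> g' < p \<Longrightarrow> x \<in> F g \<Longrightarrow> x \<in> F g' \<Longrightarrow> g = g'"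
  using disjoint_family_onD[OF disjF, of g g'] by (metis disjoint_iff lessThan_iff)

lemma inj_b: "t \<le> e \<Longrightarrow> inj_on b {..<t}"
proof (rule inj_onI)
  fix x y assume t: "t \<le> e" and xy: "x \<in> {..<t}" "y \<in> {..<t}" "b x = b y"
  have neq: "b u \<noteq> b v" if "u < v" "v < t" for u v
  proof -
    have "b u \<in> b ` {..<v}" using that by simp
    moreover have "b v \<notin> b ` {..<v}" using b_in[of v] that t by simp
    ultimately show ?thesis by metis
  qed
  show "x = y" using neq[of x y] neq[of y x] xy by (cases x y rule: linorder_cases) auto
qed

lemma used_subset:
  assumes "t \<le> e" shows "b ` {..<t} \<subseteq> (touched t)"
proof
  fix x assume "x \<in> b ` {..<t}"
  then obtain s where s: "s < t" "x = b s" by blast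
  then have "x \<in> F (idx s)" using b_in[of s] assms by auto
  then show "x \<in> (touched t)" using idx_front[OF s(1)] by (intro UN_I[of "idx s"]) simp_all
qed

lemma half_used:
  assumes g: "Suc g < front t" and t: "t \<le> e"
  shows "card (F g - b ` {..<t}) \<le> card (F g \<inter> b ` {..<t})"
proof -
  obtain s where s: "s < t" "front t = Suc (idx s)" using front_cases[of t] g by auto
  have gi: "g < idx s" using s g by simp
  have se: "s < e" using s t by simp
  have gp: "g < p" using gi idx_less[OF se] by simp
  have fin: "finite (F g)" by (rule finF[OF gp])
  have "card (N (a s) \<inter> F g - b ` {..<s}) < h"
  proof (rule ccontr)
    assume "\<not> ?thesis"
    then have "idx s \<le> g" unfolding idx_def by (intro first_fit_le gp) simp
    then show False using gi by simp
  qed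
  moreover have "card (N (a s) \<inter> F g) \<le> card (N (a s) \<inter> F g - b ` {..<s}) + card (F g \<inter> b ` {..<s})"
  proof -
    have "N (a s) \<inter> F g \<subseteq> (N (a s) \<inter> F g - b ` {..<s}) \<union> (F g \<inter> b ` {..<s})" by blast
    then have "card (N (a s) \<inter> F g) \<le> card ((N (a s) \<inter> F g - b ` {..<s}) \<union> (F g \<inter> b ` {..<s}))"
      using fin by (intro card_mono) auto
    then show ?thesis using card_Un_le order_trans by blast
  qed
  moreover have "card (F g) + 2 * h \<le> 2 * card (N (a s) \<inter> F g)" using se e by (intro half gp) simp
  moreover have "card (F g \<inter> b ` {..<s}) \<le> card (F g \<inter> b ` {..<t})"
    using fin s by (intro card_mono) auto
  moreover have "card (F g) = card (F g - b ` {..<t}) + card (F g \<inter> b ` {..<t})"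
    using fin by (metis add.commute card_Int_Diff)
  ultimately show ?thesis by linarith
qed

lemma new_garbage:
  assumes t: "t0 \<le> t" "t \<le> e"
  shows "card (\<Union>g\<in>{front t0..<front t}. F g - b ` {..<t})
    \<le> card (fresh t0 t) + f"
proof (cases "front t0 < front t")
  case True
  define m where "m = front t - 1"
  have m: "front t = Suc m" "front t0 \<le> m" using True by (auto simp: m_def)
  have mp: "m < p" using front_le[OF t(2)] m by simp
  have fin: "finite (F g)" if "g \<le> m" for g using that mp finF by simp
  have split: "{front t0..<front t} = insert m {front t0..<m}" using m by auto
  have "card (\<Union>g\<in>{front t0..<front t}. F g - b ` {..<t})
      \<le> card (F m - b ` {..<t}) + card (\<Union>g\<in>{front t0..<m}. F g - b ` {..<t})"
    unfolding split UN_insert by (rule card_Un_le)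
  also have "card (F m - b ` {..<t}) \<le> f"
    using card_mono[of "F m" "F m - b ` {..<t}"] fin[of m] cardF[OF mp] by auto
  also have "card (\<Union>g\<in>{front t0..<m}. F g - b ` {..<t}) \<le> (\<Sum>g\<in>{front t0..<m}. card (F g - b ` {..<t}))"
    by (rule card_UN_le) simp
  also have "\<dots> \<le> (\<Sum>g\<in>{front t0..<m}. card (F g \<inter> b ` {..<t}))"
    using m t by (intro sum_mono half_used) auto
  also have "\<dots> = card (\<Union>g\<in>{front t0..<m}. F g \<inter> b ` {..<t})"
  proof (rule card_UN_disjoint[symmetric])
    show "\<forall>g\<in>{front t0..<m}. finite (F g \<inter> b ` {..<t})" by simp
    show "\<forall>g\<in>{front t0..<m}. \<forall>g'\<in>{front t0..<m}. g \<noteq> g' \<longrightarrow> (F g \<inter> b ` {..<t}) \<inter> (F g' \<inter> b ` {..<t}) = {}"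
    proof (intro ballI impI)
      fix g g' assume "g \<in> {front t0..<m}" "g' \<in> {front t0..<m}" "g \<noteq> g'"
      then have "F g \<inter> F g' = {}" using disjF'[of g g'] mp by auto
      then show "(F g \<inter> b ` {..<t}) \<inter> (F g' \<inter> b ` {..<t}) = {}" by blast
    qed
  qed simp
  also have "\<dots> \<le> card (b ` (fresh t0 t))"
  proof (rule card_mono, simp, rule subsetI)
    fix x assume "x \<in> (\<Union>g\<in>{front t0..<m}. F g \<inter> b ` {..<t})"
    then obtain g s where g: "front t0 \<le> g" "g < m" "x \<in> F g" "s < t" "x = b s" by auto
    have bs: "b s \<in> F (idx s)" using b_in[of s] g t by auto
    have "idx s = g" using disjF'[of "idx s" g] bs g idx_less[of s] t mp by auto
    then have "\<not> s < t0" using idx_front[of s t0] g by auto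
    moreover have "b s \<notin> (touched t0)"
    proof
      assume "b s \<in> (touched t0)"
      then obtain g' where g': "g' < front t0" "b s \<in> F g'" by blast
      then show False using disjF'[of g' g "b s"] g mp by auto
    qed
    ultimately show "x \<in> b ` (fresh t0 t)" using g by auto
  qed
  also have "\<dots> \<le> card (fresh t0 t)" by (rule card_image_le) simp
  finally show ?thesis by simp
qed simp

text \<open>A step that is not fresh consumes a vertex of \<open>garbage t0\<close>, while new
  garbage is limited by \<open>new_garbage\<close>. The first bound exploits this consumption; the
  second is better when little of the old garbage survives.\<close>

lemma garbage_step:
  assumes t: "t0 \<le> t" "t \<le> e"
  shows "card (garbage t) + (t - t0) \<le> card (garbage t0) + 2 * card (fresh t0 t) + f"
    and "card (garbage t) \<le> card (garbage t0 - b ` {..<t}) + card (fresh t0 t) + f"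
proof -
  define u where "u = card (fresh t0 t)"
  have fin0: "finite (touched t0)" using finF front_le[of t0] t by auto
  have "front t0 \<le> front t" by (rule front_mono[OF t(1)])
  then have "{..<front t} = {..<front t0} \<union> {front t0..<front t}" by auto
  then have "garbage t \<subseteq> (garbage t0 - b ` {..<t}) \<union> (\<Union>g\<in>{front t0..<front t}. F g - b ` {..<t})"
    using t unfolding garbage_def by auto
  moreover have "finite ((garbage t0 - b ` {..<t}) \<union> (\<Union>g\<in>{front t0..<front t}. F g - b ` {..<t}))"
    using fin0 finF front_le[OF t(2)] unfolding garbage_def by auto
  ultimately have "card (garbage t) \<le> card (garbage t0 - b ` {..<t}) + card (\<Union>g\<in>{front t0..<front t}. F g - b ` {..<t})"
    by (meson card_Un_le card_mono order_trans)
  then show 2: "card (garbage t) \<le> card (garbage t0 - b ` {..<t}) + u + f"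
    using new_garbage[OF t] unfolding u_def by linarith
  have "{s \<in> {t0..<t}. b s \<in> (touched t0)} \<union> (fresh t0 t) = {t0..<t}" by blast
  moreover have "card ({s \<in> {t0..<t}. b s \<in> (touched t0)} \<union> (fresh t0 t))
     = card {s \<in> {t0..<t}. b s \<in> (touched t0)} + u"
    unfolding u_def by (rule card_Un_disjoint) auto
  ultimately have 3: "card {s \<in> {t0..<t}. b s \<in> (touched t0)} + u = t - t0" by simp
  have "card {s \<in> {t0..<t}. b s \<in> (touched t0)} = card (b ` {s \<in> {t0..<t}. b s \<in> (touched t0)})"
    by (rule card_image[symmetric], rule inj_on_subset[OF inj_b[OF t(2)]]) auto
  also have "\<dots> \<le> card (garbage t0 \<inter> b ` {..<t})"
  proof (rule card_mono)
    show "finite (garbage t0 \<inter> b ` {..<t})" by simp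
    show "b ` {s \<in> {t0..<t}. b s \<in> (touched t0)} \<subseteq> garbage t0 \<inter> b ` {..<t}"
    proof
      fix x assume "x \<in> b ` {s \<in> {t0..<t}. b s \<in> (touched t0)}"
      then obtain s where s: "t0 \<le> s" "s < t" "x = b s" "b s \<in> (touched t0)" by auto
      have "b s \<notin> b ` {..<t0}" using b_in[of s] s t by auto
      then show "x \<in> garbage t0 \<inter> b ` {..<t}" using s unfolding garbage_def by auto
    qed
  qed
  finally have 4: "card {s \<in> {t0..<t}. b s \<in> (touched t0)} \<le> card (garbage t0 \<inter> b ` {..<t})" .
  have "card (garbage t0) = card (garbage t0 \<inter> b ` {..<t}) + card (garbage t0 - b ` {..<t})"
    using fin0 unfolding garbage_def by (intro card_Int_Diff) auto
  then show "card (garbage t) + (t - t0) \<le> card (garbage t0) + 2 * u + f" using 2 3 4 by linarith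
qed

lemma fresh_le: "card (fresh t0 t) \<le> t - t0"
proof -
  have "card (fresh t0 t) \<le> card {t0..<t}" by (rule card_mono) auto
  then show ?thesis by simp
qed

lemma slot_uses_garbage:
  assumes r: "r * S + S \<le> e" and big: "S \<le> card (garbage (r * S) - b ` {..<r * S + S})"
  shows "card (fresh (r * S) (r * S + S)) + d \<le> S + p * h"
proof -
  define t0 where "t0 = r * S"
  define X where "X = garbage t0 - b ` {..<t0 + S}"
  define good where "good = {i \<in> {..<S}. p * h \<le> card (N (a (t0 + i)) \<inter> X)}"
  have rq: "r < q"
  proof (rule ccontr)
    assume "\<not> r < q"
    then have "q * S \<le> r * S" by simp
    then show False using r e by linarith
  qed
  have fp: "front t0 \<le> p" using front_le[of t0] r by (simp add: t0_def)
  have finX: "finite X" using finF fp unfolding X_def garbage_def by auto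
  have Xsub: "X \<subseteq> (touched t0)" by (auto simp: X_def garbage_def)
  have cX: "S \<le> card X" using big by (simp add: X_def t0_def)
  have "d * card X \<le> (\<Sum>x\<in>X. card {i \<in> {..<S}. x \<in> N (a (t0 + i))})"
  proof -
    have "(\<Sum>x\<in>X. d) \<le> (\<Sum>x\<in>X. card {i \<in> {..<S}. x \<in> N (a (t0 + i))})"
    proof (rule sum_mono)
      fix x assume "x \<in> X"
      then have "x \<in> (\<Union>g<p. F g)" using Xsub fp by fastforce
      from slot[OF rq this] show "d \<le> card {i \<in> {..<S}. x \<in> N (a (t0 + i))}" by (simp add: t0_def)
    qed
    then show ?thesis by (simp add: mult.commute)
  qed
  also have "\<dots> = (\<Sum>i<S. card (N (a (t0 + i)) \<inter> X))"
  proof -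
    have "(\<Sum>x\<in>X. card {i \<in> {..<S}. x \<in> N (a (t0 + i))}) = (\<Sum>x\<in>X. \<Sum>i<S. of_bool (x \<in> N (a (t0 + i))))"
      by (intro sum.cong) (auto simp: Int_def)
    also have "\<dots> = (\<Sum>i<S. \<Sum>x\<in>X. of_bool (x \<in> N (a (t0 + i))))" by (rule sum.swap)
    also have "\<dots> = (\<Sum>i<S. card (N (a (t0 + i)) \<inter> X))"
      using finX by (intro sum.cong) (auto simp: Int_def conj_commute)
    finally show ?thesis .
  qed
  also have "\<dots> \<le> (\<Sum>i<S. of_bool (i \<in> good) * card X + p * h)"
  proof (rule sum_mono)
    fix i assume "i \<in> {..<S}"
    have "card (N (a (t0 + i)) \<inter> X) \<le> card X" using finX by (intro card_mono) auto
    then show "card (N (a (t0 + i)) \<inter> X) \<le> of_bool (i \<in> good) * card X + p * h"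
      using \<open>i \<in> {..<S}\<close> by (auto simp: good_def)
  qed
  also have "\<dots> = card good * card X + S * (p * h)"
  proof -
    have "{..<S} \<inter> good = good" by (auto simp: good_def)
    then show ?thesis by (simp add: sum.distrib flip: sum_distrib_right)
  qed
  also have "\<dots> \<le> card good * card X + card X * (p * h)" using cX by (intro add_left_mono mult_le_mono1)
  also have "\<dots> = (card good + p * h) * card X" by (simp add: algebra_simps)
  finally have dgood: "d \<le> card good + p * h" using cX S by simp
  have "b (t0 + i) \<in> (touched t0)" if i: "i \<in> good" for i
  proof -
    have iS: "i < S" and ph: "p * h \<le> card (N (a (t0 + i)) \<inter> X)" using i by (auto simp: good_def)
    have se: "t0 + i < e" using iS r by (simp add: t0_def)
    obtain g where g: "g < front t0" "h \<le> card (N (a (t0 + i)) \<inter> X \<inter> F g)"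
    proof (rule ccontr)
      assume neg: "\<not> thesis"
      then have small: "card (N (a (t0 + i)) \<inter> X \<inter> F g) \<le> h - 1" if "g < front t0" for g
        using that \<open>\<And>g. g < front t0 \<Longrightarrow> h \<le> card (N (a (t0 + i)) \<inter> X \<inter> F g) \<Longrightarrow> thesis\<close> by force
      have "N (a (t0 + i)) \<inter> X = (\<Union>g<front t0. N (a (t0 + i)) \<inter> X \<inter> F g)" using Xsub by blast
      then have "card (N (a (t0 + i)) \<inter> X) \<le> (\<Sum>g<front t0. card (N (a (t0 + i)) \<inter> X \<inter> F g))"
        by (metis card_UN_le finite_lessThan)
      also have "\<dots> \<le> (\<Sum>g<front t0. h - 1)" by (intro sum_mono small) simp
      also have "\<dots> \<le> p * (h - 1)" using fp by simp
      finally have "p * h \<le> p * (h - 1)" using ph by linarith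
      then have "p = 0" using h by (cases "p = 0") auto
      then have "X = {}" using Xsub fp by auto
      then show False using cX S by simp
    qed
    have "N (a (t0 + i)) \<inter> X \<inter> F g \<subseteq> N (a (t0 + i)) \<inter> F g - b ` {..<t0 + i}"
      using iS by (auto simp: X_def)
    then have "h \<le> card (N (a (t0 + i)) \<inter> F g - b ` {..<t0 + i})"
      using g fp finF by (meson card_mono finite_Diff finite_Int order_less_le_trans order_trans)
    then have "idx (t0 + i) \<le> g" unfolding idx_def using g fp by (intro first_fit_le) auto
    then have "idx (t0 + i) < front t0" using g by simp
    moreover have "b (t0 + i) \<in> F (idx (t0 + i))" using b_in[OF se] by blast
    ultimately show ?thesis by blast
  qed
  then have "(fresh t0 (t0 + S)) \<subseteq> (\<lambda>i. t0 + i) ` ({..<S} - good)"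
  proof -
    assume A: "\<And>i. i \<in> good \<Longrightarrow> b (t0 + i) \<in> (touched t0)"
    show ?thesis
    proof
      fix s assume s: "s \<in> (fresh t0 (t0 + S))"
      then have "s - t0 \<notin> good" using A[of "s - t0"] by auto
      then show "s \<in> (\<lambda>i. t0 + i) ` ({..<S} - good)" using s by (intro image_eqI[of _ _ "s - t0"]) auto
    qed
  qed
  then have "card (fresh t0 (t0 + S)) \<le> card ((\<lambda>i. t0 + i) ` ({..<S} - good))"
    by (intro card_mono) auto
  also have "\<dots> \<le> card ({..<S} - good)" by (rule card_image_le) simp
  also have "\<dots> = S - card good" by (subst card_Diff_subset) (auto simp: good_def)
  finally have "card (fresh t0 (t0 + S)) \<le> S - card good" .
  moreover have "card good \<le> S" using card_mono[of "{..<S}" good] by (auto simp: good_def)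
  ultimately show ?thesis using dgood by (simp add: t0_def)
qed

text \<open>If at least \<open>S\<close> vertices of the old garbage survive the slot, then
  \<open>d\<close> forces twice the number of fresh steps plus \<open>f\<close> to be at most
  \<open>S\<close>, and the garbage does not grow. Otherwise less than \<open>S\<close> old
  vertices, at most \<open>S\<close> for the fresh steps and \<open>f \<le> S\<close> remain, hence
  the factor 3.\<close>

lemma garbage_small: "r * S \<le> e \<Longrightarrow> card (garbage (r * S)) \<le> 3 * S"
proof (induction r)
  case 0
  have "front 0 = 0" by (simp add: front_def)
  then show ?case by (simp add: garbage_def)
next
  case (Suc r)
  have t: "r * S \<le> r * S + S" "r * S + S \<le> e" using Suc.prems by auto
  define u where "u = card (fresh (r * S) (r * S + S))"
  have u: "u \<le> S" using fresh_le[of "r * S" "r * S + S"] by (simp add: u_def)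
  have IH: "card (garbage (r * S)) \<le> 3 * S" using Suc by simp
  have "card (garbage (r * S + S)) \<le> 3 * S"
  proof (cases "S \<le> card (garbage (r * S) - b ` {..<r * S + S})")
    case True
    then show ?thesis
      using slot_uses_garbage[OF t(2) True] garbage_step(1)[OF t] d IH unfolding u_def[symmetric] by linarith
  next
    case False
    then show ?thesis using garbage_step(2)[OF t] u fS unfolding u_def[symmetric] by linarith
  qed
  then show ?case by (simp add: add.commute)
qed

text \<open>Within a slot the garbage rises from at most \<open>3 * S\<close> to at most
  \<open>5 * S\<close>, which explains \<open>total\<close>: used vertices and garbage together
  cannot fill all pieces. In an untouched piece every centre has \<open>h\<close> neighbours by
  \<open>half\<close>.\<close>

lemma survives: "servable N F p h (a e) (b ` {..<e})"
proof -
  define r where "r = e div S"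
  have r: "r * S \<le> e" "e < r * S + S"
    using S dividend_less_div_times[of S e] by (auto simp: r_def)
  have "card (garbage e) \<le> 5 * S"
    using garbage_step(1)[OF r(1) order_refl] garbage_small[OF r(1)] fresh_le[of "r * S" e] fS r by linarith
  moreover have fe: "front e \<le> p" by (rule front_le) simp
  moreover have "card (touched e) \<le> card (b ` {..<e}) + card (garbage e)"
  proof -
    have "(touched e) \<subseteq> b ` {..<e} \<union> garbage e" by (auto simp: garbage_def)
    moreover have "finite (b ` {..<e} \<union> garbage e)" using finF fe by (auto simp: garbage_def)
    ultimately show ?thesis by (meson card_Un_le card_mono order_trans)
  qed
  moreover have "card (b ` {..<e}) \<le> e" using card_image_le[of "{..<e}" b] by simp
  ultimately have "card (touched e) < card (\<Union>g<p. F g)" using total e by linarith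
  then have "front e \<noteq> p" by auto
  then have fp: "front e < p" using fe by simp
  define g where "g = front e"
  have "F g \<inter> b ` {..<e} = {}"
  proof (rule ccontr)
    assume "F g \<inter> b ` {..<e} \<noteq> {}"
    then obtain x where x: "x \<in> F g" "x \<in> b ` {..<e}" by blast
    then obtain g' where "g' < front e" "x \<in> F g'" using used_subset[OF order_refl] by blast
    then show False using disjF'[of g' g x] x fp by (simp add: g_def)
  qed
  then have "N (a e) \<inter> F g - b ` {..<e} = N (a e) \<inter> F g" by blast
  moreover have "h \<le> card (N (a e) \<inter> F g)" using half[OF e, of g] fp by (simp add: g_def)
  ultimately show ?thesis using fp unfolding servable_def g_def by auto
qed

end

section \<open>Tilings, links and absorbers\<close>

text \<open>Greedy choice: the sets selected so far join the forbidden set, and the budget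
  \<open>N\<close> pays for all of them.\<close>

lemma disjoint_selection:
  assumes "finite J"
    and ex: "\<And>i Q. i \<in> J \<Longrightarrow> finite Q \<Longrightarrow> card Q \<le> N \<Longrightarrow>
      \<exists>B. B \<inter> Q = {} \<and> finite B \<and> card B \<le> c \<and> P i B"
    and "finite Q" "card Q + c * card J \<le> N"
  shows "\<exists>B. (\<forall>i\<in>J. B i \<inter> Q = {} \<and> finite (B i) \<and> card (B i) \<le> c \<and> P i (B i)) \<and> disjoint_family_on B J"
  using assms
proof (induction J rule: finite_induct)
  case empty
  then show ?case by (auto simp: disjoint_family_on_def)
next
  case (insert i J)
  have "\<exists>B. (\<forall>i\<in>J. B i \<inter> Q = {} \<and> finite (B i) \<and> card (B i) \<le> c \<and> P i (B i)) \<and> disjoint_family_on B J"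
    by (rule insert.IH) (use insert in \<open>auto intro: order_trans[rotated]\<close>)
  then obtain B where B: "\<And>i. i \<in> J \<Longrightarrow> B i \<inter> Q = {} \<and> finite (B i) \<and> card (B i) \<le> c \<and> P i (B i)"
    "disjoint_family_on B J" by blast
  define Q' where "Q' = Q \<union> \<Union>(B ` J)"
  have "card (\<Union>(B ` J)) \<le> (\<Sum>j\<in>J. card (B j))" using insert by (intro card_UN_le) auto
  also have "\<dots> \<le> (\<Sum>j\<in>J. c)" using B by (intro sum_mono) auto
  finally have "card Q' \<le> card Q + c * card J"
    unfolding Q'_def using card_Un_le[of Q "\<Union>(B ` J)"] by (simp add: mult.commute)
  also have "\<dots> \<le> N" using insert by (auto simp: algebra_simps)
  finally have "card Q' \<le> N" .
  moreover have "finite Q'" using insert B by (auto simp: Q'_def)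
  ultimately obtain C where C: "C \<inter> Q' = {}" "finite C" "card C \<le> c" "P i C"
    using insert.prems(1)[of i Q'] by blast
  have "disjoint_family_on (B(i := C)) (insert i J)"
    using B(2) C(1) insert(2) unfolding disjoint_family_on_def Q'_def by (auto split: if_splits)
  moreover have "\<forall>j\<in>insert i J. (B(i := C)) j \<inter> Q = {} \<and> finite ((B(i := C)) j) \<and> card ((B(i := C)) j) \<le> c \<and> P j ((B(i := C)) j)"
    using B(1) C by (auto simp: Q'_def)
  ultimately show ?case by blast
qed

lemma card_Diff_ge: "finite Q \<Longrightarrow> N + h \<le> card A \<Longrightarrow> card Q \<le> N \<Longrightarrow> h \<le> card (A - Q)"
  using diff_card_le_card_Diff[of Q A] by linarith

text \<open>Cauchy-Schwarz for the number \<open>c t\<close> of sets through \<open>t\<close>. The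
  average of \<open>c\<close> is at least \<open>a\<close>, and its square sum counts the pairs of
  sets through a common point.\<close>

lemma pair_intersections_lower_bound:
  fixes N :: "'b \<Rightarrow> 'c set" and d :: real
  assumes fin: "finite X" "finite T" and N: "\<And>x. x \<in> X \<Longrightarrow> N x \<subseteq> T"
    and d: "0 \<le> d" "\<And>x. x \<in> X \<Longrightarrow> d * card T \<le> card (N x)"
  shows "d\<^sup>2 * (card X)\<^sup>2 * card T \<le> (\<Sum>x\<in>X. \<Sum>y\<in>X. real (card (N x \<inter> N y)))"
proof -
  define a where "a = d * card X"
  define c where "c t = (\<Sum>x\<in>X. of_bool (t \<in> N x) :: real)" for t :: 'c
  have card_eq: "real (card (N x \<inter> M)) = (\<Sum>t\<in>T. of_bool (t \<in> N x) * of_bool (t \<in> M))" if "x \<in> X" for x M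
  proof -
    have "(\<Sum>t\<in>T. of_bool (t \<in> N x) * of_bool (t \<in> M)) = (\<Sum>t\<in>N x \<inter> M. (1::real))"
      using fin N[OF that] by (intro sum.mono_neutral_cong_right) auto
    then show ?thesis by simp
  qed
  have "(\<Sum>t\<in>T. c t) = (\<Sum>x\<in>X. \<Sum>t\<in>T. of_bool (t \<in> N x))"
    unfolding c_def by (rule sum.swap)
  also have "\<dots> = (\<Sum>x\<in>X. real (card (N x)))"
    using card_eq[of _ UNIV] by (intro sum.cong) auto
  also have "\<dots> \<ge> (\<Sum>x\<in>X. d * card T)" by (intro sum_mono d(2))
  finally have 1: "a * card T \<le> (\<Sum>t\<in>T. c t)" by (simp add: a_def mult_ac)
  have "(\<Sum>x\<in>X. \<Sum>y\<in>X. real (card (N x \<inter> N y))) = (\<Sum>x\<in>X. \<Sum>y\<in>X. \<Sum>t\<in>T. of_bool (t \<in> N x) * of_bool (t \<in> N y))"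
    using card_eq by (intro sum.cong) auto
  also have "\<dots> = (\<Sum>x\<in>X. \<Sum>t\<in>T. \<Sum>y\<in>X. of_bool (t \<in> N x) * of_bool (t \<in> N y))"
    by (intro sum.cong refl sum.swap)
  also have "\<dots> = (\<Sum>t\<in>T. \<Sum>x\<in>X. \<Sum>y\<in>X. of_bool (t \<in> N x) * of_bool (t \<in> N y))"
    by (rule sum.swap)
  also have "\<dots> = (\<Sum>t\<in>T. c t * c t)" by (simp only: c_def sum_product)
  finally have 2: "(\<Sum>x\<in>X. \<Sum>y\<in>X. real (card (N x \<inter> N y))) = (\<Sum>t\<in>T. c t * c t)" .
  have "0 \<le> (\<Sum>t\<in>T. (c t - a)\<^sup>2)" by (intro sum_nonneg) auto
  also have "\<dots> = (\<Sum>t\<in>T. c t * c t) - 2 * a * (\<Sum>t\<in>T. c t) + a\<^sup>2 * card T"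
  proof -
    have "(c t - a)\<^sup>2 = c t * c t - 2 * a * c t + a\<^sup>2" for t
      by (simp add: power2_eq_square algebra_simps)
    then show ?thesis by (simp add: sum.distrib sum_subtractf sum_distrib_left)
  qed
  finally have 3: "2 * a * (\<Sum>t\<in>T. c t) - a\<^sup>2 * card T \<le> (\<Sum>t\<in>T. c t * c t)" by simp
  have "2 * a * (a * card T) \<le> 2 * a * (\<Sum>t\<in>T. c t)"
    using 1 d(1) by (intro mult_left_mono) (auto simp: a_def)
  with 3 have "a\<^sup>2 * card T \<le> (\<Sum>t\<in>T. c t * c t)" by (simp add: power2_eq_square)
  then show ?thesis using 2 by (simp add: a_def power_mult_distrib)
qed

section \<open>k-partite graphs, transversal cliques and tilings\<close>

locale kpartite =
  fixes k n :: nat and V :: "nat \<Rightarrow> 'a set" and E :: "'a set set"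
  assumes k3: "k \<ge> 3" and disjV: "disjoint_family_on V {1..k}"
    and finV: "i \<in> {1..k} \<Longrightarrow> finite (V i)" and cardV: "i \<in> {1..k} \<Longrightarrow> card (V i) = n"
begin

definition nb :: "nat \<Rightarrow> 'a \<Rightarrow> 'a set" where "nb i v = {u \<in> V i. {v, u} \<in> E}"

definition VV :: "'a set" where "VV = (\<Union>i\<in>{1..k}. V i)"

definition tile :: "'a set \<Rightarrow> bool" where
  "tile A \<longleftrightarrow> (\<exists>F. (\<forall>W\<in>F. transversal_clique {1..k} V E W) \<and> disjoint F \<and> \<Union>F = A)"

definition clq :: "nat set \<Rightarrow> (nat \<Rightarrow> 'a) \<Rightarrow> bool" where
  "clq J c \<longleftrightarrow> (\<forall>i\<in>J. c i \<in> V i) \<and> (\<forall>i\<in>J. \<forall>j\<in>J. i \<noteq> j \<longrightarrow> {c i, c j} \<in> E)"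

text \<open>Sets of size at least \<open>h\<close> are allowed, so that the condition applies
  directly to neighbourhoods with forbidden vertices removed.\<close>

definition hole_free :: "nat set \<Rightarrow> nat \<Rightarrow> bool" where
  "hole_free J h \<longleftrightarrow> (\<forall>U. (\<forall>j\<in>J. U j \<subseteq> V j \<and> h \<le> card (U j)) \<longrightarrow> (\<exists>c. clq J c \<and> (\<forall>j\<in>J. c j \<in> U j)))"

lemma part_unique: "u \<in> V i \<Longrightarrow> u \<in> V j \<Longrightarrow> i \<in> {1..k} \<Longrightarrow> j \<in> {1..k} \<Longrightarrow> i = j"
  using disjoint_family_onD[OF disjV, of i j] by blast

lemma finite_VV: "finite VV" using finV by (auto simp: VV_def)

lemma nb_subset: "nb i v \<subseteq> V i" by (auto simp: nb_def)

lemma finite_nb: "i \<in> {1..k} \<Longrightarrow> finite (nb i v)" by (rule finite_subset[OF nb_subset finV])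

lemma has_factor_iff: "has_transversal_factor k V E \<longleftrightarrow> tile VV"
  by (simp add: has_transversal_factor_def tile_def VV_def)

lemma tile_empty: "tile {}" unfolding tile_def by (intro exI[of _ "{}"]) simp

lemma tile_Un: assumes "tile A" "tile B" "A \<inter> B = {}" shows "tile (A \<union> B)"
proof -
  obtain F G where F: "\<forall>W\<in>F. transversal_clique {1..k} V E W" "disjoint F" "\<Union>F = A"
    and G: "\<forall>W\<in>G. transversal_clique {1..k} V E W" "disjoint G" "\<Union>G = B"
    using assms unfolding tile_def by blast
  have "disjoint (F \<union> G)"
    using F(2,3) G(2,3) assms(3) unfolding disjoint_def by blast
  then show ?thesis unfolding tile_def using F G by (intro exI[of _ "F \<union> G"]) auto
qed

lemma tile_UN:
  assumes "finite J" "\<And>i. i \<in> J \<Longrightarrow> tile (A i)" "disjoint_family_on A J"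
  shows "tile (\<Union>i\<in>J. A i)"
  using assms
proof (induction J rule: finite_induct)
  case empty
  then show ?case by (simp add: tile_empty)
next
  case (insert i J)
  have "tile (A i \<union> (\<Union>i\<in>J. A i))"
    by (rule tile_Un) (use insert in \<open>auto simp: disjoint_family_on_def\<close>)
  then show ?case by simp
qed

lemma transversal_clique_image:
  assumes "clq {1..k} c" shows "transversal_clique {1..k} V E (c ` {1..k})"
proof -
  have c: "\<And>i. i \<in> {1..k} \<Longrightarrow> c i \<in> V i" using assms by (simp add: clq_def)
  have "c ` {1..k} \<inter> V i = {c i}" if i: "i \<in> {1..k}" for i
    using c part_unique[OF c _ _ i] i by blast
  then show ?thesis using assms c unfolding transversal_clique_def is_clique_def clq_def
    by (auto simp: card_1_singleton_iff)
qed

lemma tile_clq: assumes "clq {1..k} c" shows "tile (c ` {1..k})"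
  unfolding tile_def
proof (intro exI conjI)
  show "\<forall>W\<in>{c ` {1..k}}. transversal_clique {1..k} V E W"
    using transversal_clique_image[OF assms] by blast
  show "disjoint {c ` {1..k}}" by simp
  show "\<Union>{c ` {1..k}} = c ` {1..k}" by blast
qed

lemma tile_subset: assumes "tile A" shows "A \<subseteq> VV"
proof -
  obtain F where F: "\<forall>W\<in>F. transversal_clique {1..k} V E W" "\<Union>F = A"
    using assms unfolding tile_def by blast
  have "W \<subseteq> VV" if "W \<in> F" for W
    using F(1) that unfolding transversal_clique_def VV_def by (elim ballE conjE) auto
  then show ?thesis using F(2) by blast
qed

text \<open>Each clique of a tiling has exactly one vertex per part. Whatever a tiling leaves of
  equally large sets is therefore again equally large, which is used whenever leftovers are
  counted.\<close>

lemma tile_balanced: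
  assumes "tile A" "i \<in> {1..k}" "j \<in> {1..k}"
  shows "card (A \<inter> V i) = card (A \<inter> V j)"
proof -
  obtain F where F: "\<forall>W\<in>F. transversal_clique {1..k} V E W" "disjoint F" "\<Union>F = A"
    using assms unfolding tile_def by blast
  have finA: "finite A" using tile_subset[OF assms(1)] finite_VV finite_subset by blast
  then have finF: "finite F" using F(3) by (metis finite_UnionD)
  have "card (A \<inter> V i) = card F" if i: "i \<in> {1..k}" for i
  proof -
    have "A \<inter> V i = (\<Union>W\<in>F. W \<inter> V i)" using F(3) by blast
    also have "card \<dots> = (\<Sum>W\<in>F. card (W \<inter> V i))"
      using finF F(2) finV[OF i] unfolding disjoint_def by (intro card_UN_disjoint) auto
    also have "\<dots> = (\<Sum>W\<in>F. 1)"
      using F(1) i unfolding transversal_clique_def by (intro sum.cong) auto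
    finally show ?thesis by simp
  qed
  then show ?thesis using assms by simp
qed

text \<open>Sets inside the neighbourhoods of a prescribed vertex turn a condition on
  \<open>k - 1\<close> parts into a clique meeting all \<open>k\<close> parts.\<close>

lemma clq_center:
  assumes H: "hole_free ({1..k} - {i}) h" and i: "i \<in> {1..k}" "v \<in> V i"
    and U: "\<And>j. j \<in> {1..k} - {i} \<Longrightarrow> U j \<subseteq> nb j v \<and> h \<le> card (U j)"
  shows "\<exists>c. clq {1..k} c \<and> c i = v \<and> (\<forall>j\<in>{1..k} - {i}. c j \<in> U j)"
proof -
  obtain c where c: "clq ({1..k} - {i}) c" "\<And>j. j \<in> {1..k} - {i} \<Longrightarrow> c j \<in> U j"
    using H[unfolded hole_free_def, rule_format, of U] U nb_subset by blast
  have adj: "{v, c j} \<in> E" if "j \<in> {1..k} - {i}" for j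
    using c(2)[OF that] U[OF that] by (auto simp: nb_def)
  then have "clq {1..k} (c(i := v))"
    using c(1) i unfolding clq_def by (auto simp: insert_commute)
  then show ?thesis using c(2) by (intro exI[of _ "c(i := v)"]) auto
qed

text \<open>The forbidden set \<open>Q\<close> is meant to contain \<open>u\<close> and \<open>v\<close> (respectively the vertices of \<open>x\<close>).\<close>

definition link :: "nat \<Rightarrow> nat \<Rightarrow> 'a \<Rightarrow> 'a \<Rightarrow> bool" where
  "link N b u v \<longleftrightarrow> (\<forall>Q. finite Q \<longrightarrow> card Q \<le> N \<longrightarrow>
     (\<exists>B. B \<inter> Q = {} \<and> finite B \<and> card B \<le> b \<and> tile (insert u B) \<and> tile (insert v B)))"

definition absorb :: "nat \<Rightarrow> nat \<Rightarrow> (nat \<Rightarrow> 'a) \<Rightarrow> bool" where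
  "absorb N b x \<longleftrightarrow> (\<forall>Q. finite Q \<longrightarrow> card Q \<le> N \<longrightarrow>
     (\<exists>B. B \<inter> Q = {} \<and> finite B \<and> card B \<le> b \<and> tile B \<and> tile (B \<union> x ` {1..k})))"

text \<open>The absorber of \<open>x\<close> consists of a clique \<open>y\<close> and of link gadgets between \<open>y i\<close> and \<open>x i\<close>: switching
  all gadgets from \<open>y i\<close> to \<open>x i\<close> releases the clique \<open>y\<close>.\<close>

lemma absorb_from_links:
  assumes x: "\<And>i. i \<in> {1..k} \<Longrightarrow> x i \<in> V i" and J: "J \<subseteq> {1..k}"
    and ex: "\<And>Q. finite Q \<Longrightarrow> card Q \<le> N + k \<Longrightarrow>
      \<exists>y. clq {1..k} y \<and> (\<forall>i\<in>J. y i \<notin> Q \<and> link M b (y i) (x i)) \<and> (\<forall>i\<in>{1..k} - J. y i = x i)"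
    and NM: "N + 2 * k + b * k \<le> M"
  shows "absorb N (k + b * k) x"
  unfolding absorb_def
proof (intro allI impI)
  fix Q :: "'a set" assume Q: "finite Q" "card Q \<le> N"
  have cardk: "card (f ` {1..k}) \<le> k" for f :: "nat \<Rightarrow> 'a" using card_image_le[of "{1..k}" f] by simp
  define Q1 where "Q1 = Q \<union> x ` {1..k}"
  have Q1: "finite Q1" "card Q1 \<le> N + k"
    using Q cardk[of x] card_Un_le[of Q "x ` {1..k}"] by (auto simp: Q1_def)
  obtain y where y: "clq {1..k} y" "\<And>i. i \<in> J \<Longrightarrow> y i \<notin> Q1" "\<And>i. i \<in> J \<Longrightarrow> link M b (y i) (x i)"
    "\<And>i. i \<in> {1..k} - J \<Longrightarrow> y i = x i" using ex[OF Q1] by blast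
  have yV: "y i \<in> V i" if "i \<in> {1..k}" for i using y(1) that by (simp add: clq_def)
  define Q2 where "Q2 = Q1 \<union> y ` {1..k}"
  have Q2: "finite Q2" "card Q2 \<le> N + k + k"
    using Q1 cardk[of y] card_Un_le[of Q1 "y ` {1..k}"] by (auto simp: Q2_def)
  have finJ: "finite J" and cJ: "card J \<le> k" using J finite_subset card_mono[of "{1..k}" J] by auto
  have "\<exists>B. (\<forall>i\<in>J. B i \<inter> Q2 = {} \<and> finite (B i) \<and> card (B i) \<le> b \<and> (tile (insert (y i) (B i)) \<and> tile (insert (x i) (B i)))) \<and> disjoint_family_on B J"
  proof (rule disjoint_selection[OF finJ])
    show "card Q2 + b * card J \<le> M"
      using Q2 NM mult_le_mono2[OF cJ, of b] by linarith
  qed (use y(3) Q2 in \<open>auto simp: link_def\<close>)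
  then obtain B where B: "\<And>i. i \<in> J \<Longrightarrow> B i \<inter> Q2 = {}" "\<And>i. i \<in> J \<Longrightarrow> finite (B i)" "\<And>i. i \<in> J \<Longrightarrow> card (B i) \<le> b"
     "\<And>i. i \<in> J \<Longrightarrow> tile (insert (y i) (B i))" "\<And>i. i \<in> J \<Longrightarrow> tile (insert (x i) (B i))" "disjoint_family_on B J" by blast
  define C where "C = y ` J \<union> (\<Union>i\<in>J. B i)"
  have "tile (\<Union>i\<in>J. insert (y i) (B i))"
  proof (rule tile_UN[OF finJ B(4)])
    show "disjoint_family_on (\<lambda>i. insert (y i) (B i)) J"
    proof (unfold disjoint_family_on_def, intro ballI impI)
      fix i j assume ij: "i \<in> J" "j \<in> J" "i \<noteq> j"
      have "y i \<noteq> y j" using yV[of i] yV[of j] part_unique[of "y i" i j] ij subsetD[OF J] by metis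
      moreover have "B i \<inter> B j = {}" using B(6) ij by (auto simp: disjoint_family_on_def)
      moreover have "y i \<in> Q2" "y j \<in> Q2" using ij J by (auto simp: Q2_def)
      ultimately show "insert (y i) (B i) \<inter> insert (y j) (B j) = {}"
        using B(1)[OF ij(1)] B(1)[OF ij(2)] by auto
    qed
  qed
  moreover have "(\<Union>i\<in>J. insert (y i) (B i)) = C" by (auto simp: C_def)
  ultimately have tC: "tile C" by simp
  have "tile ((\<Union>i\<in>J. insert (x i) (B i)) \<union> y ` {1..k})"
  proof (rule tile_Un[OF tile_UN[OF finJ B(5)] tile_clq[OF y(1)]])
    show "disjoint_family_on (\<lambda>i. insert (x i) (B i)) J"
    proof (unfold disjoint_family_on_def, intro ballI impI)
      fix i j assume ij: "i \<in> J" "j \<in> J" "i \<noteq> j"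
      have "x i \<noteq> x j" using x[of i] x[of j] part_unique[of "x i" i j] ij subsetD[OF J] by metis
      moreover have "B i \<inter> B j = {}" using B(6) ij by (auto simp: disjoint_family_on_def)
      moreover have "x i \<in> Q2" "x j \<in> Q2" using ij J by (auto simp: Q2_def Q1_def)
      ultimately show "insert (x i) (B i) \<inter> insert (x j) (B j) = {}"
        using B(1)[OF ij(1)] B(1)[OF ij(2)] by auto
    qed
    have "x i \<notin> y ` {1..k}" if i: "i \<in> J" for i
    proof
      assume "x i \<in> y ` {1..k}"
      then obtain j where j: "j \<in> {1..k}" "x i = y j" by blast
      then have "j = i" using part_unique[of "y j" j i] yV[of j] x[of i] i subsetD[OF J] by metis
      moreover have "x i \<in> Q1" using i J by (auto simp: Q1_def)
      ultimately show False using y(2)[OF i] j(2) by simp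
    qed
    then show "(\<Union>i\<in>J. insert (x i) (B i)) \<inter> y ` {1..k} = {}"
      using B(1) unfolding Q2_def by blast
  qed
  moreover have "(\<Union>i\<in>J. insert (x i) (B i)) \<union> y ` {1..k} = C \<union> x ` {1..k}"
  proof -
    have "f ` {1..k} = f ` J \<union> f ` ({1..k} - J)" for f :: "nat \<Rightarrow> 'a" using J by blast
    moreover have "y ` ({1..k} - J) = x ` ({1..k} - J)" using y(4) by (intro image_cong) auto
    ultimately have "y ` {1..k} \<union> x ` J = y ` J \<union> x ` {1..k}" by (metis Un_assoc Un_commute)
    then show ?thesis unfolding C_def by auto
  qed
  ultimately have tCx: "tile (C \<union> x ` {1..k})" by simp
  have "card C \<le> card (y ` J) + card (\<Union>i\<in>J. B i)" unfolding C_def by (rule card_Un_le)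
  also have "card (y ` J) \<le> k" using card_image_le[OF finJ, of y] cJ by simp
  also have "card (\<Union>i\<in>J. B i) \<le> (\<Sum>i\<in>J. card (B i))" by (rule card_UN_le[OF finJ])
  also have "\<dots> \<le> (\<Sum>i\<in>J. b)" using B(3) by (intro sum_mono) auto
  also have "\<dots> \<le> b * k" using cJ by (simp add: mult.commute)
  finally have "card C \<le> k + b * k" by simp
  moreover have "C \<inter> Q = {}" using y(2) B(1) unfolding C_def Q2_def Q1_def by blast
  moreover have "finite C" using finJ B(2) by (auto simp: C_def)
  ultimately show "\<exists>B. B \<inter> Q = {} \<and> finite B \<and> card B \<le> k + b * k \<and> tile B \<and> tile (B \<union> x ` {1..k})"
    using tC tCx by blast
qed

text \<open>If \<open>w\<close> can be completed by either \<open>p\<close> or \<open>q\<close> to an absorbable tuple, then \<open>w\<close> together with both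
  absorbers is a gadget exchanging \<open>p\<close> and \<open>q\<close>.\<close>

lemma link_from_absorb:
  assumes pq: "i \<in> {1..k}" "p \<in> V i" "q \<in> V i"
    and ex: "\<And>Q. finite Q \<Longrightarrow> card Q \<le> N \<Longrightarrow>
      \<exists>w. (\<forall>j\<in>{1..k} - {i}. w j \<in> V j - Q) \<and> absorb M b (w(i := p)) \<and> absorb M b (w(i := q))"
    and NM: "N + k + 2 + b \<le> M"
  shows "link N (k + 2 * b) p q"
  unfolding link_def
proof (intro allI impI)
  fix Q :: "'a set" assume Q: "finite Q" "card Q \<le> N"
  obtain w where w: "\<And>j. j \<in> {1..k} - {i} \<Longrightarrow> w j \<in> V j - Q" "absorb M b (w(i := p))" "absorb M b (w(i := q))"
    using ex[OF Q] by blast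
  define T where "T = w ` ({1..k} - {i})"
  have cT: "card T \<le> k" unfolding T_def using card_image_le[of "{1..k} - {i}" w] pq by simp
  have finT: "finite T" by (simp add: T_def)
  have im: "(w(i := v)) ` {1..k} = insert v T" for v using pq by (auto simp: T_def)
  define Q1 where "Q1 = Q \<union> insert p (insert q T)"
  have Q1: "finite Q1" using Q finT by (simp add: Q1_def)
  have "card (insert p (insert q T)) \<le> k + 2" using cT finT by (simp add: card_insert_if)
  then have cQ1: "card Q1 \<le> N + k + 2" unfolding Q1_def using card_Un_le[of Q "insert p (insert q T)"] Q by linarith
  obtain B1 where B1: "B1 \<inter> Q1 = {}" "finite B1" "card B1 \<le> b" "tile B1" "tile (B1 \<union> insert p T)"
    using w(2)[unfolded absorb_def im, rule_format, of Q1] Q1 cQ1 NM by auto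
  define Q2 where "Q2 = Q1 \<union> B1"
  have Q2: "finite Q2" "card Q2 \<le> M"
    using Q1 cQ1 B1 NM card_Un_le[of Q1 B1] by (auto simp: Q2_def)
  obtain B2 where B2: "B2 \<inter> Q2 = {}" "finite B2" "card B2 \<le> b" "tile B2" "tile (B2 \<union> insert q T)"
    using w(3)[unfolded absorb_def im, rule_format, of Q2] Q2 by auto
  have "tile ((B1 \<union> insert p T) \<union> B2)" "tile ((B2 \<union> insert q T) \<union> B1)"
  proof -
    have "(B1 \<union> insert p T) \<inter> B2 = {}" "(B2 \<union> insert q T) \<inter> B1 = {}"
      using B1(1) B2(1) unfolding Q2_def Q1_def by blast+
    then show "tile ((B1 \<union> insert p T) \<union> B2)" "tile ((B2 \<union> insert q T) \<union> B1)"
      using B1(4,5) B2(4,5) tile_Un by blast+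
  qed
  moreover have "(B1 \<union> insert p T) \<union> B2 = insert p (B1 \<union> B2 \<union> T)" "(B2 \<union> insert q T) \<union> B1 = insert q (B1 \<union> B2 \<union> T)" by auto
  moreover have "card (B1 \<union> B2 \<union> T) \<le> k + 2 * b"
    using card_Un_le[of "B1 \<union> B2" T] card_Un_le[of B1 B2] B1(3) B2(3) cT by linarith
  moreover have "(B1 \<union> B2 \<union> T) \<inter> Q = {}" using B1(1) B2(1) w(1) unfolding Q2_def Q1_def T_def by blast
  ultimately show "\<exists>B. B \<inter> Q = {} \<and> finite B \<and> card B \<le> k + 2 * b \<and> tile (insert p B) \<and> tile (insert q B)"
    using B1(2) B2(2) finT by (intro exI[of _ "B1 \<union> B2 \<union> T"]) auto
qed

text \<open>A clique on \<open>k - 1\<close> parts inside the common neighbourhoods is completed by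
  \<open>p\<close> as well as by \<open>q\<close>. The \<open>N\<close> extra common neighbours pay
  for the forbidden set.\<close>

lemma link_common:
  assumes H: "hole_free ({1..k} - {i}) h" and i: "i \<in> {1..k}" "p \<in> V i" "q \<in> V i"
    and common: "\<And>j. j \<in> {1..k} - {i} \<Longrightarrow> N + h \<le> card (nb j p \<inter> nb j q)"
  shows "link N k p q"
  unfolding link_def
proof (intro allI impI)
  fix Q :: "'a set" assume Q: "finite Q" "card Q \<le> N"
  define U where "U j = nb j p \<inter> nb j q - Q" for j
  have U: "U j \<subseteq> V j \<and> h \<le> card (U j)" if "j \<in> {1..k} - {i}" for j
    using card_Diff_ge[OF Q(1) common[OF that] Q(2)] nb_subset by (auto simp: U_def)
  then obtain c where c: "clq ({1..k} - {i}) c" "\<And>j. j \<in> {1..k} - {i} \<Longrightarrow> c j \<in> U j"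
    using H[unfolded hole_free_def, rule_format, of U] by blast
  have "tile (insert v (c ` ({1..k} - {i})))" if v: "v \<in> V i" "\<And>j. j \<in> {1..k} - {i} \<Longrightarrow> c j \<in> nb j v" for v
  proof -
    have "clq {1..k} (c(i := v))"
      using c(1) v unfolding clq_def by (auto simp: nb_def insert_commute)
    moreover have "(c(i := v)) ` {1..k} = insert v (c ` ({1..k} - {i}))" using i by auto
    ultimately show ?thesis using tile_clq by metis
  qed
  then have "tile (insert p (c ` ({1..k} - {i})))" "tile (insert q (c ` ({1..k} - {i})))"
    using c(2) i by (auto simp: U_def)
  moreover have "card (c ` ({1..k} - {i})) \<le> k"
    using card_image_le[of "{1..k} - {i}" c] i by simp
  moreover have "c ` ({1..k} - {i}) \<inter> Q = {}" using c(2) unfolding U_def by blast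
  ultimately show "\<exists>B. B \<inter> Q = {} \<and> finite B \<and> card B \<le> k \<and> tile (insert p B) \<and> tile (insert q B)" by blast
qed

text \<open>The intermediate clique required by \<open>absorb_from_links\<close> is built around any
  vertex of the first part outside \<open>Q\<close>. As all pairs in a part are linked, each of its
  vertices can be exchanged with the entry of \<open>x\<close> in that part.\<close>

lemma absorb_from_all_links:
  assumes H: "\<And>i. i \<in> {1..k} \<Longrightarrow> hole_free ({1..k} - {i}) h"
    and deg: "\<And>i j v. i \<in> {1..k} \<Longrightarrow> j \<in> {1..k} \<Longrightarrow> i \<noteq> j \<Longrightarrow> v \<in> V i \<Longrightarrow> N + k + h \<le> card (nb j v)"
    and links: "\<And>i u v. i \<in> {1..k} \<Longrightarrow> u \<in> V i \<Longrightarrow> v \<in> V i \<Longrightarrow> link M b u v"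
    and NM: "N + 2 * k + b * k \<le> M" and n: "N + k < n"
    and x: "\<And>i. i \<in> {1..k} \<Longrightarrow> x i \<in> V i"
  shows "absorb N (k + b * k) x"
proof (rule absorb_from_links[OF x order_refl _ NM])
  fix Q :: "'a set" assume Q: "finite Q" "card Q \<le> N + k"
  have one: "1 \<in> {1..k}" using k3 by simp
  have "\<not> V 1 \<subseteq> Q" using card_mono[OF Q(1), of "V 1"] cardV[OF one] Q n by auto
  then obtain v where v: "v \<in> V 1" "v \<notin> Q" by blast
  have "\<exists>c. clq {1..k} c \<and> c 1 = v \<and> (\<forall>j\<in>{1..k} - {1}. c j \<in> nb j v - Q)"
  proof (rule clq_center[OF H[OF one] one v(1)])
    fix j assume "j \<in> {1..k} - {1}"
    then have "N + k + h \<le> card (nb j v)" using deg[OF one _ _ v(1)] by auto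
    then show "nb j v - Q \<subseteq> nb j v \<and> h \<le> card (nb j v - Q)"
      using card_Diff_ge[OF Q(1) _ Q(2)] by blast
  qed
  then obtain c where c: "clq {1..k} c" "c 1 = v" "\<And>j. j \<in> {1..k} - {1} \<Longrightarrow> c j \<in> nb j v - Q" by blast
  have "c i \<notin> Q" if "i \<in> {1..k}" for i using c(2,3) v that by (cases "i = 1") auto
  moreover have "link M b (c i) (x i)" if "i \<in> {1..k}" for i
    using links c(1) x that by (auto simp: clq_def)
  ultimately show "\<exists>y. clq {1..k} y \<and> (\<forall>i\<in>{1..k}. y i \<notin> Q \<and> link M b (y i) (x i)) \<and> (\<forall>i\<in>{1..k} - {1..k}. y i = x i)"
    using c(1) by blast
qed

section \<open>Twins and popular vertices\<close>

lemma link_sym: "link N b u v \<Longrightarrow> link N b v u"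
  unfolding link_def by blast

text \<open>The twins of \<open>x\<close>: for suitable \<open>g\<close>, \<open>link_common\<close>
  links \<open>x\<close> directly to each of them.\<close>

definition hnb :: "nat \<Rightarrow> nat \<Rightarrow> 'a \<Rightarrow> 'a set" where
  "hnb g i x = {y \<in> V i. \<forall>j\<in>{1..k} - {i}. g \<le> card (nb j x \<inter> nb j y)}"

text \<open>Common neighbourhoods must be large in all other parts at once. So \<open>x\<close> is
  represented in the product \<open>T\<close> of these parts by the product \<open>Nx x\<close> of
  its neighbourhoods, of density at least \<delta>^(k-1). Pairs then intersect with average density
  at least \<delta>^(2(k-1)), whereas a pair that fails in a single part intersects with density at
  most \<eta>. Restricting to a subset \<open>X\<close> of the part is what
  \<open>few_unpopular_vertices\<close> exploits.\<close>

lemma exists_popular_vertex: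
  fixes \<delta> \<eta> :: real
  assumes i: "i \<in> {1..k}" and X: "X \<subseteq> V i" "X \<noteq> {}" and n: "n > 0" and \<delta>: "\<delta> > 0" and \<eta>: "0 \<le> \<eta>"
    and deg: "\<And>x j. x \<in> X \<Longrightarrow> j \<in> {1..k} - {i} \<Longrightarrow> \<delta> * n \<le> real (card (nb j x))"
    and g: "real g \<le> \<eta> * n"
  shows "\<exists>x\<in>X. (\<delta> ^ (2 * (k - 1)) - \<eta>) * card X \<le> real (card (hnb g i x \<inter> X))"
proof (rule ccontr)
  assume "\<not> ?thesis"
  then have small: "real (card (hnb g i x \<inter> X)) < (\<delta> ^ (2 * (k - 1)) - \<eta>) * card X" if "x \<in> X" for x
    using that by force
  define J where "J = {1..k} - {i}"
  have J: "finite J" "card J = k - 1" using i by (auto simp: J_def)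
  have JV: "finite (V j)" "card (V j) = n" if "j \<in> J" for j using finV cardV that by (auto simp: J_def)
  define T where "T = PiE J V"
  define Nx where "Nx x = PiE J (\<lambda>j. nb j x)" for x
  have finX: "finite X" using X finV[OF i] finite_subset by blast
  have finT: "finite T" unfolding T_def using J JV by (intro finite_PiE) auto
  have cT: "card T = n ^ (k - 1)" unfolding T_def using J JV by (simp add: card_PiE)
  have sub: "Nx x \<subseteq> T" for x unfolding Nx_def T_def using nb_subset by (intro PiE_mono) auto
  have cN: "\<delta> ^ (k - 1) * card T \<le> card (Nx x)" if x: "x \<in> X" for x
  proof -
    have "\<delta> ^ (k - 1) * card T = (\<Prod>j\<in>J. \<delta> * n)" by (simp add: cT J power_mult_distrib)
    also have "\<dots> \<le> (\<Prod>j\<in>J. real (card (nb j x)))"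
      using deg[OF x] \<delta> by (intro prod_mono) (auto simp: J_def)
    also have "\<dots> = card (Nx x)" using J by (simp add: Nx_def card_PiE)
    finally show ?thesis .
  qed
  have pair: "real (card (Nx x \<inter> Nx y)) \<le> (if y \<in> hnb g i x then 1 else \<eta>) * card T" if y: "y \<in> X" for x y
  proof (cases "y \<in> hnb g i x")
    case True
    have "card (Nx x \<inter> Nx y) \<le> card T" using finT sub by (intro card_mono) auto
    then show ?thesis using True by simp
  next
    case False
    then obtain l where l: "l \<in> J" "card (nb l x \<inter> nb l y) < g" using y X by (force simp: hnb_def J_def)
    have "Nx x \<inter> Nx y = PiE J (\<lambda>j. nb j x \<inter> nb j y)" unfolding Nx_def by (simp add: PiE_Int)
    then have "real (card (Nx x \<inter> Nx y)) = (\<Prod>j\<in>J. real (card (nb j x \<inter> nb j y)))"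
      using J by (simp add: card_PiE)
    also have "\<dots> = card (nb l x \<inter> nb l y) * (\<Prod>j\<in>J - {l}. real (card (nb j x \<inter> nb j y)))"
      using J l by (simp add: prod.remove)
    also have "\<dots> \<le> (\<eta> * n) * (\<Prod>j\<in>J - {l}. real n)"
    proof (intro mult_mono prod_mono conjI)
      show "real (card (nb l x \<inter> nb l y)) \<le> \<eta> * n" using l g by linarith
      fix j assume "j \<in> J - {l}"
      then have "card (nb j x \<inter> nb j y) \<le> card (V j)"
        using JV by (intro card_mono) (auto simp: nb_def)
      then show "real (card (nb j x \<inter> nb j y)) \<le> real n" using JV \<open>j \<in> J - {l}\<close> by simp
    qed (use \<eta> in \<open>auto intro!: prod_nonneg\<close>)
    also have "\<dots> = \<eta> * n ^ (k - 1)"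
    proof -
      have "card J = Suc (card (J - {l}))" using J l by (metis card.remove)
      then show ?thesis using J by simp
    qed
    finally show ?thesis using False by (simp add: cT)
  qed
  have "(\<delta> ^ (k - 1))\<^sup>2 * (card X)\<^sup>2 * card T \<le> (\<Sum>x\<in>X. \<Sum>y\<in>X. real (card (Nx x \<inter> Nx y)))"
    by (rule pair_intersections_lower_bound[OF finX finT sub _ cN]) (use \<delta> in auto)
  also have "\<dots> \<le> (\<Sum>x\<in>X. \<Sum>y\<in>X. (if y \<in> hnb g i x then 1 else \<eta>) * card T)"
    by (intro sum_mono pair)
  also have "\<dots> \<le> (\<Sum>x\<in>X. (real (card (hnb g i x \<inter> X)) + \<eta> * card X) * card T)"
  proof (rule sum_mono)
    fix x assume "x \<in> X"
    have "(\<Sum>y\<in>X. (if y \<in> hnb g i x then 1 else \<eta>) * card T) = (\<Sum>y\<in>X. (if y \<in> hnb g i x then 1 else \<eta>)) * card T"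
      by (simp add: sum_distrib_right)
    also have "\<dots> \<le> (\<Sum>y\<in>X. of_bool (y \<in> hnb g i x) + \<eta>) * card T"
      using \<eta> by (intro mult_right_mono sum_mono) auto
    also have "(\<Sum>y\<in>X. of_bool (y \<in> hnb g i x) + \<eta>) = real (card (hnb g i x \<inter> X)) + \<eta> * card X"
      using finX by (simp add: sum.distrib Int_commute Int_def)
    finally show "(\<Sum>y\<in>X. (if y \<in> hnb g i x then 1 else \<eta>) * card T) \<le> (real (card (hnb g i x \<inter> X)) + \<eta> * card X) * card T" .
  qed
  also have "\<dots> < (\<Sum>x\<in>X. (\<delta> ^ (2 * (k - 1)) * card X) * card T)"
  proof (rule sum_strict_mono[OF finX X(2)])
    fix x assume x: "x \<in> X"
    show "(real (card (hnb g i x \<inter> X)) + \<eta> * card X) * card T < (\<delta> ^ (2 * (k - 1)) * card X) * card T"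
      using small[OF x] n by (intro mult_strict_right_mono) (auto simp: algebra_simps cT)
  qed
  also have "\<dots> = (\<delta> ^ (k - 1))\<^sup>2 * (card X)\<^sup>2 * card T"
    by (simp add: power_mult power2_eq_square mult_ac flip: power_add mult_2)
  finally show False by simp
qed

text \<open>Averaging within the set \<open>X\<close> of unpopular vertices finds one with at least
  \<delta>^(2(k-1)) / 2 times \<open>card X\<close> twins in \<open>X\<close>, although it has fewer
  than \<open>b\<close> twins altogether.\<close>

lemma few_unpopular_vertices:
  fixes \<delta> :: real
  assumes i: "i \<in> {1..k}" and n: "n > 0" and \<delta>: "\<delta> > 0"
    and deg: "\<And>x j. x \<in> V i \<Longrightarrow> j \<in> {1..k} - {i} \<Longrightarrow> \<delta> * n \<le> real (card (nb j x))"
    and g: "real g \<le> \<delta> ^ (2 * (k - 1)) / 2 * n"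
  shows "\<delta> ^ (2 * (k - 1)) / 2 * card {x \<in> V i. card (hnb g i x) < b} \<le> b"
proof (cases "{x \<in> V i. card (hnb g i x) < b} = {}")
  case True
  then have "card {x \<in> V i. card (hnb g i x) < b} = 0" by (simp only: card.empty)
  then show ?thesis by simp
next
  case False
  define X where "X = {x \<in> V i. card (hnb g i x) < b}"
  have "\<exists>x\<in>X. (\<delta> ^ (2 * (k - 1)) - \<delta> ^ (2 * (k - 1)) / 2) * card X \<le> real (card (hnb g i x \<inter> X))"
    using False deg \<delta> by (intro exists_popular_vertex[OF i _ _ n \<delta> _ _ g]) (auto simp: X_def)
  then obtain x where x: "x \<in> X" "(\<delta> ^ (2 * (k - 1)) - \<delta> ^ (2 * (k - 1)) / 2) * card X \<le> real (card (hnb g i x \<inter> X))"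
    by blast
  have "card (hnb g i x \<inter> X) \<le> card (hnb g i x)"
    using finV[OF i] by (intro card_mono) (auto simp: hnb_def)
  also have "\<dots> < b" using x by (simp add: X_def)
  finally have "real (card (hnb g i x \<inter> X)) \<le> b" by simp
  then show ?thesis using x(2) unfolding X_def[symmetric] by simp
qed

text \<open>Vertices with small degree may have disjoint neighbourhoods, so links are built in stages: from
  pairs with large common neighbourhoods to tuples and then pairs of popular vertices, then to tuples
  with one arbitrary entry, then to arbitrary pairs.\<close>

lemma absorb_all_of_hole_free:
  assumes H: "hole_free {1..k} h" and H1: "\<And>i. i \<in> {1..k} \<Longrightarrow> hole_free ({1..k} - {i}) h"
    and K: "K = 2 * k + 3 * k\<^sup>2 + 6 * k ^ 3 + 4 * k ^ 4 + 2"
    and unpopular: "\<And>i. i \<in> {1..k} \<Longrightarrow> card {x \<in> V i. card (hnb g i x) < b} \<le> m"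
    and g: "N + 5 * K + h \<le> g" and b: "N + 5 * K + h \<le> b" and n: "N + 5 * K + m < n"
    and deg: "\<And>i j v. i \<in> {1..k} \<Longrightarrow> j \<in> {1..k} \<Longrightarrow> i \<noteq> j \<Longrightarrow> v \<in> V i \<Longrightarrow> N + 5 * K + h + m \<le> card (nb j v)"
    and x: "\<And>i. i \<in> {1..k} \<Longrightarrow> x i \<in> V i"
  shows "absorb N K x"
proof -
  define popular where "popular i = {x \<in> V i. b \<le> card (hnb g i x)}" for i
  define a1 where "a1 = k + k * k"
  define l2 where "l2 = k + 2 * a1"
  define a3 where "a3 = k + l2 * k"
  define l4 where "l4 = k + 2 * a3"
  \<comment> \<open>\<open>K\<close> is \<open>k + l4 * k\<close> increased by k + 2. With this
    slack it also dominates what each stage takes away from the admissible size of forbidden sets,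
    so this size falls from \<open>N + 5 * K\<close> by at most \<open>K\<close> per stage.\<close>
  have a5: "k + l4 * k \<le> K"
    by (simp add: K l4_def a3_def l2_def a1_def algebra_simps power2_eq_square eval_nat_numeral)
  have Ks: "2 * k + k * k \<le> K" "k + 2 + a1 \<le> K" "2 * k + l2 * k \<le> K" "k + 2 + a3 \<le> K" "2 * k + l4 * k \<le> K" "k \<le> K"
    by (simp_all add: K l4_def a3_def l2_def a1_def algebra_simps power2_eq_square eval_nat_numeral)
  have pop: "card (V i) \<le> card (popular i) + m" if i: "i \<in> {1..k}" for i
  proof -
    have "V i = popular i \<union> {x \<in> V i. card (hnb g i x) < b}" by (auto simp: popular_def)
    then have "card (V i) \<le> card (popular i) + card {x \<in> V i. card (hnb g i x) < b}"
      by (metis card_Un_le)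
    then show ?thesis using unpopular[OF i] by linarith
  qed
  have hlink: "link (g - h) k x y" if "i \<in> {1..k}" "x \<in> V i" "y \<in> hnb g i x" for i x y
    by (rule link_common[OF H1 that(1,2)]) (use that g in \<open>auto simp: hnb_def\<close>)
  \<comment> \<open>Here cliques across all \<open>k\<close> parts are needed: the clique consists
    of twins of the entries of \<open>x\<close>, chosen in \<open>k\<close> prescribed sets with no
    centre to start from.\<close>
  have A: "absorb (N + 4 * K) a1 x" if x: "\<And>i. i \<in> {1..k} \<Longrightarrow> x i \<in> popular i" for x
    unfolding a1_def
  proof (rule absorb_from_links[where J = "{1..k}" and M = "g - h"])
    show "x i \<in> V i" if "i \<in> {1..k}" for i using x[OF that] by (simp add: popular_def)
    show "N + 4 * K + 2 * k + k * k \<le> g - h" using Ks g by linarith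
    fix Q :: "'a set" assume Q: "finite Q" "card Q \<le> N + 4 * K + k"
    have "hnb g i (x i) - Q \<subseteq> V i \<and> h \<le> card (hnb g i (x i) - Q)" if i: "i \<in> {1..k}" for i
      using card_Diff_ge[OF Q(1) _ Q(2), of h "hnb g i (x i)"] x[OF i] b Ks by (auto simp: popular_def hnb_def)
    then obtain y where y: "clq {1..k} y" "\<And>i. i \<in> {1..k} \<Longrightarrow> y i \<in> hnb g i (x i) - Q"
      using H[unfolded hole_free_def, rule_format, of "\<lambda>i. hnb g i (x i) - Q"] by blast
    have "y i \<notin> Q \<and> link (g - h) k (y i) (x i)" if i: "i \<in> {1..k}" for i
      using y(2)[OF i] hlink[OF i, of "x i" "y i"] x[OF i] by (auto simp: popular_def link_sym)
    then show "\<exists>y. clq {1..k} y \<and> (\<forall>i\<in>{1..k}. y i \<notin> Q \<and> link (g - h) k (y i) (x i)) \<and> (\<forall>i\<in>{1..k} - {1..k}. y i = x i)"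
      using y(1) by blast
  qed simp
  have pop_avoid: "\<exists>w. \<forall>j\<in>{1..k}. w j \<in> popular j - Q" if Q: "finite Q" "card Q \<le> N + 4 * K" for Q
  proof (rule bchoice, rule ballI)
    fix j assume j: "j \<in> {1..k}"
    have "\<not> popular j \<subseteq> Q" using card_mono[OF Q(1), of "popular j"] pop[OF j] cardV[OF j] n Q(2) by auto
    then show "\<exists>w. w \<in> popular j - Q" by blast
  qed
  have B: "link (N + 3 * K) l2 p q" if pq: "i \<in> {1..k}" "p \<in> popular i" "q \<in> popular i" for i p q
    unfolding l2_def
  proof (rule link_from_absorb[OF pq(1)])
    show "p \<in> V i" "q \<in> V i" using pq by (auto simp: popular_def)
    show "N + 3 * K + k + 2 + a1 \<le> N + 4 * K" using Ks by linarith
    fix Q :: "'a set" assume Q: "finite Q" "card Q \<le> N + 3 * K"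
    then have "card Q \<le> N + 4 * K" by linarith
    from pop_avoid[OF Q(1) this] obtain w where w: "\<And>j. j \<in> {1..k} \<Longrightarrow> w j \<in> popular j - Q" by blast
    have "absorb (N + 4 * K) a1 (w(i := p))" "absorb (N + 4 * K) a1 (w(i := q))"
      using w pq by (auto intro!: A)
    moreover have "\<forall>j\<in>{1..k} - {i}. w j \<in> V j - Q" using w by (auto simp: popular_def)
    ultimately show "\<exists>w. (\<forall>j\<in>{1..k} - {i}. w j \<in> V j - Q) \<and> absorb (N + 4 * K) a1 (w(i := p)) \<and> absorb (N + 4 * K) a1 (w(i := q))" by blast
  qed
  \<comment> \<open>The arbitrary entry \<open>u\<close> is kept and serves as the centre; only the
    other entries are exchanged, via popular neighbours of \<open>u\<close> and the links from
    \<open>B\<close>.\<close>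
  have C: "absorb (N + 2 * K) a3 (w(i := u))" if i: "i \<in> {1..k}" "u \<in> V i" and w: "\<And>j. j \<in> {1..k} - {i} \<Longrightarrow> w j \<in> popular j" for i u w
    unfolding a3_def
  proof (rule absorb_from_links[where J = "{1..k} - {i}" and M = "N + 3 * K"])
    show "(w(i := u)) j \<in> V j" if "j \<in> {1..k}" for j using w[of j] i that by (auto simp: popular_def)
    show "N + 2 * K + 2 * k + l2 * k \<le> N + 3 * K" using Ks by linarith
    fix Q :: "'a set" assume Q: "finite Q" "card Q \<le> N + 2 * K + k"
    have "\<exists>c. clq {1..k} c \<and> c i = u \<and> (\<forall>j\<in>{1..k} - {i}. c j \<in> nb j u \<inter> popular j - Q)"
    proof (rule clq_center[OF H1[OF i(1)] i])
      fix j assume j: "j \<in> {1..k} - {i}"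
      have "nb j u = (nb j u \<inter> popular j) \<union> (nb j u - popular j)" by blast
      then have "card (nb j u) \<le> card (nb j u \<inter> popular j) + card (nb j u - popular j)"
        by (metis card_Un_le)
      moreover have "card (nb j u - popular j) \<le> card {x \<in> V j. card (hnb g j x) < b}"
        using finV[of j] j by (intro card_mono) (auto simp: popular_def nb_def)
      moreover have "N + 5 * K + h + m \<le> card (nb j u)" using deg[OF i(1) _ _ i(2)] j by auto
      ultimately have "N + 2 * K + k + h \<le> card (nb j u \<inter> popular j)" using unpopular[of j] j Ks(6) by auto
      then show "nb j u \<inter> popular j - Q \<subseteq> nb j u \<and> h \<le> card (nb j u \<inter> popular j - Q)"
        using card_Diff_ge[OF Q(1) _ Q(2)] by blast
    qed
    then obtain c where c: "clq {1..k} c" "c i = u" "\<And>j. j \<in> {1..k} - {i} \<Longrightarrow> c j \<in> nb j u \<inter> popular j - Q" by blast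
    have "c j \<notin> Q \<and> link (N + 3 * K) l2 (c j) ((w(i := u)) j)" if "j \<in> {1..k} - {i}" for j
      using c(3)[OF that] B[of j "c j" "w j"] w[OF that] that by auto
    moreover have "\<forall>j\<in>{1..k} - ({1..k} - {i}). c j = (w(i := u)) j" using c(2) by auto
    ultimately show "\<exists>y. clq {1..k} y \<and> (\<forall>j\<in>{1..k} - {i}. y j \<notin> Q \<and> link (N + 3 * K) l2 (y j) ((w(i := u)) j)) \<and> (\<forall>j\<in>{1..k} - ({1..k} - {i}). y j = (w(i := u)) j)"
      using c(1) by blast
  qed blast
  have D: "link (N + K) l4 p q" if pq: "i \<in> {1..k}" "p \<in> V i" "q \<in> V i" for i p q
    unfolding l4_def
  proof (rule link_from_absorb[OF pq])
    show "N + K + k + 2 + a3 \<le> N + 2 * K" using Ks by linarith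
    fix Q :: "'a set" assume Q: "finite Q" "card Q \<le> N + K"
    then have "card Q \<le> N + 4 * K" by linarith
    from pop_avoid[OF Q(1) this] obtain w where w: "\<And>j. j \<in> {1..k} \<Longrightarrow> w j \<in> popular j - Q" by blast
    have "absorb (N + 2 * K) a3 (w(i := p))" "absorb (N + 2 * K) a3 (w(i := q))"
      using w pq by (auto intro!: C)
    moreover have "\<forall>j\<in>{1..k} - {i}. w j \<in> V j - Q" using w by (auto simp: popular_def)
    ultimately show "\<exists>w. (\<forall>j\<in>{1..k} - {i}. w j \<in> V j - Q) \<and> absorb (N + 2 * K) a3 (w(i := p)) \<and> absorb (N + 2 * K) a3 (w(i := q))" by blast
  qed
  have "absorb N (k + l4 * k) x"
  proof (rule absorb_from_all_links[OF H1 _ D _ _ x])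
    show "N + k + h \<le> card (nb j v)" if "i \<in> {1..k}" "j \<in> {1..k}" "i \<noteq> j" "v \<in> V i" for i j v
      using deg[OF that] Ks by linarith
    show "N + 2 * k + l4 * k \<le> N + K" using Ks by linarith
    show "N + k < n" using n Ks by linarith
  qed
  then show ?thesis using a5 unfolding absorb_def by (meson le_trans)
qed

text \<open>Take a largest tiled set. Its leftovers have the same size in all parts, so if one had
  more than \<open>h\<close> vertices, all would, and another clique could be added.\<close>

lemma greedy_cover:
  assumes H: "hole_free {1..k} h"
    and W: "\<And>j. j \<in> {1..k} \<Longrightarrow> W j \<subseteq> V j" "\<And>j. j \<in> {1..k} \<Longrightarrow> card (W j) = w"
  shows "\<exists>A. tile A \<and> A \<subseteq> (\<Union>j\<in>{1..k}. W j) \<and> (\<forall>j\<in>{1..k}. card (W j - A) \<le> h)"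
proof -
  have bound: "card A \<le> card VV" if "tile A" for A
    using tile_subset[OF that] finite_VV by (intro card_mono)
  have "\<exists>A. (tile A \<and> A \<subseteq> (\<Union>j\<in>{1..k}. W j)) \<and> (\<forall>A'. tile A' \<and> A' \<subseteq> (\<Union>j\<in>{1..k}. W j) \<longrightarrow> card A' \<le> card A)"
    by (rule ex_has_greatest_nat[of _ "{}" card "Suc (card VV)"])
       (use tile_empty bound in \<open>auto simp: less_Suc_eq_le\<close>)
  then obtain A where A: "tile A" "A \<subseteq> (\<Union>j\<in>{1..k}. W j)"
    and max: "\<And>A'. tile A' \<Longrightarrow> A' \<subseteq> (\<Union>j\<in>{1..k}. W j) \<Longrightarrow> card A' \<le> card A" by blast
  have finA: "finite A" using tile_subset[OF A(1)] finite_VV finite_subset by blast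
  have cW: "card (W j - A) = w - card (A \<inter> V j)" if j: "j \<in> {1..k}" for j
  proof -
    have "W i \<inter> V j \<subseteq> W j" if "i \<in> {1..k}" for i
      using part_unique[of _ i j] W(1)[OF that] that j by blast
    then have "A \<inter> V j = W j \<inter> A" using A(2) W(1)[OF j] by blast
    then show ?thesis using W(2)[OF j] finite_subset[OF W(1)[OF j] finV[OF j]]
      by (metis card_Diff_subset_Int finite_Int)
  qed
  have "card (W j - A) \<le> h" if j: "j \<in> {1..k}" for j
  proof (rule ccontr)
    assume "\<not> ?thesis"
    then have big: "h \<le> card (W i - A)" if i: "i \<in> {1..k}" for i
      using cW[OF i] cW[OF j] tile_balanced[OF A(1) i j] by simp
    have "\<exists>c. clq {1..k} c \<and> (\<forall>j\<in>{1..k}. c j \<in> W j - A)"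
      using H[unfolded hole_free_def, rule_format, of "\<lambda>j. W j - A"] W(1) big by blast
    then obtain c where c: "clq {1..k} c" "\<And>j. j \<in> {1..k} \<Longrightarrow> c j \<in> W j - A" by blast
    have disj: "A \<inter> c ` {1..k} = {}" using c(2) by blast
    have "tile (A \<union> c ` {1..k})" by (rule tile_Un[OF A(1) tile_clq[OF c(1)] disj])
    moreover have "A \<union> c ` {1..k} \<subseteq> (\<Union>j\<in>{1..k}. W j)" using A(2) c(2) by blast
    ultimately have "card (A \<union> c ` {1..k}) \<le> card A" by (rule max)
    then have "card (c ` {1..k}) = 0" using disj finA by (simp add: card_Un_disjoint)
    then show False using k3 by simp
  qed
  then show ?thesis using A by blast
qed

section \<open>A factor from absorbers and an almost perfect tiling\<close>

text \<open>These sets will be the deletable side of the templates. The degree condition allows any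
  vertex to become a centre with leaves in them.\<close>

definition flexible :: "(nat \<Rightarrow> 'a set) \<Rightarrow> nat \<Rightarrow> bool" where
  "flexible X d \<longleftrightarrow> (\<forall>j\<in>{1..k}. X j \<subseteq> V j) \<and>
     (\<forall>i\<in>{1..k}. \<forall>j\<in>{1..k} - {i}. \<forall>v\<in>V i. d \<le> card (nb j v \<inter> X j))"

lemma flexibleD:
  assumes "flexible X d"
  shows "j \<in> {1..k} \<Longrightarrow> X j \<subseteq> V j"
    and "i \<in> {1..k} \<Longrightarrow> j \<in> {1..k} - {i} \<Longrightarrow> v \<in> V i \<Longrightarrow> d \<le> card (nb j v \<inter> X j)"
  using assms unfolding flexible_def by simp_all

text \<open>At most \<open>e\<close> of the \<open>e + h\<close> neighbours of \<open>v\<close> in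
  each \<open>X j\<close> are occupied by \<open>S\<close>, so \<open>h\<close> remain. The counts
  per part serve both applications: a leftover vertex outside the sets \<open>X j\<close>, and
  padding by a vertex of \<open>X 1\<close>.\<close>

lemma extend_by_center:
  assumes H1: "\<forall>i\<in>{1..k}. hole_free ({1..k} - {i}) h" and X: "flexible X (e + h)"
    and S: "tile S" "\<forall>j\<in>{1..k}. card (S \<inter> X j) \<le> e"
    and v: "i \<in> {1..k}" "v \<in> V i" "v \<notin> S"
  shows "\<exists>C. C \<subseteq> (\<Union>j\<in>{1..k}. X j) \<and> v \<notin> C \<and> C \<inter> S = {} \<and> tile (insert v (S \<union> C)) \<and>
    (\<forall>j\<in>{1..k}. card (insert v (S \<union> C) \<inter> V j) = Suc (card (S \<inter> V j))) \<and>
    (\<forall>j\<in>{1..k}. card (C \<inter> V j) = (if j = i then 0 else 1))"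
proof -
  have finS: "finite S" using tile_subset[OF S(1)] finite_VV finite_subset by blast
  have "\<exists>c. clq {1..k} c \<and> c i = v \<and> (\<forall>j\<in>{1..k} - {i}. c j \<in> nb j v \<inter> X j - S)"
  proof (rule clq_center[OF bspec[OF H1 v(1)] v(1,2)])
    fix j assume j: "j \<in> {1..k} - {i}"
    have "nb j v \<inter> X j - S = nb j v \<inter> X j - (S \<inter> X j)" by blast
    moreover have "h \<le> card (nb j v \<inter> X j - (S \<inter> X j))"
      using flexibleD(2)[OF X v(1) j v(2)] S(2) finS j by (intro card_Diff_ge[of _ e]) auto
    ultimately show "nb j v \<inter> X j - S \<subseteq> nb j v \<and> h \<le> card (nb j v \<inter> X j - S)" by auto
  qed
  then obtain c where c: "clq {1..k} c" "c i = v" "\<And>j. j \<in> {1..k} - {i} \<Longrightarrow> c j \<in> nb j v \<inter> X j - S" by blast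
  have cV: "c j \<in> V j" if "j \<in> {1..k}" for j using c(1) that by (simp add: clq_def)
  have cS: "c j \<notin> S" if "j \<in> {1..k}" for j using c(2,3) v(3) that by (cases "j = i") auto
  have capV: "c ` M \<inter> V j = (if j \<in> M then {c j} else {})" if "M \<subseteq> {1..k}" "j \<in> {1..k}" for M j
    using part_unique[of "c _" _ j] cV that by (auto simp: subset_iff)
  define C where "C = c ` ({1..k} - {i})"
  have insC: "insert v (S \<union> C) = S \<union> c ` {1..k}" using c(2) v(1) by (auto simp: C_def)
  have disj: "S \<inter> c ` {1..k} = {}" using cS by blast
  have "card (insert v (S \<union> C) \<inter> V j) = Suc (card (S \<inter> V j))" if j: "j \<in> {1..k}" for j
  proof -
    have "insert v (S \<union> C) \<inter> V j = insert (c j) (S \<inter> V j)"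
      unfolding insC Int_Un_distrib2 capV[OF subset_refl j] using j by auto
    then show ?thesis using cS[OF j] finS by simp
  qed
  moreover have "card (C \<inter> V j) = (if j = i then 0 else 1)" if j: "j \<in> {1..k}" for j
    unfolding C_def capV[OF Diff_subset j] using j by auto
  moreover have "tile (insert v (S \<union> C))"
    unfolding insC by (rule tile_Un[OF S(1) tile_clq[OF c(1)] disj])
  moreover have "C \<subseteq> (\<Union>j\<in>{1..k}. X j)" using c(3) by (auto simp: C_def)
  moreover have "v \<notin> C"
  proof
    assume "v \<in> C"
    then obtain j where "j \<in> {1..k} - {i}" "v = c j" by (auto simp only: C_def)
    then show False using part_unique[of v i j] cV[of j] v by auto
  qed
  moreover have "C \<inter> S = {}" using cS by (auto simp: C_def)
  ultimately show ?thesis by (intro exI[of _ C] conjI ballI)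
qed

text \<open>Each of the \<open>k * l\<close> leftover vertices becomes a centre; the resulting
  cliques occupy \<open>k * l - l\<close> vertices of every \<open>X j\<close>. Cliques lying wholly
  in the flexible sets then raise this number to exactly \<open>e\<close>, since the templates
  tolerate deletions of one fixed size only.\<close>

lemma cover_leftover:
  assumes H1: "\<forall>i\<in>{1..k}. hole_free ({1..k} - {i}) h" and X: "flexible X (e + h)"
    and cX: "\<And>j. j \<in> {1..k} \<Longrightarrow> e \<le> card (X j)"
    and L: "L \<subseteq> VV - (\<Union>j\<in>{1..k}. X j)" "\<And>j. j \<in> {1..k} \<Longrightarrow> card (L \<inter> V j) = l" "k * l \<le> e"
  shows "\<exists>R. R \<subseteq> (\<Union>j\<in>{1..k}. X j) \<and> (\<forall>j\<in>{1..k}. card (R \<inter> V j) = e) \<and> tile (L \<union> R)"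
proof -
  note XV = flexibleD(1)[OF X]
  define XX where "XX = (\<Union>j\<in>{1..k}. X j)"
  have XXV: "XX \<inter> V j = X j" if j: "j \<in> {1..k}" for j
  proof -
    have "X i \<inter> V j \<subseteq> X j" if "i \<in> {1..k}" for i
      using part_unique[of _ i j] XV[OF that] that j by blast
    then show ?thesis using XV[OF j] j unfolding XX_def by blast
  qed
  have finsub: "finite A" if "A \<subseteq> VV" for A using finite_VV that finite_subset by blast
  have cover: "\<exists>R. R \<subseteq> XX \<and> tile (L' \<union> R) \<and> (\<forall>j\<in>{1..k}. card ((L' \<union> R) \<inter> V j) = card L')"
    if "finite L'" "L' \<subseteq> VV - XX" "card L' \<le> e" for L'
    using that
  proof (induction L' rule: finite_induct)
    case empty
    then show ?case by (intro exI[of _ "{}"]) (auto simp: tile_empty)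
  next
    case (insert v L')
    then obtain R where R: "R \<subseteq> XX" "tile (L' \<union> R)" "\<And>j. j \<in> {1..k} \<Longrightarrow> card ((L' \<union> R) \<inter> V j) = card L'"
      by auto
    obtain i where i: "i \<in> {1..k}" "v \<in> V i" using insert.prems by (auto simp: VV_def)
    have le: "\<forall>j\<in>{1..k}. card ((L' \<union> R) \<inter> X j) \<le> e"
    proof
      fix j assume j: "j \<in> {1..k}"
      have "card ((L' \<union> R) \<inter> X j) \<le> card ((L' \<union> R) \<inter> V j)"
        using finV[OF j] XV[OF j] by (intro card_mono) auto
      then show "card ((L' \<union> R) \<inter> X j) \<le> e" using R(3)[OF j] insert by simp
    qed
    have vn: "v \<notin> L' \<union> R" using insert.hyps insert.prems R(1) by auto
    obtain C where C: "C \<subseteq> XX" "v \<notin> C" "C \<inter> (L' \<union> R) = {}" "tile (insert v ((L' \<union> R) \<union> C))"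
      "\<forall>j\<in>{1..k}. card (insert v ((L' \<union> R) \<union> C) \<inter> V j) = Suc (card ((L' \<union> R) \<inter> V j))"
      "\<forall>j\<in>{1..k}. card (C \<inter> V j) = (if j = i then 0 else 1)"
      using extend_by_center[OF H1 X R(2) le i vn, folded XX_def] by blast
    have "insert v ((L' \<union> R) \<union> C) = insert v L' \<union> (R \<union> C)" by blast
    moreover have "card (insert v L') = Suc (card L')" using insert.hyps by simp
    moreover have "R \<union> C \<subseteq> XX" using C(1) R(1) by blast
    ultimately show ?case using C(4,5) R(3) by metis
  qed
  have finL: "finite L" using L(1) finsub by blast
  have one: "1 \<in> {1..k}" using k3 by simp
  have "card L = k * l"
  proof -
    have "L = (\<Union>j\<in>{1..k}. L \<inter> V j)" using L(1) by (auto simp: VV_def)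
    also have "card \<dots> = (\<Sum>j\<in>{1..k}. card (L \<inter> V j))"
      using finL part_unique by (intro card_UN_disjoint) auto
    finally show ?thesis using L(2) by simp
  qed
  then obtain R0 where R0: "R0 \<subseteq> XX" "tile (L \<union> R0)" "\<And>j. j \<in> {1..k} \<Longrightarrow> card ((L \<union> R0) \<inter> V j) = k * l"
    using cover[OF finL] L(1,3) unfolding XX_def[symmetric] by auto
  have "card (R0 \<inter> V j) = k * l - l" if j: "j \<in> {1..k}" for j
  proof -
    have "(L \<union> R0) \<inter> V j = (L \<inter> V j) \<union> (R0 \<inter> V j)" by blast
    moreover have "card \<dots> = card (L \<inter> V j) + card (R0 \<inter> V j)"
      using finL finV[OF j] R0(1) L(1) unfolding XX_def[symmetric] by (intro card_Un_disjoint) auto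
    ultimately show ?thesis using R0(3)[OF j] L(2)[OF j] by simp
  qed
  moreover have "k * l - l \<le> e" using L(3) by simp
  moreover have "\<exists>R. R \<subseteq> XX \<and> tile (L \<union> R) \<and> (\<forall>j\<in>{1..k}. card (R \<inter> V j) = r)"
    if "k * l - l \<le> r" "r \<le> e" "\<And>j. j \<in> {1..k} \<Longrightarrow> card (R0 \<inter> V j) = k * l - l" for r
    using that(1,2)
  proof (induction r rule: dec_induct)
    case base
    then show ?case using R0 that(3) by blast
  next
    case (step r)
    then obtain R where R: "R \<subseteq> XX" "tile (L \<union> R)" "\<And>j. j \<in> {1..k} \<Longrightarrow> card (R \<inter> V j) = r" by auto
    have LX: "(L \<union> R) \<inter> X j = R \<inter> V j" if j: "j \<in> {1..k}" for j
      using XXV[OF j] R(1) L(1) j unfolding XX_def by blast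
    have le: "\<forall>j\<in>{1..k}. card ((L \<union> R) \<inter> X j) \<le> e" using LX R(3) step by simp
    have "\<not> X 1 \<subseteq> R \<inter> V 1"
    proof
      assume "X 1 \<subseteq> R \<inter> V 1"
      then have "card (X 1) \<le> card (R \<inter> V 1)" using finV[OF one] by (intro card_mono) auto
      then show False using R(3)[OF one] cX[OF one] step by simp
    qed
    then obtain v where v: "v \<in> X 1" "v \<notin> L \<union> R" using LX[OF one] by blast
    then have v1: "v \<in> V 1" using XV[OF one] by blast
    obtain C where C: "C \<subseteq> XX" "v \<notin> C" "C \<inter> (L \<union> R) = {}" "tile (insert v ((L \<union> R) \<union> C))"
      "\<forall>j\<in>{1..k}. card (insert v ((L \<union> R) \<union> C) \<inter> V j) = Suc (card ((L \<union> R) \<inter> V j))"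
      "\<forall>j\<in>{1..k}. card (C \<inter> V j) = (if j = 1 then 0 else 1)"
      using extend_by_center[OF H1 X R(2) le one v1 v(2), folded XX_def] by blast
    define R' where "R' = insert v (R \<union> C)"
    have "insert v ((L \<union> R) \<union> C) = L \<union> R'" by (auto simp: R'_def)
    moreover have "R' \<subseteq> XX" using R C v one by (auto simp: R'_def XX_def)
    moreover have "card (R' \<inter> V j) = Suc r" if j: "j \<in> {1..k}" for j
    proof -
      have fin: "finite (R \<inter> V j)" "finite (C \<inter> V j)" using finV[OF j] by auto
      have "card ((R \<union> C) \<inter> V j) = card (R \<inter> V j) + card (C \<inter> V j)"
        unfolding Int_Un_distrib2 using fin C(3) by (intro card_Un_disjoint) auto
      then have "card ((R \<union> C) \<inter> V j) = (if j = 1 then r else Suc r)"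
        using R(3)[OF j] C(6) j by auto
      moreover have "R' \<inter> V j = (if j = 1 then insert v ((R \<union> C) \<inter> V j) else (R \<union> C) \<inter> V j)"
      proof (cases "j = 1")
        case False
        then have "v \<notin> V j" using part_unique[OF v1 _ one j] by blast
        then show ?thesis using False by (simp add: R'_def Int_insert_left)
      next
        case True
        then have "v \<in> V j" using v1 by blast
        then show ?thesis using True by (simp add: R'_def)
      qed
      moreover have "finite ((R \<union> C) \<inter> V j)" "v \<notin> (R \<union> C) \<inter> V j"
        using fin v(2) C(2) by (auto simp: Int_Un_distrib2)
      ultimately show ?thesis by (cases "j = 1") simp_all
    qed
    ultimately show ?case using C(4) by metis
  qed
  ultimately show ?thesis unfolding XX_def by blast
qed

text \<open>For every part \<open>j\<close>, each vertex of \<open>Z\<close> in the template carries a tuple \<open>T\<close> of vertices in the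
  other parts, and every edge of the template an absorber for its end in part \<open>j\<close> together with that
  tuple. The vertices outside this structure are covered up to a small rest, the rest is covered by
  cliques using exactly \<open>e\<close> vertices of each \<open>X j\<close>, and the matching given by the template tells which
  absorbers to activate.\<close>

lemma factor_from_absorbers:
  assumes H1: "\<forall>i\<in>{1..k}. hole_free ({1..k} - {i}) h"
    and ab: "\<And>x. \<forall>i\<in>{1..k}. x i \<in> V i \<Longrightarrow> absorb N a x"
    and X: "flexible X (e + h)" and cX: "\<And>j. j \<in> {1..k} \<Longrightarrow> card (X j) = m"
    and m: "1 \<le> m" "e \<le> m"
    and cover: "\<And>W w. \<forall>j\<in>{1..k}. W j \<subseteq> V j \<and> card (W j) = w \<Longrightarrow> n \<le> w + N \<Longrightarrow>
      \<exists>A. tile A \<and> A \<subseteq> (\<Union>j\<in>{1..k}. W j) \<and> (\<forall>j\<in>{1..k}. card (W j - A) \<le> l)"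
    and l: "k * l \<le> e"
    and N: "5 * m * k + 5 * m * k * k + 120 * m * k * a \<le> N" "N < n"
  shows "tile VV"
proof -
  note XV = flexibleD(1)[OF X]
  have one: "1 \<in> {1..k}" using k3 by simp
  have finX: "finite (X j)" if "j \<in> {1..k}" for j using XV finV that finite_subset by blast
  have "5 * m * 1 \<le> 5 * m * k" using k3 by (intro mult_le_mono2) simp
  then have mk: "5 * m \<le> n" using N by linarith
  have "\<exists>Y. Y \<subseteq> V j - X j \<and> card Y = 4 * m" if j: "j \<in> {1..k}" for j
  proof -
    have "4 * m \<le> card (V j - X j)"
      using card_Diff_subset[OF finX[OF j] XV[OF j]] cX[OF j] cardV[OF j] mk by simp
    then show ?thesis by (meson obtain_subset_with_card_n)
  qed
  then obtain Y where Y: "\<And>j. j \<in> {1..k} \<Longrightarrow> Y j \<subseteq> V j - X j" "\<And>j. j \<in> {1..k} \<Longrightarrow> card (Y j) = 4 * m" by metis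
  have finY: "finite (Y j)" if "j \<in> {1..k}" for j using Y(1)[OF that] finV[OF that] finite_subset by blast
  \<comment> \<open>This many vertices of \<open>X j \<union> Y j\<close> are left to be matched
    once \<open>e\<close> flexible ones are gone.\<close>
  define Z where "Z = {..<5 * m - e}"
  have "\<exists>G. G \<subseteq> (X j \<union> Y j) \<times> Z \<and> card G \<le> 120 * card (X j) \<and>
    (\<forall>X'\<subseteq>X j. card X' + e = card (X j) \<longrightarrow> (\<exists>f. bij_betw f (X' \<union> Y j) Z \<and> (\<forall>l\<in>X' \<union> Y j. (l, f l) \<in> G)))"
    if j: "j \<in> {1..k}" for j
    by (rule robust_matching_template) (use finX finY Y cX m j in \<open>auto simp: Z_def\<close>)
  then obtain G where G: "\<And>j. j \<in> {1..k} \<Longrightarrow> G j \<subseteq> (X j \<union> Y j) \<times> Z" "\<And>j. j \<in> {1..k} \<Longrightarrow> card (G j) \<le> 120 * m"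
    "\<And>j X'. j \<in> {1..k} \<Longrightarrow> X' \<subseteq> X j \<Longrightarrow> card X' + e = m \<Longrightarrow>
       \<exists>f. bij_betw f (X' \<union> Y j) Z \<and> (\<forall>l\<in>X' \<union> Y j. (l, f l) \<in> G j)"
    using cX by metis
  have finG: "finite (G j)" if "j \<in> {1..k}" for j
    by (rule finite_subset[OF G(1)[OF that]]) (simp add: Z_def finX[OF that] finY[OF that])
  define Q0 where "Q0 = (\<Union>j\<in>{1..k}. X j \<union> Y j)"
  have Q0: "finite Q0" using finX finY by (auto simp: Q0_def)
  have "card Q0 \<le> (\<Sum>j\<in>{1..k}. card (X j \<union> Y j))" unfolding Q0_def by (rule card_UN_le) simp
  also have "\<dots> \<le> (\<Sum>j\<in>{1..k}. 5 * m)"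
  proof (rule sum_mono)
    fix j assume "j \<in> {1..k}"
    then show "card (X j \<union> Y j) \<le> 5 * m" using card_Un_le[of "X j" "Y j"] cX[of j] Y(2)[of j] by linarith
  qed
  finally have cQ0: "card Q0 \<le> 5 * m * k" by (simp add: mult_ac)
  define J1 where "J1 = {1..k} \<times> Z"
  have J1: "finite J1" "card J1 \<le> 5 * m * k" by (auto simp: J1_def Z_def card_cartesian_product)
  \<comment> \<open>The tuple at \<open>(j, z)\<close> omits part \<open>j\<close>: its entry there
    is supplied by the vertex matched to \<open>z\<close>.\<close>
  define P1 where "P1 p B \<longleftrightarrow> (\<exists>t. (\<forall>i\<in>{1..k} - {fst p}. t i \<in> V i) \<and> B = t ` ({1..k} - {fst p}))" for p :: "nat \<times> nat" and B :: "'a set"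
  have "\<exists>T. (\<forall>p\<in>J1. T p \<inter> Q0 = {} \<and> finite (T p) \<and> card (T p) \<le> k \<and> P1 p (T p)) \<and> disjoint_family_on T J1"
  proof (rule disjoint_selection[OF J1(1) _ Q0])
    show "card Q0 + k * card J1 \<le> N"
    proof -
      have "k * card J1 \<le> k * (5 * m * k)" using J1(2) by (rule mult_le_mono2)
      also have "k * (5 * m * k) = 5 * m * k * k" by (simp only: mult_ac)
      finally show ?thesis using cQ0 N(1) by linarith
    qed
    fix p and Q :: "'a set" assume "p \<in> J1" and Q: "finite Q" "card Q \<le> N"
    have "\<exists>v. v \<in> V i - Q" if i: "i \<in> {1..k}" for i
    proof -
      have "\<not> V i \<subseteq> Q" using card_mono[OF Q(1), of "V i"] cardV[OF i] Q(2) N(2) by auto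
      then show ?thesis by blast
    qed
    then obtain t where t: "\<And>i. i \<in> {1..k} \<Longrightarrow> t i \<in> V i - Q" by metis
    have "card (t ` ({1..k} - {fst p})) \<le> card ({1..k} - {fst p})" by (rule card_image_le) simp
    also have "\<dots> \<le> k" using card_mono[of "{1..k}" "{1..k} - {fst p}"] by simp
    finally have "card (t ` ({1..k} - {fst p})) \<le> k" .
    moreover have "t ` ({1..k} - {fst p}) \<inter> Q = {}" using t by blast
    moreover have "P1 p (t ` ({1..k} - {fst p}))" using t unfolding P1_def by blast
    ultimately show "\<exists>B. B \<inter> Q = {} \<and> finite B \<and> card B \<le> k \<and> P1 p B" by blast
  qed
  then obtain T where T: "\<And>p. p \<in> J1 \<Longrightarrow> T p \<inter> Q0 = {}" "\<And>p. p \<in> J1 \<Longrightarrow> finite (T p)"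
    "\<And>p. p \<in> J1 \<Longrightarrow> card (T p) \<le> k" "\<And>p. p \<in> J1 \<Longrightarrow> P1 p (T p)" "disjoint_family_on T J1" by blast
  define Q1 where "Q1 = Q0 \<union> (\<Union>p\<in>J1. T p)"
  have Q1: "finite Q1" using Q0 J1 T(2) by (auto simp: Q1_def)
  have "card (\<Union>p\<in>J1. T p) \<le> (\<Sum>p\<in>J1. card (T p))" using J1 by (intro card_UN_le) auto
  also have "\<dots> \<le> (\<Sum>p\<in>J1. k)" by (intro sum_mono T(3))
  also have "\<dots> = card J1 * k" by simp
  also have "\<dots> \<le> 5 * m * k * k" using J1(2) by (rule mult_le_mono1)
  finally have cQ1: "card Q1 \<le> 5 * m * k + 5 * m * k * k"
    using cQ0 card_Un_le[of Q0 "\<Union>p\<in>J1. T p"] by (simp add: Q1_def)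
  define J2 where "J2 = (SIGMA j:{1..k}. G j)"
  have J2: "finite J2" using finG by (auto simp: J2_def)
  have "card J2 = (\<Sum>j\<in>{1..k}. card (G j))" using finG by (simp add: J2_def)
  also have "\<dots> \<le> (\<Sum>j\<in>{1..k}. 120 * m)" by (intro sum_mono G(2))
  finally have cJ2: "card J2 \<le> 120 * m * k" by (simp add: mult_ac)
  define vx where "vx p = fst (snd p)" for p :: "nat \<times> 'a \<times> nat"
  define ix where "ix p = (fst p, snd (snd p))" for p :: "nat \<times> 'a \<times> nat"
  have J2D: "fst p \<in> {1..k}" "vx p \<in> X (fst p) \<union> Y (fst p)" "ix p \<in> J1" "(vx p, snd (snd p)) \<in> G (fst p)" if "p \<in> J2" for p
  proof -
    obtain j l z where q: "p = (j, l, z)" "j \<in> {1..k}" "(l, z) \<in> G j" using \<open>p \<in> J2\<close> by (auto simp: J2_def)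
    have "(l, z) \<in> (X j \<union> Y j) \<times> Z" using G(1)[OF q(2)] q(3) by blast
    then show "fst p \<in> {1..k}" "vx p \<in> X (fst p) \<union> Y (fst p)" "ix p \<in> J1" "(vx p, snd (snd p)) \<in> G (fst p)"
      using q by (auto simp: vx_def ix_def J1_def)
  qed
  have XYV: "X j \<union> Y j \<subseteq> V j" if "j \<in> {1..k}" for j using XV[OF that] Y(1)[OF that] by blast
  have "\<exists>B. (\<forall>p\<in>J2. B p \<inter> Q1 = {} \<and> finite (B p) \<and> card (B p) \<le> a \<and> (tile (B p) \<and> tile (B p \<union> insert (vx p) (T (ix p))))) \<and> disjoint_family_on B J2"
  proof (rule disjoint_selection[OF J2 _ Q1])
    show "card Q1 + a * card J2 \<le> N"
    proof -
      have "a * card J2 \<le> a * (120 * m * k)" using cJ2 by (rule mult_le_mono2)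
      also have "a * (120 * m * k) = 120 * m * k * a" by (simp only: mult_ac)
      finally show ?thesis using cQ1 N(1) by linarith
    qed
    fix p and Q :: "'a set" assume p: "p \<in> J2" and Q: "finite Q" "card Q \<le> N"
    define j where "j = fst p"
    have j: "j \<in> {1..k}" using J2D(1)[OF p] by (simp add: j_def)
    obtain t where t: "\<And>i. i \<in> {1..k} - {j} \<Longrightarrow> t i \<in> V i" "T (ix p) = t ` ({1..k} - {j})"
    proof -
      have "fst (ix p) = j" by (simp add: ix_def j_def)
      then show thesis using that T(4)[OF J2D(3)[OF p]] unfolding P1_def by metis
    qed
    have "vx p \<in> V j" using J2D(2)[OF p] XYV[OF j] by (auto simp: j_def)
    then have "\<forall>i\<in>{1..k}. (t(j := vx p)) i \<in> V i" using t(1) by simp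
    from ab[OF this] have "absorb N a (t(j := vx p))" by blast
    moreover have "(t(j := vx p)) ` {1..k} = insert (vx p) (T (ix p))" using t(2) j by auto
    ultimately show "\<exists>B. B \<inter> Q = {} \<and> finite B \<and> card B \<le> a \<and> (tile B \<and> tile (B \<union> insert (vx p) (T (ix p))))"
      using Q unfolding absorb_def by auto
  qed
  then obtain B where B: "\<And>p. p \<in> J2 \<Longrightarrow> B p \<inter> Q1 = {}" "\<And>p. p \<in> J2 \<Longrightarrow> finite (B p)"
    "\<And>p. p \<in> J2 \<Longrightarrow> card (B p) \<le> a" "\<And>p. p \<in> J2 \<Longrightarrow> tile (B p)"
    "\<And>p. p \<in> J2 \<Longrightarrow> tile (B p \<union> insert (vx p) (T (ix p)))" "disjoint_family_on B J2" by blast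
  define Ab where "Ab = Q1 \<union> (\<Union>p\<in>J2. B p)"
  have "card (\<Union>p\<in>J2. B p) \<le> (\<Sum>p\<in>J2. card (B p))" using J2 by (intro card_UN_le) auto
  also have "\<dots> \<le> (\<Sum>p\<in>J2. a)" by (intro sum_mono B(3))
  also have "\<dots> = card J2 * a" by simp
  also have "\<dots> \<le> 120 * m * k * a" using cJ2 by (rule mult_le_mono1)
  finally have cAb: "card Ab \<le> N"
    using cQ1 N(1) card_Un_le[of Q1 "\<Union>p\<in>J2. B p"] by (simp add: Ab_def)
  have finAb: "finite Ab" using Q1 J2 B(2) by (auto simp: Ab_def)
  have key: "tile (Ab - (\<Union>j\<in>{1..k}. R j))"
    if R_all: "\<forall>j\<in>{1..k}. R j \<subseteq> X j \<and> card (R j) = e" for R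
  proof -
    have R: "R j \<subseteq> X j" "card (R j) = e" if "j \<in> {1..k}" for j using R_all that by blast+
    define X' where "X' j = X j - R j" for j
    have "card (X' j) + e = m" if j: "j \<in> {1..k}" for j
      using R(1)[OF j] R(2)[OF j] cX[OF j] finX[OF j] m(2) unfolding X'_def
      by (simp add: card_Diff_subset finite_subset)
    then have "\<exists>f. bij_betw f (X' j \<union> Y j) Z \<and> (\<forall>l\<in>X' j \<union> Y j. (l, f l) \<in> G j)" if "j \<in> {1..k}" for j
      using G(3)[OF that, of "X' j"] that by (simp add: X'_def)
    then obtain f where f: "\<And>j. j \<in> {1..k} \<Longrightarrow> bij_betw (f j) (X' j \<union> Y j) Z"
      "\<And>j l. j \<in> {1..k} \<Longrightarrow> l \<in> X' j \<union> Y j \<Longrightarrow> (l, f j l) \<in> G j" by metis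
    \<comment> \<open>A template edge is on if the matching of its part uses it. Its absorber then
      takes in the end vertex and the tuple; an absorber that is off is tiled by itself. As the
      matchings are bijections, every remaining vertex and every tuple is taken exactly
      once.\<close>
    define on where "on p \<longleftrightarrow> vx p \<in> X' (fst p) \<union> Y (fst p) \<and> f (fst p) (vx p) = snd (snd p)" for p
    define S where "S p = B p \<union> (if on p then insert (vx p) (T (ix p)) else {})" for p
    have vxQ0: "vx p \<in> Q0" if "p \<in> J2" for p using J2D(1,2)[OF that] by (auto simp: Q0_def)
    have insQ1: "insert (vx p) (T (ix p)) \<subseteq> Q1" if "p \<in> J2" for p
      using vxQ0[OF that] J2D(3)[OF that] by (auto simp: Q1_def)
    have "disjoint_family_on S J2"
    proof (unfold disjoint_family_on_def, intro ballI impI)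
      fix p q assume pq: "p \<in> J2" "q \<in> J2" "p \<noteq> q"
      have BB: "B p \<inter> B q = {}" using B(6) pq by (auto simp: disjoint_family_on_def)
      have "insert (vx p) (T (ix p)) \<inter> insert (vx q) (T (ix q)) = {}" if on: "on p" "on q"
      proof -
        have ne: "vx p \<noteq> vx q \<and> ix p \<noteq> ix q"
        proof (cases "fst p = fst q")
          case True
          have inj: "inj_on (f (fst p)) (X' (fst p) \<union> Y (fst p))"
            using f(1)[OF J2D(1)[OF pq(1)]] by (simp add: bij_betw_def)
          have "vx p \<noteq> vx q" using pq(3) True on by (auto simp: on_def vx_def prod_eq_iff)
          moreover from this have "f (fst p) (vx p) \<noteq> f (fst p) (vx q)"
            using inj_onD[OF inj] on True by (auto simp: on_def)
          ultimately show ?thesis using on True by (auto simp: on_def ix_def)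
        next
          case False
          have "vx p \<in> V (fst p)" "vx q \<in> V (fst q)"
            using J2D(1,2)[OF pq(1)] J2D(1,2)[OF pq(2)] XYV by blast+
          then have "vx p \<noteq> vx q" using part_unique[of "vx p"] J2D(1) pq False by metis
          then show ?thesis using False by (simp add: ix_def)
        qed
        then have "T (ix p) \<inter> T (ix q) = {}"
          using T(5) J2D(3)[OF pq(1)] J2D(3)[OF pq(2)] by (auto simp: disjoint_family_on_def)
        moreover have "vx p \<notin> T (ix q)" "vx q \<notin> T (ix p)"
          using vxQ0 T(1) J2D(3) pq by blast+
        ultimately show ?thesis using ne by auto
      qed
      then have "(if on p then insert (vx p) (T (ix p)) else {}) \<inter> (if on q then insert (vx q) (T (ix q)) else {}) = {}"
        by simp
      moreover have "(if on p then insert (vx p) (T (ix p)) else {}) \<subseteq> Q1" "(if on q then insert (vx q) (T (ix q)) else {}) \<subseteq> Q1"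
        using insQ1 pq by (auto split: if_splits)
      ultimately show "S p \<inter> S q = {}"
        using BB B(1)[OF pq(1)] B(1)[OF pq(2)] unfolding S_def by blast
    qed
    moreover have "tile (S p)" if "p \<in> J2" for p using B(4,5)[OF that] by (simp add: S_def)
    ultimately have "tile (\<Union>p\<in>J2. S p)" using tile_UN[OF J2] by blast
    moreover have "(\<Union>p\<in>J2. S p) = Ab - (\<Union>j\<in>{1..k}. R j)"
    proof
      show "(\<Union>p\<in>J2. S p) \<subseteq> Ab - (\<Union>j\<in>{1..k}. R j)"
      proof (rule UN_least)
        fix p assume p: "p \<in> J2"
        have RQ0: "(\<Union>j\<in>{1..k}. R j) \<subseteq> Q0" using R(1) unfolding Q0_def by blast
        have "B p \<inter> (\<Union>j\<in>{1..k}. R j) = {}" using B(1)[OF p] RQ0 by (auto simp: Q1_def)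
        moreover have "T (ix p) \<inter> (\<Union>j\<in>{1..k}. R j) = {}" using T(1)[OF J2D(3)[OF p]] RQ0 by blast
        moreover have "vx p \<notin> R j" if "on p" "j \<in> {1..k}" for j
        proof
          assume vR: "vx p \<in> R j"
          have "vx p \<in> V (fst p)" using J2D(1,2)[OF p] XYV by blast
          moreover have "vx p \<in> V j" using vR R(1) XV that(2) by blast
          ultimately have "j = fst p" using part_unique J2D(1)[OF p] that(2) by blast
          then show False using vR that R(1)[OF that(2)] Y(1)[OF that(2)] by (auto simp: on_def X'_def)
        qed
        moreover have "S p \<subseteq> Ab" using insQ1[OF p] p by (auto simp: S_def Ab_def)
        ultimately show "S p \<subseteq> Ab - (\<Union>j\<in>{1..k}. R j)" by (auto simp: S_def split: if_splits)
      qed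
      show "Ab - (\<Union>j\<in>{1..k}. R j) \<subseteq> (\<Union>p\<in>J2. S p)"
      proof
        fix x assume x: "x \<in> Ab - (\<Union>j\<in>{1..k}. R j)"
        have vertex: "\<exists>p\<in>J2. on p \<and> vx p = l \<and> ix p = (j, f j l)" if "j \<in> {1..k}" "l \<in> X' j \<union> Y j" for j l
          using f(2)[OF that] that by (intro bexI[of _ "(j, l, f j l)"]) (auto simp: on_def vx_def ix_def J2_def)
        consider "x \<in> Q0" | p where "p \<in> J1" "x \<in> T p" | p where "p \<in> J2" "x \<in> B p"
          using x by (auto simp: Ab_def Q1_def)
        then show "x \<in> (\<Union>p\<in>J2. S p)"
        proof cases
          case 1
          then obtain j where j: "j \<in> {1..k}" "x \<in> X j \<union> Y j" by (auto simp: Q0_def)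
          then have "x \<in> X' j \<union> Y j" using x by (auto simp: X'_def)
          then obtain p where "p \<in> J2" "on p" "vx p = x" using vertex[OF j(1)] by blast
          then show ?thesis by (auto simp: S_def)
        next
          case 2
          then obtain j z where p: "p = (j, z)" "j \<in> {1..k}" "z \<in> Z" by (auto simp: J1_def)
          then obtain l where l: "l \<in> X' j \<union> Y j" "f j l = z"
            using f(1)[OF p(2)] by (metis bij_betw_imp_surj_on imageE)
          then obtain q where "q \<in> J2" "on q" "ix q = p" using vertex[OF p(2) l(1)] p by blast
          then show ?thesis using 2 by (auto simp: S_def)
        qed (auto simp: S_def)
      qed
    qed
    ultimately show ?thesis by simp
  qed
  have XiV: "(\<Union>j\<in>{1..k}. R j) \<inter> V i = R i" if "i \<in> {1..k}" "\<And>j. j \<in> {1..k} \<Longrightarrow> R j \<subseteq> V j" for R i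
  proof -
    have "R j \<inter> V i \<subseteq> R i" if "j \<in> {1..k}" for j
      using part_unique[of _ j i] \<open>\<And>j. j \<in> {1..k} \<Longrightarrow> R j \<subseteq> V j\<close> that \<open>i \<in> {1..k}\<close> by blast
    then show ?thesis using that by blast
  qed
  have XAb: "X j \<subseteq> Ab" if "j \<in> {1..k}" for j using that by (auto simp: Ab_def Q1_def Q0_def)
  have "\<exists>R. R \<subseteq> X j \<and> card R = e" if "j \<in> {1..k}" for j
    using cX[OF that] m(2) by (metis obtain_subset_with_card_n)
  then obtain R0 where R0: "\<And>j. j \<in> {1..k} \<Longrightarrow> R0 j \<subseteq> X j" "\<And>j. j \<in> {1..k} \<Longrightarrow> card (R0 j) = e" by metis
  then have "\<forall>j\<in>{1..k}. R0 j \<subseteq> X j \<and> card (R0 j) = e" by blast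
  note key0 = key[OF this]
  \<comment> \<open>An arbitrary admissible choice \<open>R0\<close> is enough to see that
    \<open>Ab\<close> meets all parts equally: \<open>Ab\<close> without \<open>R0\<close> is tiled,
    hence balanced, and each \<open>R0 j\<close> has \<open>e\<close> vertices.\<close>
  define q where "q = card ((Ab - (\<Union>j\<in>{1..k}. R0 j)) \<inter> V 1) + e"
  have AbV: "card (Ab \<inter> V j) = q" if j: "j \<in> {1..k}" for j
  proof -
    have "R0 j \<subseteq> Ab \<inter> V j" using R0(1)[OF j] XAb[OF j] XV[OF j] by blast
    moreover have "(Ab - (\<Union>j\<in>{1..k}. R0 j)) \<inter> V j = Ab \<inter> V j - R0 j"
      using XiV[OF j, of R0] R0(1) XV by blast
    ultimately have "card ((Ab - (\<Union>j\<in>{1..k}. R0 j)) \<inter> V j) + e = card (Ab \<inter> V j)"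
      using R0(2)[OF j] finAb by (metis card_Diff_subset card_mono finite_Int finite_subset le_add_diff_inverse2)
    then show ?thesis using tile_balanced[OF key0 j one] by (simp add: q_def)
  qed
  have AbVV: "Ab \<subseteq> VV"
  proof -
    have "Ab - (\<Union>j\<in>{1..k}. R0 j) \<subseteq> VV" by (rule tile_subset[OF key0])
    moreover have "(\<Union>j\<in>{1..k}. R0 j) \<subseteq> VV"
      unfolding VV_def using R0(1) XV by (intro UN_mono[OF order_refl]) blast
    ultimately show ?thesis by blast
  qed
  define W where "W j = V j - Ab" for j
  have cW: "card (W j) = n - q" if j: "j \<in> {1..k}" for j
    using AbV[OF j] cardV[OF j] finAb unfolding W_def
    by (metis card_Diff_subset_Int finite_Int inf_commute)
  have qN: "q \<le> N" using AbV[OF one] cAb finAb card_mono[of Ab "Ab \<inter> V 1"] by simp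
  have "\<exists>A. tile A \<and> A \<subseteq> (\<Union>j\<in>{1..k}. W j) \<and> (\<forall>j\<in>{1..k}. card (W j - A) \<le> l)"
    by (rule cover[of W "n - q"]) (use cW qN in \<open>auto simp: W_def\<close>)
  then obtain A where A: "tile A" "A \<subseteq> (\<Union>j\<in>{1..k}. W j)" "\<And>j. j \<in> {1..k} \<Longrightarrow> card (W j - A) \<le> l" by blast
  define L where "L = VV - Ab - A"
  have LV: "L \<inter> V j = W j - A" if "j \<in> {1..k}" for j using that by (auto simp: L_def W_def VV_def)
  have finA: "finite A" using tile_subset[OF A(1)] finite_VV finite_subset by blast
  have c1: "card (L \<inter> V j) = card (W 1 - A)" if j: "j \<in> {1..k}" for j
  proof -
    have "card (W i - A) = n - q - card (A \<inter> V i)" if i: "i \<in> {1..k}" for i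
    proof -
      have "W i \<inter> A = A \<inter> V i" using A(2) by (auto simp: W_def)
      then show ?thesis using cW[OF i] finA by (metis card_Diff_subset_Int finite_Int)
    qed
    then show ?thesis using LV[OF j] tile_balanced[OF A(1) j one] j one by simp
  qed
  have c2: "L \<subseteq> VV - (\<Union>j\<in>{1..k}. X j)" using XAb unfolding L_def by blast
  have c3: "k * card (W 1 - A) \<le> e" using A(3)[OF one] l mult_le_mono2 le_trans by blast
  have c4: "e \<le> card (X j)" if "j \<in> {1..k}" for j using cX[OF that] m(2) by simp
  have "\<exists>R. R \<subseteq> (\<Union>j\<in>{1..k}. X j) \<and> (\<forall>j\<in>{1..k}. card (R \<inter> V j) = e) \<and> tile (L \<union> R)"
    by (rule cover_leftover[OF H1 X c4 c2 c1 c3])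
  then obtain R where R: "R \<subseteq> (\<Union>j\<in>{1..k}. X j)" "\<And>j. j \<in> {1..k} \<Longrightarrow> card (R \<inter> V j) = e" "tile (L \<union> R)" by blast
  have RU: "R = (\<Union>j\<in>{1..k}. R \<inter> V j)" using R(1) XV by blast
  have RX: "R \<inter> V j \<subseteq> X j" if j: "j \<in> {1..k}" for j
    using R(1) XiV[OF j, of X] XV by blast
  have "tile (Ab - (\<Union>j\<in>{1..k}. R \<inter> V j))"
    by (rule key) (use RX R(2) in blast)
  then have tAb: "tile (Ab - R)" using RU by simp
  have RAb: "R \<subseteq> Ab" using R(1) XAb by blast
  have A_Ab: "A \<inter> Ab = {}" using A(2) by (auto simp: W_def)
  have "tile (A \<union> (L \<union> R))" by (rule tile_Un[OF A(1) R(3)]) (use A_Ab RAb in \<open>auto simp: L_def\<close>)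
  then have "tile ((A \<union> (L \<union> R)) \<union> (Ab - R))" by (rule tile_Un[OF _ tAb]) (use A_Ab in \<open>auto simp: L_def\<close>)
  moreover have "(A \<union> (L \<union> R)) \<union> (Ab - R) = VV"
    using RAb AbVV tile_subset[OF A(1)] by (auto simp: L_def)
  ultimately show ?thesis by simp
qed

section \<open>Almost perfect tilings by stars\<close>

lemma star_tiling:
  assumes H: "hole_free ({1..k} - {1}) h"
    and a: "inj_on a {..<q * S}" "a ` {..<q * S} \<subseteq> V 1"
    and FV: "\<And>j g. j \<in> {1..k} - {1} \<Longrightarrow> g < p \<Longrightarrow> F j g \<subseteq> V j"
    and disjF: "\<And>j. j \<in> {1..k} - {1} \<Longrightarrow> disjoint_family_on (F j) {..<p}"
    and cardF: "\<And>j g. j \<in> {1..k} - {1} \<Longrightarrow> g < p \<Longrightarrow> card (F j g) \<le> f"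
    and half: "\<And>j s g. j \<in> {1..k} - {1} \<Longrightarrow> s < q * S \<Longrightarrow> g < p \<Longrightarrow> card (F j g) + 2 * h \<le> 2 * card (nb j (a s) \<inter> F j g)"
    and slot: "\<And>j r x. j \<in> {1..k} - {1} \<Longrightarrow> r < q \<Longrightarrow> x \<in> (\<Union>g<p. F j g) \<Longrightarrow> d \<le> card {i \<in> {..<S}. x \<in> nb j (a (r * S + i))}"
    and d: "S + f + 2 * p * h \<le> 2 * d" and h: "1 \<le> h" and fS: "f \<le> S" and S: "1 \<le> S"
    and total: "\<And>j. j \<in> {1..k} - {1} \<Longrightarrow> q * S + 5 * S < card (\<Union>g<p. F j g)"
  shows "\<exists>A. tile A \<and> A \<inter> V 1 \<subseteq> a ` {..<q * S} \<and> (\<forall>j\<in>{1..k} - {1}. A \<inter> V j \<subseteq> (\<Union>g<p. F j g)) \<and>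
    (\<forall>j\<in>{1..k}. card (A \<inter> V j) = q * S)"
proof -
  have one: "1 \<in> {1..k}" using k3 by simp
  define play where "play j c s \<longleftrightarrow> servable (nb j) (F j) p h (a s) ((\<lambda>s. c s j) ` {..<s}) \<and>
    c s j \<in> nb j (a s) \<inter> F j (first_fit (nb j) (F j) p h (a s) ((\<lambda>s. c s j) ` {..<s})) - (\<lambda>s. c s j) ` {..<s}"
    for j s and c :: "nat \<Rightarrow> nat \<Rightarrow> 'a"
  have "\<exists>c. \<forall>s<e. clq {1..k} (c s) \<and> c s 1 = a s \<and> (\<forall>j\<in>{1..k} - {1}. play j c s)" if "e \<le> q * S" for e
    using that
  proof (induction e)
    case 0
    then show ?case by simp
  next
    case (Suc e)
    then obtain c where c: "\<And>s. s < e \<Longrightarrow> clq {1..k} (c s)" "\<And>s. s < e \<Longrightarrow> c s 1 = a s"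
      "\<And>s j. s < e \<Longrightarrow> j \<in> {1..k} - {1} \<Longrightarrow> play j c s"
      using Suc.IH[OF Suc_leD[OF Suc.prems]] by blast
    have serv: "servable (nb j) (F j) p h (a e) ((\<lambda>s. c s j) ` {..<e})" if j: "j \<in> {1..k} - {1}" for j
    proof (rule first_fit_play.survives)
      show "first_fit_play (nb j) (F j) p h f S q d a (\<lambda>s. c s j) e"
      proof
        show "finite (F j g)" if "g < p" for g using FV[OF j that] finV[of j] j finite_subset by blast
        show "servable (nb j) (F j) p h (a s) ((\<lambda>s. c s j) ` {..<s}) \<and>
          c s j \<in> nb j (a s) \<inter> F j (first_fit (nb j) (F j) p h (a s) ((\<lambda>s. c s j) ` {..<s})) - (\<lambda>s. c s j) ` {..<s}"
          if "s < e" for s using c(3)[OF that j] unfolding play_def .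
        show "e < q * S" using Suc.prems by simp
      qed (fact disjF[OF j] cardF[OF j] half[OF j] slot[OF j] d h fS S total[OF j])+
    qed
    define ff where "ff j = first_fit (nb j) (F j) p h (a e) ((\<lambda>s. c s j) ` {..<e})" for j
    have "a e \<in> V 1" using a(2) Suc.prems by auto
    have "\<exists>x. clq {1..k} x \<and> x 1 = a e \<and> (\<forall>j\<in>{1..k} - {1}. x j \<in> nb j (a e) \<inter> F j (ff j) - (\<lambda>s. c s j) ` {..<e})"
    proof (rule clq_center[OF H one \<open>a e \<in> V 1\<close>])
      fix j assume j: "j \<in> {1..k} - {1}"
      show "nb j (a e) \<inter> F j (ff j) - (\<lambda>s. c s j) ` {..<e} \<subseteq> nb j (a e) \<and>
          h \<le> card (nb j (a e) \<inter> F j (ff j) - (\<lambda>s. c s j) ` {..<e})"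
        using first_fitD(2)[OF serv[OF j]] unfolding ff_def by blast
    qed
    then obtain x where x: "clq {1..k} x" "x 1 = a e"
      "\<And>j. j \<in> {1..k} - {1} \<Longrightarrow> x j \<in> nb j (a e) \<inter> F j (ff j) - (\<lambda>s. c s j) ` {..<e}" by blast
    define c' where "c' = c(e := x)"
    have im: "(\<lambda>s. c' s j) ` {..<s} = (\<lambda>s. c s j) ` {..<s}" if "s \<le> e" for s j
      using that by (intro image_cong) (auto simp: c'_def)
    have pl: "play j c' s" if "s < Suc e" "j \<in> {1..k} - {1}" for s j
    proof (cases "s = e")
      case True
      then show ?thesis using serv[OF that(2)] x(3)[OF that(2)] unfolding play_def im[OF order_refl] True
        by (simp add: c'_def ff_def)
    next
      case False
      then have "s < e" using that by simp
      from c(3)[OF this that(2)] have "play j c s" .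
      moreover have "c' s = c s" using False by (simp add: c'_def)
      moreover have "s \<le> e" using \<open>s < e\<close> by simp
      ultimately show ?thesis unfolding play_def im[OF \<open>s \<le> e\<close>] by simp
    qed
    have "clq {1..k} (c' s) \<and> c' s 1 = a s" if "s < Suc e" for s
      using c(1,2)[of s] x(1,2) that by (cases "s = e") (auto simp: c'_def)
    then show ?case using pl by blast
  qed
  from this[OF order_refl] obtain c where c: "\<And>s. s < q * S \<Longrightarrow> clq {1..k} (c s)" "\<And>s. s < q * S \<Longrightarrow> c s 1 = a s"
    "\<And>s j. s < q * S \<Longrightarrow> j \<in> {1..k} - {1} \<Longrightarrow> play j c s" by blast
  have cV: "c s j \<in> V j" if "s < q * S" "j \<in> {1..k}" for s j using c(1)[OF that(1)] that(2) by (simp add: clq_def)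
  have cF: "c s j \<in> (\<Union>g<p. F j g)" if "s < q * S" "j \<in> {1..k} - {1}" for s j
    using c(3)[OF that] first_fitD(1) unfolding play_def by fast
  have inj: "inj_on (\<lambda>s. c s j) {..<q * S}" if j: "j \<in> {1..k}" for j
  proof (cases "j = 1")
    case True
    then show ?thesis using a(1) c(2) by (simp add: inj_on_def)
  next
    case False
    have ne: "c u j \<noteq> c v j" if "u < v" "v < q * S" for u v
    proof -
      have "c u j \<in> (\<lambda>s. c s j) ` {..<v}" using that by simp
      moreover have "c v j \<notin> (\<lambda>s. c s j) ` {..<v}" using c(3)[OF that(2), of j] j False unfolding play_def by blast
      ultimately show ?thesis by metis
    qed
    show ?thesis
    proof (rule inj_onI)
      fix x y assume "x \<in> {..<q * S}" "y \<in> {..<q * S}" "c x j = c y j"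
      then show "x = y" using ne[of x y] ne[of y x] by (cases x y rule: linorder_cases) auto
    qed
  qed
  define A where "A = (\<Union>s<q * S. c s ` {1..k})"
  have AV: "A \<inter> V j = (\<lambda>s. c s j) ` {..<q * S}" if j: "j \<in> {1..k}" for j
  proof
    show "A \<inter> V j \<subseteq> (\<lambda>s. c s j) ` {..<q * S}"
    proof
      fix x assume "x \<in> A \<inter> V j"
      then obtain s i where s: "s < q * S" "i \<in> {1..k}" "x = c s i" "x \<in> V j" unfolding A_def by blast
      then have "i = j" using part_unique[of x i j] cV j by blast
      then show "x \<in> (\<lambda>s. c s j) ` {..<q * S}" using s by blast
    qed
    show "(\<lambda>s. c s j) ` {..<q * S} \<subseteq> A \<inter> V j" using cV j unfolding A_def by blast
  qed
  have "tile A" unfolding A_def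
  proof (rule tile_UN)
    show "tile (c s ` {1..k})" if "s \<in> {..<q * S}" for s using tile_clq[OF c(1)] that by simp
    show "disjoint_family_on (\<lambda>s. c s ` {1..k}) {..<q * S}"
    proof (unfold disjoint_family_on_def, intro ballI impI)
      fix u v assume uv: "u \<in> {..<q * S}" "v \<in> {..<q * S}" "u \<noteq> v"
      show "c u ` {1..k} \<inter> c v ` {1..k} = {}"
      proof (rule ccontr)
        assume "\<not> ?thesis"
        then obtain i j where ij: "i \<in> {1..k}" "j \<in> {1..k}" "c u i = c v j" by blast
        then have "i = j" using part_unique[of "c u i" i j] cV[of u i] cV[of v j] uv by simp
        then show False using inj_onD[OF inj[OF ij(1)] _ uv(1,2)] ij uv(3) by blast
      qed
    qed
  qed simp
  moreover have "A \<inter> V 1 \<subseteq> a ` {..<q * S}" unfolding AV[OF one] using c(2) by auto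
  moreover have "A \<inter> V j \<subseteq> (\<Union>g<p. F j g)" if "j \<in> {1..k} - {1}" for j
  proof -
    have "j \<in> {1..k}" using that by blast
    then show ?thesis unfolding AV[OF \<open>j \<in> {1..k}\<close>] using cF[OF _ that] by (intro image_subsetI) simp
  qed
  moreover have "card (A \<inter> V j) = q * S" if "j \<in> {1..k}" for j
    unfolding AV[OF that] using card_image[OF inj[OF that]] by simp
  ultimately show ?thesis by (intro exI[of _ A] conjI ballI)
qed

lemma nb_sym: "u \<in> V i \<Longrightarrow> x \<in> V j \<Longrightarrow> x \<in> nb j u \<longleftrightarrow> u \<in> nb i x"
  by (simp add: nb_def insert_commute)

text \<open>Balanced colourings cut each leaf part into \<open>p\<close> pieces of about
  \<open>z\<close> vertices and the first part into \<open>q\<close> slots of about \<open>y\<close>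
  centres; colouring the first part by neighbourhoods of leaves is what yields \<open>slot\<close>.
  Since \<open>p\<close> is large compared with \<open>q\<close>, a piece is small compared with the
  degree surplus \<open>t\<close> in a slot. Six slots are sacrificed: five for the garbage, one to
  make \<open>total\<close> strict.\<close>

lemma almost_cover:
  fixes \<theta> :: real and q p w h :: nat
  assumes H: "hole_free ({1..k} - {1}) h" and h: "1 \<le> h"
    and W: "\<And>j. j \<in> {1..k} \<Longrightarrow> W j \<subseteq> V j" "\<And>j. j \<in> {1..k} \<Longrightarrow> card (W j) = w"
    and \<theta>: "0 < \<theta>" "\<theta> \<le> 1/2" and q: "7 \<le> q" and p: "4 * real q / \<theta> \<le> real p"
    and deg: "\<And>u j. u \<in> W 1 \<Longrightarrow> j \<in> {1..k} - {1} \<Longrightarrow> (1/2 + \<theta>) * w \<le> real (card (nb j u \<inter> W j))"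
      "\<And>x j. j \<in> {1..k} - {1} \<Longrightarrow> x \<in> W j \<Longrightarrow> (1/2 + \<theta>) * w \<le> real (card (nb 1 x \<inter> W 1))"
    and hw: "2 * real p * h + 4 \<le> \<theta> * w / q"
    and w1: "32 * real 2 * real p / (\<theta> / (real p * (real p + 2))) ^ 4 < w"
    and w2: "32 * real k * real q / (\<theta> / (4 * real q * (real q + 2))) ^ 4 < w"
  shows "\<exists>A. tile A \<and> A \<subseteq> (\<Union>j\<in>{1..k}. W j) \<and> (\<forall>j\<in>{1..k}. real (card (W j - A)) \<le> 7 * w / q + q)"
proof -
  have one: "1 \<in> {1..k}" using k3 by simp
  have finW: "finite (W j)" if "j \<in> {1..k}" for j using W(1)[OF that] finV[OF that] finite_subset by blast
  define y where "y = w / real q"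
  define z where "z = w / real p"
  define t where "t = \<theta> * y"
  have q0: "real q > 0" "q > 0" using q by auto
  have p0: "real p > 0" 
  proof -
    have "0 < 4 * real q / \<theta>" using q0 \<theta> by simp
    then show ?thesis using p by linarith
  qed
  have "0 \<le> 32 * real 2 * real p / (\<theta> / (real p * (real p + 2))) ^ 4"
    using \<theta> by (intro divide_nonneg_nonneg mult_nonneg_nonneg zero_le_power) auto
  then have w0: "real w > 0" using w1 by linarith
  have qy: "real q * y = w" using q0 by (simp add: y_def)
  have y0: "y > 0" and z0: "z > 0" using w0 q0 p0 by (auto simp: y_def z_def)
  have hw': "2 * real p * h + 4 \<le> t" using hw by (simp add: t_def y_def)
  have t4: "4 \<le> t" 
  proof -
    have "0 \<le> 2 * real p * h" by simp
    then show ?thesis using hw' by linarith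
  qed
  have ty: "t \<le> y / 2" using \<theta> y0 by (simp add: t_def)
  have zt: "4 * z \<le> t"
  proof -
    have "4 * real q \<le> p * \<theta>" using p \<theta> by (simp add: field_simps)
    then have "real w * (4 * real q) \<le> real w * (p * \<theta>)" by (intro mult_left_mono) auto
    then show ?thesis using p0 q0 by (simp add: z_def t_def y_def field_simps)
  qed
  have hz: "2 * real h \<le> \<theta> * z"
  proof -
    have "2 * real p * h \<le> \<theta> * y" using hw' by (simp add: t_def)
    also have "\<dots> \<le> \<theta> * w" using \<theta> q0 w0 unfolding y_def by (intro mult_left_mono) (auto simp: field_simps)
    finally show ?thesis using p0 by (simp add: z_def field_simps)
  qed
  \<comment> \<open>The upper bound on a piece carries \<open>p\<close> errors, twice the bound on a
    neighbourhood carries two. Together they are \<open>\<theta> * z\<close>, half of the surplus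
    \<open>2 * \<theta> * z\<close> in \<open>half\<close>; the other half is left for
    \<open>2 * h\<close>.\<close>
  define \<epsilon>1 where "\<epsilon>1 = \<theta> / (real p * (real p + 2))"
  have \<epsilon>1: "\<epsilon>1 > 0" unfolding \<epsilon>1_def using \<theta> p0 by (intro divide_pos_pos mult_pos_pos) auto
  have \<epsilon>1w: "(real p + 2) * (\<epsilon>1 * w) = \<theta> * z" 
  proof -
    have "real p + 2 \<noteq> 0" using p0 by linarith
    then show ?thesis using p0 by (simp add: \<epsilon>1_def z_def)
  qed
  have "\<exists>f. f \<in> W j \<rightarrow> {..<p} \<and> (\<forall>A\<in>insert (W j) ((\<lambda>u. nb j u \<inter> W j) ` W 1). \<forall>c<p.
      card A / p - \<epsilon>1 * w \<le> real (card {u \<in> A. f u = c}))" if j: "j \<in> {1..k} - {1}" for j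
  proof -
    have "card (insert (W j) ((\<lambda>u. nb j u \<inter> W j) ` W 1)) \<le> Suc (card ((\<lambda>u. nb j u \<inter> W j) ` W 1))"
      by (rule card_insert_le_m1) simp_all
    also have "card ((\<lambda>u. nb j u \<inter> W j) ` W 1) \<le> w" using card_image_le[OF finW[OF one]] W(2)[OF one] by metis
    finally have cF: "card (insert (W j) ((\<lambda>u. nb j u \<inter> W j) ` W 1)) \<le> 2 * card (W j)" using w0 W(2)[of j] j by simp
    have cw: "card (W j) = w" using W(2)[of j] j by blast
    have "\<exists>f. f \<in> W j \<rightarrow> {..<p} \<and> (\<forall>A\<in>insert (W j) ((\<lambda>u. nb j u \<inter> W j) ` W 1). \<forall>c<p.
      card A / p - \<epsilon>1 * card (W j) \<le> real (card {u \<in> A. f u = c}))"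
    proof (rule balanced_colouring[OF _ \<epsilon>1 _ _ cF])
      show "finite (W j)" using finW[of j] j by blast
      show "32 * real 2 * real p / \<epsilon>1 ^ 4 < real (card (W j))" unfolding cw \<epsilon>1_def by (rule w1)
    qed (use p0 in auto)
    then show ?thesis unfolding cw .
  qed
  then have "\<exists>col. \<forall>j\<in>{1..k} - {1}. col j \<in> W j \<rightarrow> {..<p} \<and> (\<forall>A\<in>insert (W j) ((\<lambda>u. nb j u \<inter> W j) ` W 1). \<forall>c<p.
      card A / p - \<epsilon>1 * w \<le> real (card {u \<in> A. col j u = c}))"
    by (intro bchoice ballI)
  then obtain col where col0: "\<forall>j\<in>{1..k} - {1}. col j \<in> W j \<rightarrow> {..<p} \<and> (\<forall>A\<in>insert (W j) ((\<lambda>u. nb j u \<inter> W j) ` W 1). \<forall>c<p.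
      card A / p - \<epsilon>1 * w \<le> real (card {u \<in> A. col j u = c}))" ..
  have col: "col j \<in> W j \<rightarrow> {..<p}" if "j \<in> {1..k} - {1}" for j
    by (rule conjunct1[OF bspec[OF col0 that]])
  have col2: "card A / p - \<epsilon>1 * w \<le> real (card {u \<in> A. col j u = c})"
    if "j \<in> {1..k} - {1}" "A \<in> insert (W j) ((\<lambda>u. nb j u \<inter> W j) ` W 1)" "c < p" for j A c
    using bspec[OF conjunct2[OF bspec[OF col0 that(1)]] that(2)] that(3) by blast
  define F where "F j g = {x \<in> W j. col j x = g}" for j g
  have F_upper: "real (card (F j g)) \<le> z + p * (\<epsilon>1 * w)" if "j \<in> {1..k} - {1}" "g < p" for j g
  proof -
    have j: "j \<in> {1..k}" using that by blast
    have "card (W j) / p - \<epsilon>1 * w \<le> real (card {u \<in> W j. col j u = c})" if "c < p" for c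
      by (rule col2[OF \<open>j \<in> {1..k} - {1}\<close> insertI1 that])
    from colour_class_upper[OF finW[OF j] col[OF that(1)] that(2) _ this]
    show ?thesis using \<epsilon>1 by (simp add: F_def z_def W(2)[OF j])
  qed
  have F_nb: "(1/2 + \<theta>) * z - \<epsilon>1 * w \<le> real (card (nb j u \<inter> F j g))" if "j \<in> {1..k} - {1}" "g < p" "u \<in> W 1" for j g u
  proof -
    have eq: "nb j u \<inter> F j g = {x \<in> nb j u \<inter> W j. col j x = g}" by (auto simp: F_def)
    have "card (nb j u \<inter> W j) / p - \<epsilon>1 * w \<le> real (card {x \<in> nb j u \<inter> W j. col j x = g})"
      using that by (intro col2) auto
    moreover have "(1/2 + \<theta>) * z \<le> card (nb j u \<inter> W j) / p"
      using divide_right_mono[OF deg(1)[OF that(3,1)], of "real p"] by (simp add: z_def)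
    ultimately show ?thesis unfolding eq by linarith
  qed
  \<comment> \<open>Here \<open>q\<close> errors come from the upper bound on a class, one from the
    neighbourhood and one from trimming the class to \<open>S\<close> centres; they add up to
    \<open>t / 4\<close>.\<close>
  define \<epsilon>2 where "\<epsilon>2 = \<theta> / (4 * real q * (real q + 2))"
  have \<epsilon>2: "\<epsilon>2 > 0" unfolding \<epsilon>2_def using \<theta> q0 by (intro divide_pos_pos mult_pos_pos) auto
  have \<epsilon>2w: "(real q + 2) * (\<epsilon>2 * w) = t / 4" 
  proof -
    have "real q + 2 \<noteq> 0" using q0 by linarith
    then show ?thesis using q0 by (simp add: \<epsilon>2_def t_def y_def)
  qed
  define \<F> where "\<F> = insert (W 1) (\<Union>j\<in>{1..k} - {1}. (\<lambda>x. nb 1 x \<inter> W 1) ` W j)"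
  have "card \<F> \<le> Suc (card ({1..k} - {1})) * w"
    unfolding \<F>_def using W(2) finW w0 by (intro card_insert_UN_image_le) auto
  also have "Suc (card ({1..k} - {1})) = k" using k3 by simp
  also have "w = card (W 1)" using W(2)[OF one] by simp
  finally have "card \<F> \<le> k * card (W 1)" .
  moreover have "\<F> \<subseteq> Pow (W 1)" by (auto simp: \<F>_def)
  moreover have "32 * real k * real q / \<epsilon>2 ^ 4 < real (card (W 1))"
    unfolding W(2)[OF one] \<epsilon>2_def by (rule w2)
  ultimately have "\<exists>f. f \<in> W 1 \<rightarrow> {..<q} \<and> (\<forall>A\<in>\<F>. \<forall>c<q. card A / q - \<epsilon>2 * card (W 1) \<le> real (card {u \<in> A. f u = c}))"
    by (intro balanced_colouring[OF q0(2) \<epsilon>2 finW[OF one]])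
  then obtain cc where cc: "cc \<in> W 1 \<rightarrow> {..<q}"
    "\<And>A c. A \<in> \<F> \<Longrightarrow> c < q \<Longrightarrow> card A / q - \<epsilon>2 * w \<le> real (card {u \<in> A. cc u = c})" unfolding W(2)[OF one] by blast
  define C where "C r = {u \<in> W 1. cc u = r}" for r
  have C_lower: "y - \<epsilon>2 * w \<le> real (card (C r))" if "r < q" for r
    using cc(2)[of "W 1" r] that unfolding C_def \<F>_def y_def W(2)[OF one] by simp
  have C_upper: "real (card (C r)) \<le> y + q * (\<epsilon>2 * w)" if "r < q" for r
  proof -
    have "card (W 1) / q - \<epsilon>2 * w \<le> real (card {u \<in> W 1. cc u = c})" if "c < q" for c
      by (rule cc(2)[OF _ that]) (simp add: \<F>_def)
    from colour_class_upper[OF finW[OF one] cc(1) that _ this]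
    show ?thesis using \<epsilon>2 unfolding C_def y_def W(2)[OF one] by simp
  qed
  have C_nb: "(1/2 + \<theta>) * y - \<epsilon>2 * w \<le> real (card (nb 1 x \<inter> C r))" if "r < q" "j \<in> {1..k} - {1}" "x \<in> W j" for r j x
  proof -
    have eq: "nb 1 x \<inter> C r = {u \<in> nb 1 x \<inter> W 1. cc u = r}" by (auto simp: C_def)
    have "card (nb 1 x \<inter> W 1) / q - \<epsilon>2 * w \<le> real (card {u \<in> nb 1 x \<inter> W 1. cc u = r})"
      using that by (intro cc(2)) (auto simp: \<F>_def)
    moreover have "(1/2 + \<theta>) * y \<le> card (nb 1 x \<inter> W 1) / q"
      using divide_right_mono[OF deg(2)[OF that(2,3)], of "real q"] by (simp add: y_def)
    ultimately show ?thesis unfolding eq by linarith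
  qed
  have \<epsilon>2t: "0 \<le> \<epsilon>2 * w" "q * (\<epsilon>2 * w) + 2 * (\<epsilon>2 * w) = t / 4" using \<epsilon>2 \<epsilon>2w by (auto simp: algebra_simps)
  have \<epsilon>2s: "\<epsilon>2 * w \<le> t / 8" "0 \<le> q * (\<epsilon>2 * w)" using \<epsilon>2t by (auto simp: \<epsilon>2)
  define S where "S = nat \<lfloor>y - \<epsilon>2 * w\<rfloor>"
  have Sr: "real S \<le> y - \<epsilon>2 * w" "y - \<epsilon>2 * w - 1 < S"
    using \<epsilon>2s ty y0 unfolding S_def by linarith+
  have "\<exists>c. bij_betw c {..<S} (c ` {..<S}) \<and> c ` {..<S} \<subseteq> C r" if "r < q" for r
  proof -
    have "S \<le> card (C r)" using C_lower[OF that] Sr by linarith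
    then obtain C' where C': "C' \<subseteq> C r" "card C' = S" "finite C'" by (metis obtain_subset_with_card_n)
    then obtain c where "bij_betw c {0..<S} C'" using ex_bij_betw_nat_finite by blast
    then show ?thesis using C'(1) by (intro exI[of _ c]) (auto simp: bij_betw_def lessThan_atLeast0)
  qed
  then have "\<exists>cen. \<forall>r\<in>{..<q}. bij_betw (cen r) {..<S} (cen r ` {..<S}) \<and> cen r ` {..<S} \<subseteq> C r"
    by (intro bchoice ballI) simp
  then obtain cen where "\<forall>r\<in>{..<q}. bij_betw (cen r) {..<S} (cen r ` {..<S}) \<and> cen r ` {..<S} \<subseteq> C r" ..
  then have cen: "inj_on (cen r) {..<S}" "cen r ` {..<S} \<subseteq> C r" if "r < q" for r
    using that by (auto simp only: bij_betw_def lessThan_iff)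
  define a where "a s = cen (s div S) (s mod S)" for s
  have S1: "1 \<le> S" using Sr \<epsilon>2s ty t4 y0 by linarith
  have aval: "a (r * S + i) = cen r i" if "i < S" for r i using that by (simp add: a_def)
  define q' where "q' = q - 6"
  have q': "q' \<le> q" "real q' = real q - 6" using q by (auto simp: q'_def)
  have sq: "s div S < q" "s mod S < S" if "s < q' * S" for s
  proof -
    have "s div S < q'" using that by (simp add: less_mult_imp_div_less)
    then show "s div S < q" using q' by simp
    show "s mod S < S" using S1 by simp
  qed
  have aC: "a s \<in> C (s div S)" if "s < q' * S" for s using cen(2)[OF sq(1)[OF that]] sq(2)[OF that] by (auto simp: a_def)
  have aW: "a s \<in> W 1" if "s < q' * S" for s using aC[OF that] by (simp add: C_def)
  have inja: "inj_on a {..<q' * S}"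
  proof (rule inj_onI)
    fix s s' assume s: "s \<in> {..<q' * S}" "s' \<in> {..<q' * S}" "a s = a s'"
    have div: "s div S = s' div S" using aC[of s] aC[of s'] s by (auto simp: C_def)
    then have "cen (s div S) (s mod S) = cen (s div S) (s' mod S)" using s(3) by (simp add: a_def)
    then have "s mod S = s' mod S" using inj_onD[OF cen(1)[OF sq(1)]] sq(2) s by simp
    then show "s = s'" using div by (metis div_mult_mod_eq)
  qed
  \<comment> \<open>A neighbourhood in a class loses one error to the colouring, and trimming the
    class to \<open>S\<close> costs at most \<open>(q + 1) * (\<epsilon>2 * w) + 1\<close> vertices
    more.\<close>
  define d where "d = nat \<lfloor>(1/2 + \<theta>) * y - (q + 2) * (\<epsilon>2 * w) - 1\<rfloor>"
  have y\<theta>: "(1/2 + \<theta>) * y = y / 2 + t" by (simp add: t_def algebra_simps)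
  have dr: "real d \<le> y / 2 + t - t / 4 - 1" "y / 2 + t - t / 4 - 2 \<le> real d"
    using \<epsilon>2w ty t4 y0 unfolding d_def y\<theta> by (simp_all add: algebra_simps) linarith+
  define f where "f = nat \<lfloor>2 * z\<rfloor>"
  have fr: "real f \<le> 2 * z" using z0 unfolding f_def by linarith
  have \<epsilon>1t: "p * (\<epsilon>1 * w) + 2 * (\<epsilon>1 * w) = \<theta> * z" using \<epsilon>1w by (simp add: algebra_simps)
  have \<epsilon>1s: "0 \<le> \<epsilon>1 * w" using \<epsilon>1 by simp
  have \<theta>z: "\<theta> * z \<le> z" using \<theta> z0 by simp
  have FU: "(\<Union>g<p. F j g) = W j" if "j \<in> {1..k} - {1}" for j using col[OF that] by (auto simp: F_def)
  have "\<exists>A. tile A \<and> A \<inter> V 1 \<subseteq> a ` {..<q' * S} \<and> (\<forall>j\<in>{1..k} - {1}. A \<inter> V j \<subseteq> (\<Union>g<p. F j g)) \<and>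
    (\<forall>j\<in>{1..k}. card (A \<inter> V j) = q' * S)"
  proof (rule star_tiling[OF H inja])
    show "a ` {..<q' * S} \<subseteq> V 1" using aW W(1)[OF one] by auto
    show "F j g \<subseteq> V j" if "j \<in> {1..k} - {1}" for j g using W(1)[of j] that by (auto simp: F_def)
    show "disjoint_family_on (F j) {..<p}" for j by (auto simp: disjoint_family_on_def F_def)
    show "card (F j g) \<le> f" if "j \<in> {1..k} - {1}" "g < p" for j g
    proof -
      have "real (card (F j g)) \<le> 2 * z" using F_upper[OF that] \<epsilon>1t \<epsilon>1s \<theta>z by linarith
      then show ?thesis unfolding f_def by linarith
    qed
    show "card (F j g) + 2 * h \<le> 2 * card (nb j (a s) \<inter> F j g)" if "j \<in> {1..k} - {1}" "s < q' * S" "g < p" for j s g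
    proof -
      have "(1/2 + \<theta>) * z = z / 2 + \<theta> * z" by (simp add: algebra_simps)
      then have "real (card (F j g)) + 2 * real h \<le> 2 * real (card (nb j (a s) \<inter> F j g))"
        using F_upper[OF that(1,3)] F_nb[OF that(1,3) aW[OF that(2)]] \<epsilon>1t hz by linarith
      then show ?thesis by linarith
    qed
    show "d \<le> card {i \<in> {..<S}. x \<in> nb j (a (r * S + i))}"
      if "j \<in> {1..k} - {1}" "r < q'" "x \<in> (\<Union>g<p. F j g)" for j r x
    proof -
      have x: "x \<in> W j" using that(3) FU[OF that(1)] by simp
      have r: "r < q" using that(2) q' by simp
      have finC: "finite (C r)" using finW[OF one] by (simp add: C_def)
      have img: "cen r ` {i \<in> {..<S}. x \<in> nb j (a (r * S + i))} = nb 1 x \<inter> cen r ` {..<S}"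
      proof -
        have "x \<in> nb j (cen r i) \<longleftrightarrow> cen r i \<in> nb 1 x" if "i < S" for i
        proof (rule nb_sym)
          show "cen r i \<in> V 1" using cen(2)[OF r] that W(1)[OF one] by (auto simp: C_def)
          show "x \<in> V j" using x W(1)[of j] \<open>j \<in> {1..k} - {1}\<close> by auto
        qed
        then show ?thesis using aval by auto
      qed
      have "card {i \<in> {..<S}. x \<in> nb j (a (r * S + i))} = card (nb 1 x \<inter> cen r ` {..<S})"
      proof -
        have "inj_on (cen r) {i \<in> {..<S}. x \<in> nb j (a (r * S + i))}"
          by (rule inj_on_subset[OF cen(1)[OF r]]) blast
        from card_image[OF this] show ?thesis
          unfolding img by simp
      qed
      moreover have "card (nb 1 x \<inter> C r) \<le> card (nb 1 x \<inter> cen r ` {..<S}) + (card (C r) - S)"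
      proof -
        have "card (C r - cen r ` {..<S}) = card (C r) - S"
          using cen(2)[OF r] card_image[OF cen(1)[OF r]] by (subst card_Diff_subset) auto
        moreover have "card (nb 1 x \<inter> C r) \<le> card ((nb 1 x \<inter> cen r ` {..<S}) \<union> (C r - cen r ` {..<S}))"
          using finC by (intro card_mono) auto
        ultimately show ?thesis by (metis card_Un_le order_trans)
      qed
      moreover have "S \<le> card (C r)" using C_lower[OF r] Sr by linarith
      ultimately have "real (card (nb 1 x \<inter> C r)) \<le> real (card {i \<in> {..<S}. x \<in> nb j (a (r * S + i))}) + card (C r) - S"
        by linarith
      then have "real d \<le> real (card {i \<in> {..<S}. x \<in> nb j (a (r * S + i))})"
        using C_nb[OF r that(1) x] C_upper[OF r] Sr \<epsilon>2t dr(1) y\<theta> by linarith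
      then show ?thesis by linarith
    qed
    \<comment> \<open>The left side is at most y + t/2 + (t - 4), by f <= 2z <= t/2 and
      \<open>hw'\<close>; the right side is at least y + 3t/2 - 4. The 4 in \<open>hw\<close> pays
      for the rounding of \<open>d\<close>.\<close>
    show "S + f + 2 * p * h \<le> 2 * d"
    proof -
      have "real S + real f + 2 * real p * real h \<le> 2 * real d"
        using Sr fr zt dr(2) hw' \<epsilon>2t by linarith
      then show ?thesis by (metis (mono_tags, lifting) of_nat_add of_nat_le_iff of_nat_mult of_nat_numeral)
    qed
    show "1 \<le> h" by (rule h)
    show "f \<le> S"
    proof -
      have "real f \<le> real S" using fr zt Sr ty t4 \<epsilon>2s y0 by linarith
      then show ?thesis by linarith
    qed
    show "1 \<le> S" by (rule S1)
    show "q' * S + 5 * S < card (\<Union>g<p. F j g)" if "j \<in> {1..k} - {1}" for j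
    proof -
      have "real (q' * S + 5 * S) = (real q - 1) * S"
        unfolding of_nat_add of_nat_mult q'(2) by (simp add: algebra_simps)
      also have "\<dots> \<le> (real q - 1) * y" using Sr \<epsilon>2t q by (intro mult_left_mono) auto
      also have "\<dots> = w - y" using qy by (simp add: left_diff_distrib)
      also have "\<dots> < w" using y0 by simp
      finally have "q' * S + 5 * S < w" by linarith
      then show ?thesis using FU[OF that] W(2)[of j] that by simp
    qed
  qed
  then obtain A where A: "tile A" "A \<inter> V 1 \<subseteq> a ` {..<q' * S}" "\<And>j. j \<in> {1..k} - {1} \<Longrightarrow> A \<inter> V j \<subseteq> W j"
    "\<And>j. j \<in> {1..k} \<Longrightarrow> card (A \<inter> V j) = q' * S" using FU by auto
  have AW: "A \<inter> V j \<subseteq> W j" if "j \<in> {1..k}" for j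
  proof (cases "j = 1")
    case True
    have "a ` {..<q' * S} \<subseteq> W 1" using aW by auto
    then show ?thesis using A(2) True by blast
  next
    case False
    then show ?thesis using A(3)[of j] that by blast
  qed
  have "A \<subseteq> (\<Union>j\<in>{1..k}. W j)" using tile_subset[OF A(1)] AW unfolding VV_def by blast
  moreover have "real (card (W j - A)) \<le> 7 * w / q + q" if j: "j \<in> {1..k}" for j
  proof -
    have "W j \<inter> A = A \<inter> V j" using AW[OF j] W(1)[OF j] by blast
    then have "card (W j - A) + q' * S = w"
      using card_Int_Diff[OF finW[OF j], of A] A(4)[OF j] W(2)[OF j] by simp
    then have "real (card (W j - A)) + real q' * real S = w" by (metis of_nat_add of_nat_mult)
    moreover have "real q' * (y - \<epsilon>2 * w - 1) \<le> real q' * real S" using Sr by (intro mult_left_mono) auto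
    moreover have "real q' * (y - \<epsilon>2 * w - 1) = w - 6 * y - real q' * (\<epsilon>2 * w) - real q'"
      using qy unfolding q'(2) by (simp add: algebra_simps)
    moreover have "real q' * (\<epsilon>2 * w) \<le> q * (\<epsilon>2 * w)" using q' \<epsilon>2t by (intro mult_right_mono) auto
    ultimately have "real (card (W j - A)) \<le> 7 * y + q" using \<epsilon>2t ty q' y0 by linarith
    then show ?thesis by (simp add: y_def)
  qed
  ultimately show ?thesis using A(1) by blast
qed

section \<open>Degree and hole conditions\<close>

text \<open>The induced graph is symmetric in \<open>i\<close> and \<open>j\<close>, so the
  restriction to \<open>i < j\<close> in \<open>delta_star\<close> is harmless. As \<open>E\<close>
  lies in the blow-up, every induced edge at \<open>v\<close> has its other end in
  \<open>V j\<close>.\<close>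

lemma delta_star_le_card_nb:
  assumes E: "E \<subseteq> blowup_edges k V" and ij: "i \<in> {1..k}" "j \<in> {1..k}" "i \<noteq> j" and v: "v \<in> V i"
  shows "delta_star k V E \<le> card (nb j v)"
proof -
  define md where "md i j = min_degree (V i \<union> V j) (induced_edges E (V i \<union> V j))" for i j
  have md_sym: "md i j = md j i" for i j by (simp add: md_def Un_commute)
  have "{md i j | i j. 1 \<le> i \<and> i < j \<and> j \<le> k} \<subseteq> (\<lambda>(i, j). md i j) ` ({1..k} \<times> {1..k})" by auto
  then have fin: "finite {md i j | i j. 1 \<le> i \<and> i < j \<and> j \<le> k}" by (rule finite_subset) simp
  have le: "Min {md i j | i j. 1 \<le> i \<and> i < j \<and> j \<le> k} \<le> md i j" if "1 \<le> i" "i < j" "j \<le> k" for i j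
    using that by (intro Min_le fin) blast
  have "delta_star k V E \<le> md i j"
    using le[of i j] le[of j i] ij md_sym[of i j] unfolding delta_star_def md_def[symmetric]
    by (cases "i < j") auto
  also have "md i j \<le> vertex_degree (induced_edges E (V i \<union> V j)) v"
    unfolding md_def min_degree_def using finV ij v by (intro Min_le) auto
  also have "\<dots> \<le> card ((\<lambda>u. {v, u}) ` nb j v)"
    unfolding vertex_degree_def
  proof (rule card_mono)
    show "finite ((\<lambda>u. {v, u}) ` nb j v)" using finite_nb[OF ij(2)] by simp
    show "{e \<in> induced_edges E (V i \<union> V j). v \<in> e} \<subseteq> (\<lambda>u. {v, u}) ` nb j v"
    proof
      fix e assume "e \<in> {e \<in> induced_edges E (V i \<union> V j). v \<in> e}"
      then have e: "e \<in> E" "e \<subseteq> V i \<union> V j" "v \<in> e" by (auto simp: induced_edges_def)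
      then obtain x y a b where xy: "e = {x, y}" "a \<in> {1..k}" "b \<in> {1..k}" "a \<noteq> b" "x \<in> V a" "y \<in> V b"
        using E unfolding blowup_edges_def by blast
      have other: "u \<in> V j" if "e = {v, u}" "u \<in> V c" "v \<in> V d" "c \<noteq> d" "c \<in> {1..k}" "d \<in> {1..k}" for u c d
      proof -
        have "d = i" using part_unique[OF that(3) v that(6) ij(1)] .
        then have "u \<notin> V i" using part_unique[OF that(2) _ that(5) ij(1)] that(4) by blast
        then show ?thesis using e(2) that(1) by blast
      qed
      show "e \<in> (\<lambda>u. {v, u}) ` nb j v"
      proof (cases "v = x")
        case True
        then have "y \<in> V j" using other[of y b a] xy by blast
        then show ?thesis using True xy e(1) by (auto simp: nb_def)
      next
        case False
        then have "v = y" using e(3) xy(1) by blast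
        then have "x \<in> V j" using other[of x a b] xy by blast
        then show ?thesis using \<open>v = y\<close> xy e(1) by (auto simp: nb_def insert_commute)
      qed
    qed
  qed
  also have "\<dots> \<le> card (nb j v)" by (rule card_image_le[OF finite_nb[OF ij(2)]])
  finally show ?thesis .
qed

text \<open>Large sets are trimmed to size exactly \<open>s\<close>. Because \<open>J\<close> is
  nonempty, hole sizes are at most \<open>n\<close>; so the \<open>Max\<close> in
  \<open>alpha_star\<close> ranges over a finite set, and a hole of size \<open>s\<close> would
  exceed it.\<close>

lemma hole_free_of_alpha_star:
  assumes J: "J \<subseteq> {1..k}" "J \<noteq> {}" and s: "alpha_star (card J) k V E < s"
  shows "hole_free J s"
  unfolding hole_free_def
proof (intro allI impI)
  fix U assume U: "\<forall>j\<in>J. U j \<subseteq> V j \<and> s \<le> card (U j)"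
  have "\<forall>j\<in>J. \<exists>U'. U' \<subseteq> U j \<and> card U' = s" using U by (meson obtain_subset_with_card_n)
  then obtain U' where U': "\<forall>j\<in>J. U' j \<subseteq> U j \<and> card (U' j) = s" by metis
  have UV: "U' j \<subseteq> V j" if "j \<in> J" for j using U U' that by blast
  have "{s. \<exists>I U. partite_hole k V E (card J) s I U} \<subseteq> {..n}"
  proof
    fix t assume "t \<in> {s. \<exists>I U. partite_hole k V E (card J) s I U}"
    then obtain I U where h: "partite_hole k V E (card J) t I U" by blast
    have "finite J" using J(1) finite_subset by blast
    then have "card J > 0" using J(2) by (simp add: card_gt_0_iff)
    then have "card I > 0" using h by (simp add: partite_hole_def)
    then obtain i where i: "i \<in> I" by (auto simp: card_gt_0_iff)
    then have "i \<in> {1..k}" "U i \<subseteq> V i" "card (U i) = t" using h by (auto simp: partite_hole_def)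
    then show "t \<in> {..n}" using card_mono[OF finV, of i "U i"] cardV by simp
  qed
  then have "finite {s. \<exists>I U. partite_hole k V E (card J) s I U}" by (rule finite_subset) simp
  then have "\<not> partite_hole k V E (card J) s J U'"
    using Max_ge[of "{s. \<exists>I U. partite_hole k V E (card J) s I U}" s] s unfolding alpha_star_def by fastforce
  then obtain W where W: "transversal_clique J U' E W"
    using J U' UV unfolding partite_hole_def by blast
  then have "\<forall>j\<in>J. \<exists>c. W \<inter> U' j = {c}" unfolding transversal_clique_def by (metis card_1_singletonE)
  then obtain c where c: "\<forall>j\<in>J. W \<inter> U' j = {c j}" by metis
  have cW: "c j \<in> W" "c j \<in> U' j" if "j \<in> J" for j using c that by blast+
  have "clq J c" unfolding clq_def
  proof (intro conjI ballI impI)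
    fix i assume i: "i \<in> J"
    show "c i \<in> V i" using cW[OF i] UV[OF i] by blast
    fix j assume j: "j \<in> J" "i \<noteq> j"
    have "c i \<noteq> c j" using part_unique[of "c i" i j] cW i j UV J(1) by (metis subsetD)
    then show "{c i, c j} \<in> E" using W cW(1) i j unfolding transversal_clique_def is_clique_def by blast
  qed
  then show "\<exists>c. clq J c \<and> (\<forall>j\<in>J. c j \<in> U j)" using cW(2) U' by blast
qed

text \<open>The missing part contributes all of \<open>V i\<close>, which is large enough by
  \<open>h \<le> n\<close>.\<close>

lemma hole_free_remove:
  assumes H: "hole_free {1..k} h" and i: "i \<in> {1..k}" and hn: "h \<le> n"
  shows "hole_free ({1..k} - {i}) h"
  unfolding hole_free_def
proof (intro allI impI)
  fix U assume U: "\<forall>j\<in>{1..k} - {i}. U j \<subseteq> V j \<and> h \<le> card (U j)"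
  have "\<forall>j\<in>{1..k}. (U(i := V i)) j \<subseteq> V j \<and> h \<le> card ((U(i := V i)) j)"
    using U cardV[OF i] hn by simp
  then obtain c where c: "clq {1..k} c" "\<forall>j\<in>{1..k}. c j \<in> (U(i := V i)) j"
    using H[unfolded hole_free_def, rule_format, of "U(i := V i)"] by blast
  have "clq ({1..k} - {i}) c" using c(1) by (simp add: clq_def)
  moreover have "\<forall>j\<in>{1..k} - {i}. c j \<in> U j"
  proof
    fix j assume j: "j \<in> {1..k} - {i}"
    then have "c j \<in> (U(i := V i)) j" using c(2) by blast
    then show "c j \<in> U j" using j by simp
  qed
  ultimately show "\<exists>c. clq ({1..k} - {i}) c \<and> (\<forall>j\<in>{1..k} - {i}. c j \<in> U j)" by blast
qed

definition min_nb_degree :: "real \<Rightarrow> bool" where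
  "min_nb_degree \<delta> \<longleftrightarrow> (\<forall>i\<in>{1..k}. \<forall>j\<in>{1..k}. i \<noteq> j \<longrightarrow> (\<forall>v\<in>V i. \<delta> * n \<le> real (card (nb j v))))"

lemma min_nb_degreeD:
  "min_nb_degree \<delta> \<Longrightarrow> i \<in> {1..k} \<Longrightarrow> j \<in> {1..k} \<Longrightarrow> i \<noteq> j \<Longrightarrow> v \<in> V i \<Longrightarrow> \<delta> * n \<le> real (card (nb j v))"
  unfolding min_nb_degree_def by simp

text \<open>Two neighbourhoods of size at least \<delta> n in a part of size n share at least (2
  \<delta> - 1) n vertices, so all pairs in a part are linked in a single stage.\<close>

lemma absorb_of_common_neighbours:
  fixes \<delta> :: real
  assumes H1: "\<forall>i\<in>{1..k}. hole_free ({1..k} - {i}) h"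
    and min_nb: "min_nb_degree \<delta>"
    and \<delta>: "\<delta> \<le> 1" and N: "real (N + 2 * k + k * k + h) \<le> (2 * \<delta> - 1) * n"
    and x: "\<forall>i\<in>{1..k}. x i \<in> V i"
  shows "absorb N (k + k * k) x"
proof (rule absorb_from_all_links[where M = "N + 2 * k + k * k"])
  note deg = min_nb_degreeD[OF min_nb]
  have "(2 * \<delta> - 1) * n \<le> \<delta> * n" using \<delta> by (intro mult_right_mono) auto
  moreover have "\<delta> * n \<le> 1 * real n" using \<delta> by (intro mult_right_mono) auto
  ultimately have N': "real (N + 2 * k + k * k + h) \<le> \<delta> * n" "real (N + 2 * k + k * k + h) \<le> n"
    using N by linarith+
  show "hole_free ({1..k} - {i}) h" if "i \<in> {1..k}" for i using H1 that by blast
  show "N + k + h \<le> card (nb j v)" if "i \<in> {1..k}" "j \<in> {1..k}" "i \<noteq> j" "v \<in> V i" for i j v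
  proof -
    have "real (N + k + h) \<le> real (N + 2 * k + k * k + h)" by (intro of_nat_mono) simp
    then have "real (N + k + h) \<le> card (nb j v)" using N' deg[OF that] by linarith
    then show ?thesis by simp
  qed
  have "N + 2 * k + k * k + h \<le> n" using N'(2) by (simp only: of_nat_le_iff)
  then show "N + k < n" using k3 by linarith
  show "N + 2 * k + k * k \<le> N + 2 * k + k * k" by simp
  show "x i \<in> V i" if "i \<in> {1..k}" for i using x that by blast
  show "link (N + 2 * k + k * k) k u v" if i: "i \<in> {1..k}" "u \<in> V i" "v \<in> V i" for i u v
  proof (rule link_common[OF bspec[OF H1 i(1)] i])
    fix j assume j: "j \<in> {1..k} - {i}"
    then have j': "j \<in> {1..k}" "i \<noteq> j" by auto
    have "card (nb j u \<union> nb j v) \<le> n"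
      using card_mono[OF finV[OF j'(1)], of "nb j u \<union> nb j v"] nb_subset cardV[OF j'(1)] by simp
    moreover have "card (nb j u) + card (nb j v) = card (nb j u \<union> nb j v) + card (nb j u \<inter> nb j v)"
      by (rule card_Un_Int[OF finite_nb[OF j'(1)] finite_nb[OF j'(1)]])
    ultimately have "card (nb j u) + card (nb j v) \<le> n + card (nb j u \<inter> nb j v)" by linarith
    then have "real (card (nb j u)) + real (card (nb j v)) \<le> n + real (card (nb j u \<inter> nb j v))"
      by (metis of_nat_add of_nat_le_iff)
    moreover have "\<delta> * n \<le> card (nb j u)" "\<delta> * n \<le> card (nb j v)" using deg i j' by blast+
    moreover have "(2 * \<delta> - 1) * n = 2 * (\<delta> * n) - n" by (simp add: algebra_simps)
    ultimately have "real (N + 2 * k + k * k + h) \<le> real (card (nb j u \<inter> nb j v))" using N by linarith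
    then show "N + 2 * k + k * k + h \<le> card (nb j u \<inter> nb j v)" by (simp only: of_nat_le_iff)
  qed
qed

text \<open>Parameters for the staged construction: twins share about D n / 2 neighbours in each
  part, where D = \<delta>^(2(k-1)), so at most 2 b / D <= \<delta> n / 8 vertices of a part are
  unpopular. Adding b <= \<delta> n / 16 stays below the minimum degree.\<close>

lemma absorb_of_hole_free:
  fixes \<delta> :: real
  assumes H: "hole_free {1..k} h" and H1: "\<forall>i\<in>{1..k}. hole_free ({1..k} - {i}) h"
    and min_nb: "min_nb_degree \<delta>"
    and \<delta>: "0 < \<delta>" "\<delta> \<le> 1"
    and K: "K = 2 * k + 3 * k\<^sup>2 + 6 * k ^ 3 + 4 * k ^ 4 + 2"
    and N: "real (N + 5 * K + h) + 2 \<le> \<delta> * \<delta> ^ (2 * (k - 1)) / 16 * n"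
    and x: "\<forall>i\<in>{1..k}. x i \<in> V i"
  shows "absorb N K x"
proof -
  note deg = min_nb_degreeD[OF min_nb]
  define D where "D = \<delta> ^ (2 * (k - 1))"
  define b where "b = N + 5 * K + h"
  define g where "g = nat \<lfloor>D / 2 * n\<rfloor>"
  define m where "m = nat \<lfloor>2 * b / D\<rfloor>"
  have D: "0 < D" "D \<le> 1" using \<delta> by (auto simp: D_def power_le_one)
  have bD: "real b + 2 \<le> \<delta> * D / 16 * n" using N by (simp add: b_def D_def)
  have n0: "0 < n" using bD by (cases n) auto
  have "\<delta> * D \<le> 1 * D" using \<delta> D by (intro mult_right_mono) auto
  then have "\<delta> * D / 16 * n \<le> D / 16 * n" by (intro mult_right_mono) auto
  then have bD': "real b + 2 \<le> D / 16 * n" using bD by linarith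
  have "real b \<le> \<delta> * n / 16 * D" using bD by (simp add: mult_ac)
  then have "2 * real b / D \<le> \<delta> * n / 8" using D by (simp add: pos_divide_le_eq)
  then have m: "real m \<le> \<delta> * n / 8" 
  proof -
    have "0 \<le> 2 * real b / D" using D by simp
    then have "real m \<le> 2 * real b / D" unfolding m_def by simp
    then show ?thesis using \<open>2 * real b / D \<le> \<delta> * n / 8\<close> by linarith
  qed
  have "\<delta> * D \<le> \<delta> * 1" using \<delta> D by (intro mult_left_mono) auto
  then have "\<delta> * D / 16 * n \<le> \<delta> * 1 / 16 * n" by (intro mult_right_mono divide_right_mono) auto
  then have b\<delta>: "real b + 2 \<le> \<delta> * n / 16" using bD by simp
  have \<delta>n: "\<delta> * n \<le> n" "0 < \<delta> * n" using \<delta> n0 by (auto simp: mult_le_cancel_right1)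
  show ?thesis
  proof (rule absorb_all_of_hole_free[OF H _ K])
    show "hole_free ({1..k} - {i}) h" if "i \<in> {1..k}" for i using H1 that by blast
    show "card {x \<in> V i. card (hnb g i x) < b} \<le> m" if i: "i \<in> {1..k}" for i
    proof -
      have "D / 2 * card {x \<in> V i. card (hnb g i x) < b} \<le> b"
        unfolding D_def
      proof (rule few_unpopular_vertices[OF i n0 \<delta>(1)])
        show "\<delta> * n \<le> real (card (nb j x))" if "x \<in> V i" "j \<in> {1..k} - {i}" for x j
          using deg[OF i _ _ that(1), of j] that(2) by auto
        have "0 \<le> D / 2 * n" using D by simp
        then show "real g \<le> \<delta> ^ (2 * (k - 1)) / 2 * n" unfolding D_def[symmetric] g_def by linarith
      qed
      then have "card {x \<in> V i. card (hnb g i x) < b} \<le> 2 * b / D" using D by (simp add: field_simps)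
      then show ?thesis unfolding m_def by linarith
    qed
    show "N + 5 * K + h \<le> g"
    proof -
      have "real b \<le> D / 2 * n - 1" using bD' D by (simp add: field_simps)
      then have "b \<le> g" unfolding g_def by linarith
      then show ?thesis by (simp add: b_def)
    qed
    show "N + 5 * K + h \<le> b" by (simp add: b_def)
    show "N + 5 * K + m < n"
    proof -
      have "real (b + m) < n" using m b\<delta> \<delta>n unfolding of_nat_add by linarith
      then show ?thesis by (simp add: b_def)
    qed
    show "N + 5 * K + h + m \<le> card (nb j v)" if "i \<in> {1..k}" "j \<in> {1..k}" "i \<noteq> j" "v \<in> V i" for i j v
    proof -
      have "real (b + m) \<le> card (nb j v)" using m b\<delta> \<delta>n deg[OF that] unfolding of_nat_add by linarith
      then show ?thesis by (simp add: b_def)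
    qed
    show "x i \<in> V i" if "i \<in> {1..k}" for i using x that by blast
  qed
qed

text \<open>One class of a balanced colouring of each part with \<open>N\<close> colours, trimmed to
  a common size. A neighbourhood keeps at least 3/4 \<delta> n / N - 1 vertices in it, and 4 N <=
  \<delta> n makes this at least \<delta> n / (2 N).\<close>

lemma exists_flexible:
  fixes \<delta> :: real
  assumes min_nb: "min_nb_degree \<delta>"
    and \<delta>: "0 < \<delta>" "\<delta> \<le> 1" and N: "0 < N" and n: "4 * real N \<le> \<delta> * n"
    and large: "32 * real k * real N / (\<delta> / (4 * real N * (real N + 2))) ^ 4 < n"
    and d: "real d \<le> \<delta> * n / (2 * real N)"
  shows "\<exists>X m. flexible X d \<and> (\<forall>j\<in>{1..k}. card (X j) = m) \<and> real m \<le> n / N \<and> n / (2 * real N) \<le> real m"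
proof -
  note deg = min_nb_degreeD[OF min_nb]
  define \<epsilon> where "\<epsilon> = \<delta> / (4 * real N * (real N + 2))"
  define y where "y = n / real N"
  have N0: "real N > 0" using N by simp
  have \<epsilon>: "\<epsilon> > 0" unfolding \<epsilon>_def using \<delta> N0 by (intro divide_pos_pos mult_pos_pos) auto
  have n0: "0 < n" using n N0 by (cases n) auto
  have \<epsilon>n: "(real N + 2) * (\<epsilon> * n) = \<delta> * y / 4"
  proof -
    have "real N + 2 \<noteq> 0" using N0 by linarith
    then show ?thesis using N0 by (simp add: \<epsilon>_def y_def)
  qed
  have \<epsilon>n0: "0 \<le> \<epsilon> * n" "N * (\<epsilon> * n) + 2 * (\<epsilon> * n) = \<delta> * y / 4" using \<epsilon> \<epsilon>n by (auto simp: algebra_simps)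
  have y4: "4 \<le> \<delta> * y" using n N0 by (simp add: y_def pos_le_divide_eq mult.commute)
  have "0 \<le> y" by (simp add: y_def)
  then have \<delta>y: "\<delta> * y \<le> y" using \<delta> by (intro mult_left_le_one_le) auto
  have N\<epsilon>: "0 \<le> N * (\<epsilon> * n)" using \<epsilon>n0 by simp
  define m where "m = nat \<lfloor>y - \<epsilon> * n\<rfloor>"
  have m: "real m \<le> y - \<epsilon> * n" "y - \<epsilon> * n - 1 < real m"
    using \<epsilon>n0 N\<epsilon> \<delta>y y4 unfolding m_def by linarith+
  have "\<exists>X. X \<subseteq> V j \<and> card X = m \<and> (\<forall>i\<in>{1..k} - {j}. \<forall>v\<in>V i. d \<le> card (nb j v \<inter> X))" if j: "j \<in> {1..k}" for j
  proof -
    define \<F> where "\<F> = insert (V j) (\<Union>i\<in>{1..k} - {j}. nb j ` V i)"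
    have "card \<F> \<le> Suc (card ({1..k} - {j})) * n"
      unfolding \<F>_def using cardV finV n0 by (intro card_insert_UN_image_le) auto
    also have "Suc (card ({1..k} - {j})) = k" using j by simp
    also have "n = card (V j)" using cardV[OF j] by simp
    finally have "card \<F> \<le> k * card (V j)" .
    moreover have "\<F> \<subseteq> Pow (V j)" using nb_subset unfolding \<F>_def by blast
    moreover have "32 * real k * real N / \<epsilon> ^ 4 < real (card (V j))"
      unfolding cardV[OF j] \<epsilon>_def by (rule large)
    ultimately have "\<exists>f. f \<in> V j \<rightarrow> {..<N} \<and> (\<forall>A\<in>\<F>. \<forall>c<N. card A / N - \<epsilon> * card (V j) \<le> real (card {u \<in> A. f u = c}))"
      by (intro balanced_colouring[OF N \<epsilon> finV[OF j]])
    then obtain f where f: "f \<in> V j \<rightarrow> {..<N}"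
      "\<And>A c. A \<in> \<F> \<Longrightarrow> c < N \<Longrightarrow> card A / N - \<epsilon> * n \<le> real (card {u \<in> A. f u = c})"
      unfolding cardV[OF j] by blast
    define C where "C = {u \<in> V j. f u = 0}"
    have finC: "finite C" using finV[OF j] by (simp add: C_def)
    have "card (V j) / N - \<epsilon> * n \<le> real (card C)" unfolding C_def by (rule f(2)) (use N in \<open>auto simp: \<F>_def\<close>)
    then have C_lower: "y - \<epsilon> * n \<le> card C" using cardV[OF j] by (simp add: y_def)
    have "card (V j) / N - \<epsilon> * n \<le> real (card {u \<in> V j. f u = c})" if "c < N" for c
      by (rule f(2)[OF _ that]) (simp add: \<F>_def)
    from colour_class_upper[OF finV[OF j] f(1) N _ this]
    have C_upper: "real (card C) \<le> y + N * (\<epsilon> * n)" using \<epsilon>n0 cardV[OF j] by (simp add: C_def y_def)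
    have "m \<le> card C" using C_lower m by linarith
    then obtain X where X: "X \<subseteq> C" "card X = m" by (metis obtain_subset_with_card_n)
    have "d \<le> card (nb j v \<inter> X)" if i: "i \<in> {1..k} - {j}" and v: "v \<in> V i" for i v
    proof -
      have "nb j v \<in> \<F>" using i v unfolding \<F>_def by blast
      then have "card (nb j v) / N - \<epsilon> * n \<le> real (card {u \<in> nb j v. f u = 0})" using f(2) N by blast
      moreover have "{u \<in> nb j v. f u = 0} = nb j v \<inter> C" using nb_subset unfolding C_def by blast
      moreover have "\<delta> * y \<le> card (nb j v) / N"
      proof -
        have "\<delta> * n \<le> card (nb j v)" using deg[OF _ j _ v] i by blast
        from divide_right_mono[OF this, of "real N"] show ?thesis by (simp add: y_def)
      qed
      ultimately have 1: "\<delta> * y - \<epsilon> * n \<le> real (card (nb j v \<inter> C))" by simp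
      have "card (nb j v \<inter> C) \<le> card ((nb j v \<inter> X) \<union> (C - X))" using finC by (intro card_mono) (auto intro: finite_subset[OF X(1)])
      also have "\<dots> \<le> card (nb j v \<inter> X) + card (C - X)" by (rule card_Un_le)
      also have "card (C - X) = card C - m" using X finC by (metis card_Diff_subset finite_subset)
      finally have "real (card (nb j v \<inter> C)) \<le> real (card (nb j v \<inter> X)) + card C - m" using \<open>m \<le> card C\<close> by linarith
      then have "3 / 4 * (\<delta> * y) - 1 \<le> real (card (nb j v \<inter> X))" using 1 C_upper m \<epsilon>n0 by linarith
      moreover have "real d \<le> \<delta> * y / 2" using d by (simp add: y_def mult.commute)
      ultimately have "real d \<le> real (card (nb j v \<inter> X))" using y4 by linarith
      then show ?thesis by simp
    qed
    moreover have "X \<subseteq> V j" using X(1) by (auto simp: C_def)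
    ultimately show ?thesis using X(2) by blast
  qed
  then have "\<exists>X. \<forall>j\<in>{1..k}. X j \<subseteq> V j \<and> card (X j) = m \<and> (\<forall>i\<in>{1..k} - {j}. \<forall>v\<in>V i. d \<le> card (nb j v \<inter> X j))"
    by (intro bchoice ballI)
  then obtain X where X: "\<forall>j\<in>{1..k}. X j \<subseteq> V j \<and> card (X j) = m \<and> (\<forall>i\<in>{1..k} - {j}. \<forall>v\<in>V i. d \<le> card (nb j v \<inter> X j))" ..
  have "flexible X d" using X unfolding flexible_def by blast
  moreover have "real m \<le> n / N" using m \<epsilon>n0 unfolding y_def[symmetric] by linarith
  moreover have "n / (2 * real N) \<le> real m"
  proof -
    have "y / 2 \<le> real m" using m \<epsilon>n0 N\<epsilon> \<delta>y y4 by linarith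
    then show ?thesis by (simp add: y_def mult.commute)
  qed
  ultimately show ?thesis using X by blast
qed

text \<open>The flexible sets have m <= n / N vertices, and the structure over them costs at most m
  (5k + 5k^2 + 120ka) vertices, which the choice of \<open>N\<close> keeps below \<tau> n. The
  degree \<delta> n / (2 N) into the flexible sets is split evenly between the \<open>e\<close>
  vertices that will be used up and the reserve \<open>h\<close>.\<close>

lemma factor_if_absorb_and_cover:
  fixes \<delta> \<tau> :: real
  assumes H1: "\<forall>i\<in>{1..k}. hole_free ({1..k} - {i}) h"
    and min_nb: "min_nb_degree \<delta>"
    and \<delta>: "0 < \<delta>" "\<delta> \<le> 1" and \<tau>: "0 < \<tau>" "\<tau> < 1"
    and ab: "\<And>x. \<forall>i\<in>{1..k}. x i \<in> V i \<Longrightarrow> absorb (nat \<lfloor>\<tau> * n\<rfloor>) a x"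
    and cover: "\<And>W w. \<forall>j\<in>{1..k}. W j \<subseteq> V j \<and> card (W j) = w \<Longrightarrow> n \<le> w + nat \<lfloor>\<tau> * n\<rfloor> \<Longrightarrow>
      \<exists>A. tile A \<and> A \<subseteq> (\<Union>j\<in>{1..k}. W j) \<and> (\<forall>j\<in>{1..k}. card (W j - A) \<le> l)"
    and N: "0 < N" "real (5 * k + 5 * k * k + 120 * k * a) \<le> \<tau> * N"
    and n: "4 * real N \<le> \<delta> * n" "32 * real k * real N / (\<delta> / (4 * real N * (real N + 2))) ^ 4 < n"
    and l: "real (k * l) + 1 \<le> \<delta> * n / (4 * real N)" and h: "real h \<le> \<delta> * n / (4 * real N)"
  shows "has_transversal_factor k V E"
proof -
  define e where "e = nat \<lfloor>\<delta> * n / (4 * real N)\<rfloor>"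
  define x where "x = \<delta> * n / (4 * real N)"
  have N0: "0 < real N" using N by simp
  have x0: "0 \<le> x" using \<delta> by (simp add: x_def)
  have e: "real e \<le> x" "x - 1 < real e" using x0 unfolding e_def x_def[symmetric] by linarith+
  have "real (e + h) \<le> \<delta> * n / (2 * real N)"
  proof -
    have "\<delta> * n / (2 * real N) = 2 * x" by (simp add: x_def)
    then show ?thesis using e h unfolding of_nat_add x_def[symmetric] by linarith
  qed
  from exists_flexible[OF min_nb \<delta> N(1) n this] obtain X m where X: "flexible X (e + h)"
    "\<forall>j\<in>{1..k}. card (X j) = m" "real m \<le> n / N" "n / (2 * real N) \<le> real m" by auto
  have n0: "0 < real n" using n(1) \<delta> N0 by (cases n) auto
  have "tile VV"
  proof (rule factor_from_absorbers[OF H1 ab X(1)])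
    show "card (X j) = m" if "j \<in> {1..k}" for j using X(2) that by blast
    have "0 < n / (2 * real N)" using n0 N0 by simp
    then show "1 \<le> m" using X(4) by linarith
    have "x \<le> n / (2 * real N)"
    proof -
      have "\<delta> * n / (4 * real N) \<le> 1 * real n / (2 * real N)" using \<delta> N0 n0 by (intro frac_le mult_right_mono) auto
      then show ?thesis by (simp add: x_def)
    qed
    then show "e \<le> m" using e X(4) by linarith
    show "k * l \<le> e"
    proof -
      have "real (k * l) < real e + 0" using l e unfolding x_def[symmetric] by linarith
      then show ?thesis by linarith
    qed
    show "5 * m * k + 5 * m * k * k + 120 * m * k * a \<le> nat \<lfloor>\<tau> * n\<rfloor>"
    proof -
      have "real (5 * m * k + 5 * m * k * k + 120 * m * k * a) = real m * real (5 * k + 5 * k * k + 120 * k * a)"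
        by (simp add: algebra_simps)
      also have "\<dots> \<le> (n / N) * (\<tau> * N)" using X(3) N(2) by (intro mult_mono) auto
      also have "\<dots> = \<tau> * n" using N0 by simp
      finally show ?thesis by linarith
    qed
    have "\<tau> * n < n" using \<tau> n0 by simp
    then show "nat \<lfloor>\<tau> * n\<rfloor> < n" using \<tau> n0 by linarith
  qed (use cover in auto)
  then show ?thesis by (simp add: has_factor_iff)
qed

text \<open>The greedy tiling leaves at most \<open>h\<close> vertices per part. The second bound on
  \<open>h\<close>, together with 8 N <= \<delta> n, makes k h + 1 at most \<delta> n / (4 N), which
  the flexible sets can take.\<close>

lemma factor_of_hole_free:
  fixes \<delta> \<tau> :: real
  assumes H: "hole_free {1..k} h" and hn: "h \<le> n" and min_nb: "min_nb_degree \<delta>"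
    and \<delta>: "0 < \<delta>" "\<delta> \<le> 1" and D: "D = \<delta> * \<delta> ^ (2 * (k - 1))"
    and K: "K = 2 * k + 3 * k\<^sup>2 + 6 * k ^ 3 + 4 * k ^ 4 + 2"
    and N: "0 < N" "real (5 * k + 5 * k * k + 120 * k * K) \<le> D / 64 * N"
    and h: "real h \<le> D / 64 * n" "real h \<le> \<delta> / (8 * real N * real k) * n"
    and n: "real (5 * K + 2) \<le> D / 32 * n" "4 * real N \<le> \<delta> * n" "8 * real N \<le> \<delta> * n"
      "32 * real k * real N / (\<delta> / (4 * real N * (real N + 2))) ^ 4 < n"
  shows "has_transversal_factor k V E"
proof -
  have H1: "\<forall>i\<in>{1..k}. hole_free ({1..k} - {i}) h" using hole_free_remove[OF H _ hn] by blast
  have "\<delta> * \<delta> ^ (2 * (k - 1)) \<le> 1 * 1" using \<delta> by (intro mult_mono power_le_one) auto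
  then have D01: "0 < D" "D \<le> 1" using \<delta> by (auto simp: D)
  have N0: "0 < real N" using N by simp
  have k0: "0 < real k" using k3 by simp
  define y where "y = \<delta> * n / (8 * real N)"
  have y: "real k * real h \<le> y" "1 \<le> y"
  proof -
    have "real k * real h \<le> real k * (\<delta> / (8 * real N * real k) * n)" using h(2) by (intro mult_left_mono) auto
    also have "\<dots> = y" using k0 by (simp add: y_def)
    finally show "real k * real h \<le> y" .
    show "1 \<le> y" using n(3) N0 by (simp add: y_def pos_le_divide_eq)
  qed
  have y4: "\<delta> * n / (4 * real N) = 2 * y" by (simp add: y_def)
  show ?thesis
  proof (rule factor_if_absorb_and_cover[OF H1 min_nb \<delta>, where \<tau> = "D / 64" and a = K and l = h and N = N])
    show "0 < D / 64" "D / 64 < 1" using D01 by auto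
    show "absorb (nat \<lfloor>D / 64 * n\<rfloor>) K x" if "\<forall>i\<in>{1..k}. x i \<in> V i" for x
    proof (rule absorb_of_hole_free[OF H H1 min_nb \<delta> K _ that])
      have "0 \<le> D / 64 * n" using D01 by simp
      then have "real (nat \<lfloor>D / 64 * n\<rfloor>) \<le> D / 64 * n" by linarith
      then show "real (nat \<lfloor>D / 64 * n\<rfloor> + 5 * K + h) + 2 \<le> \<delta> * \<delta> ^ (2 * (k - 1)) / 16 * n"
        using h(1) n(1) unfolding D[symmetric] of_nat_add by simp
    qed
    show "\<exists>A. tile A \<and> A \<subseteq> (\<Union>j\<in>{1..k}. W j) \<and> (\<forall>j\<in>{1..k}. card (W j - A) \<le> h)"
      if "\<forall>j\<in>{1..k}. W j \<subseteq> V j \<and> card (W j) = w" for W w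
      by (rule greedy_cover[OF H]) (use that in blast)+
    show "real (k * h) + 1 \<le> \<delta> * n / (4 * real N)" using y unfolding y4 of_nat_mult by linarith
    have "1 * real h \<le> real k * real h" using k3 by (intro mult_right_mono) auto
    then show "real h \<le> \<delta> * n / (4 * real N)" using y unfolding y4 by linarith
  qed (use N n in auto)
qed

text \<open>\<open>\<theta>\<close> is half of the surplus of \<delta> over 1/2: deleting up to
  \<theta> n vertices of each part leaves degrees of at least (1/2 + \<theta>) n for the star
  tiling. This leaves about 7 n / q vertices per part, and q >= 56 k N / \<delta> makes k times that
  at most \<delta> n / (8 N), half of what the flexible sets can take.\<close>

lemma factor_of_large_degree:
  fixes \<delta> \<theta> :: real
  assumes H1: "\<forall>i\<in>{1..k}. hole_free ({1..k} - {i}) h" and h1: "1 \<le> h" and min_nb: "min_nb_degree \<delta>"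
    and \<delta>: "0 < \<delta>" "\<delta> \<le> 1" and \<theta>: "\<theta> = (\<delta> - 1/2) / 2" "0 < \<theta>"
    and N: "0 < N" "real (5 * k + 5 * k * k + 120 * k * (k + k * k)) \<le> \<theta> * N"
    and q: "7 \<le> q" "56 * real k * real N / \<delta> \<le> q" and p: "4 * real q / \<theta> \<le> real p"
    and h: "real h \<le> \<theta> * n" "real h \<le> \<delta> / (4 * real N) * n" "real h \<le> \<theta> / (8 * real p * real q) * n"
    and n: "real (2 * k + k * k) \<le> \<theta> * n" "4 * real N \<le> \<delta> * n"
      "32 * real k * real N / (\<delta> / (4 * real N * (real N + 2))) ^ 4 < n"
      "real (k * q) + 1 \<le> \<delta> / (8 * real N) * n" "4 \<le> \<theta> / (4 * real q) * n"
      "32 * real 2 * real p / (\<theta> / (real p * (real p + 2))) ^ 4 \<le> 1/2 * n"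
      "32 * real k * real q / (\<theta> / (4 * real q * (real q + 2))) ^ 4 \<le> 1/2 * n"
  shows "has_transversal_factor k V E"
proof -
  have one: "1 \<in> {1..k}" using k3 by simp
  have N0: "0 < real N" and q0: "0 < real q" using N q by auto
  have "0 < 4 * real q / \<theta>" using q0 \<theta>(2) by simp
  then have p0: "0 < real p" using p by linarith
  have n0: "0 < real n" using n(2) \<delta> N0 by (cases n) auto
  have \<theta>4: "\<theta> \<le> 1/4" "\<delta> = 1/2 + 2 * \<theta>" using \<theta> \<delta> by auto
  define b where "b = nat \<lfloor>\<theta> * n\<rfloor>"
  have b: "real b \<le> \<theta> * n" using \<theta>(2) by (simp add: b_def)
  have b4: "real b \<le> n / 4"
  proof -
    have "\<theta> * n \<le> 1/4 * n" using \<theta>4 by (intro mult_right_mono) auto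
    then show ?thesis using b by simp
  qed
  define l where "l = nat \<lfloor>7 * real n / q + q\<rfloor>"
  have "0 \<le> 7 * real n / q + q" by simp
  then have l: "real l \<le> 7 * real n / q + q" unfolding l_def by simp
  show ?thesis
  proof (rule factor_if_absorb_and_cover[OF H1 min_nb \<delta>, where \<tau> = \<theta> and a = "k + k * k" and l = l and N = N])
    show "0 < \<theta>" "\<theta> < 1" using \<theta> \<theta>4 by auto
    show "absorb (nat \<lfloor>\<theta> * n\<rfloor>) (k + k * k) x" if "\<forall>i\<in>{1..k}. x i \<in> V i" for x
    proof (rule absorb_of_common_neighbours[OF H1 min_nb \<delta>(2) _ that])
      have "(2 * \<delta> - 1) * n = 4 * (\<theta> * n)" unfolding \<theta>4(2) by simp
      moreover have "real (b + 2 * k + k * k + h) = real b + real (2 * k + k * k) + real h" by simp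
      moreover have "0 \<le> \<theta> * n" using \<theta> by simp
      ultimately show "real (nat \<lfloor>\<theta> * n\<rfloor> + 2 * k + k * k + h) \<le> (2 * \<delta> - 1) * n"
        using b h(1) n(1) unfolding b_def[symmetric] by linarith
    qed
    show "\<exists>A. tile A \<and> A \<subseteq> (\<Union>j\<in>{1..k}. W j) \<and> (\<forall>j\<in>{1..k}. card (W j - A) \<le> l)"
      if W: "\<forall>j\<in>{1..k}. W j \<subseteq> V j \<and> card (W j) = w" and w: "n \<le> w + nat \<lfloor>\<theta> * n\<rfloor>" for W w
    proof -
      have w': "real n \<le> real w + real b" using w unfolding b_def[symmetric] by linarith
      have wn: "w \<le> n" using W one card_mono[OF finV[OF one], of "W 1"] cardV[OF one] by auto
      have w2: "n / 2 < real w" using w' b4 n0 by linarith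
      have degW: "(1/2 + \<theta>) * w \<le> real (card (nb j v \<inter> W j))" if "i \<in> {1..k}" "j \<in> {1..k}" "i \<noteq> j" "v \<in> V i" for i j v
      proof -
        have Wj: "W j \<subseteq> V j" "card (W j) = w" using W that(2) by auto
        have "nb j v - W j \<subseteq> V j - W j" using nb_subset by blast
        then have "card (nb j v - W j) \<le> card (V j - W j)" using finV[OF that(2)] by (intro card_mono) auto
        also have "\<dots> = n - w" using Wj cardV[OF that(2)] finV[OF that(2)] by (metis card_Diff_subset finite_subset)
        finally have "card (nb j v) \<le> card (nb j v \<inter> W j) + (n - w)"
          using card_Int_Diff[OF finite_nb[OF that(2)], of v "W j"] by simp
        then have "real (card (nb j v)) \<le> real (card (nb j v \<inter> W j)) + real b" using w' wn by linarith
        moreover have "\<delta> * n \<le> card (nb j v)" by (rule min_nb_degreeD[OF min_nb that])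
        moreover have "\<delta> * n = (1/2 + \<theta>) * n + \<theta> * n" unfolding \<theta>4(2) by (simp add: algebra_simps)
        moreover have "(1/2 + \<theta>) * w \<le> (1/2 + \<theta>) * n" using \<theta> wn by (intro mult_left_mono) auto
        ultimately show ?thesis using b by linarith
      qed
      have "\<exists>A. tile A \<and> A \<subseteq> (\<Union>j\<in>{1..k}. W j) \<and> (\<forall>j\<in>{1..k}. real (card (W j - A)) \<le> 7 * w / q + q)"
      proof (rule almost_cover[where \<theta> = \<theta> and h = h and p = p])
        show "hole_free ({1..k} - {1}) h" using H1 one by blast
        show "W j \<subseteq> V j" "card (W j) = w" if "j \<in> {1..k}" for j using W that by auto
        show "(1/2 + \<theta>) * w \<le> real (card (nb j u \<inter> W j))" if "u \<in> W 1" "j \<in> {1..k} - {1}" for u j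
        proof (rule degW[OF one])
          show "u \<in> V 1" using W one that(1) by blast
        qed (use that(2) in auto)
        show "(1/2 + \<theta>) * w \<le> real (card (nb 1 x \<inter> W 1))" if "j \<in> {1..k} - {1}" "x \<in> W j" for x j
        proof (rule degW[OF _ one])
          show "x \<in> V j" using W that by blast
        qed (use that(1) in auto)
        show "2 * real p * h + 4 \<le> \<theta> * w / q"
        proof -
          have "2 * real p * h \<le> 2 * real p * (\<theta> / (8 * real p * real q) * n)" using h(3) by (intro mult_left_mono) auto
          also have "\<dots> = \<theta> / (4 * real q) * n" using p0 by simp
          finally have "2 * real p * h + 4 \<le> 2 * (\<theta> / (4 * real q) * n)" using n(5) by linarith
          also have "\<dots> = \<theta> / q * (n / 2)" by simp
          also have "\<dots> \<le> \<theta> / q * w" using w2 \<theta> by (intro mult_left_mono) auto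
          finally show ?thesis by simp
        qed
        show "32 * real 2 * real p / (\<theta> / (real p * (real p + 2))) ^ 4 < w" using n(6) w2 by linarith
        show "32 * real k * real q / (\<theta> / (4 * real q * (real q + 2))) ^ 4 < w" using n(7) w2 by linarith
        show "4 * real q / \<theta> \<le> real p" by (rule p)
      qed (use h1 \<theta> \<theta>4 q in auto)
      then obtain A where A: "tile A" "A \<subseteq> (\<Union>j\<in>{1..k}. W j)"
        "\<And>j. j \<in> {1..k} \<Longrightarrow> real (card (W j - A)) \<le> 7 * w / q + q" by blast
      have "7 * real w / q \<le> 7 * real n / q" using wn q0 by (intro divide_right_mono) auto
      then have "card (W j - A) \<le> l" if "j \<in> {1..k}" for j using A(3)[OF that] unfolding l_def by linarith
      then show ?thesis using A(1,2) by blast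
    qed
    show "real (k * l) + 1 \<le> \<delta> * n / (4 * real N)"
    proof -
      have "56 * real k * real N \<le> q * \<delta>" using q(2) \<delta> by (simp add: pos_divide_le_eq)
      then have "7 * real k / q \<le> \<delta> / (8 * real N)" using q0 N0 by (simp add: divide_simps mult_ac)
      then have "7 * real k / q * n \<le> \<delta> / (8 * real N) * n" by (intro mult_right_mono) auto
      moreover have "real k * real l \<le> real k * (7 * real n / q + q)" using l by (intro mult_left_mono) auto
      moreover have "real k * (7 * real n / q + q) = 7 * real k / q * n + real (k * q)" by (simp add: algebra_simps)
      moreover have "\<delta> * n / (4 * real N) = 2 * (\<delta> / (8 * real N) * n)" by simp
      ultimately show ?thesis using n(4) unfolding of_nat_mult[of k l] by linarith
    qed
    show "real h \<le> \<delta> * n / (4 * real N)" using h(2) by simp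
  qed (use N n in auto)
qed

end

section \<open>From explicit bounds to all sufficiently large n\<close>

lemma eventually_le_linear:
  fixes c x :: real assumes "0 < c" shows "\<forall>\<^sub>F n in sequentially. x \<le> c * real n"
proof -
  have "x \<le> c * real n" if "nat \<lceil>x / c\<rceil> \<le> n" for n
  proof -
    have "x / c \<le> n" using that by linarith
    then show ?thesis using assms by (simp add: pos_divide_le_eq mult.commute)
  qed
  then show ?thesis by (rule eventually_sequentiallyI)
qed

lemma eventually_less_linear:
  fixes x :: real shows "\<forall>\<^sub>F n in sequentially. x < real n"
  using eventually_le_linear[of 1 "x + 1"] by (auto elim: eventually_mono)

text \<open>\<open>\<delta> \<le> 1\<close> holds because a vertex has at most \<open>n\<close>
  neighbours in a part. The rounding up in the hole size is correct since \<open>alpha_star\<close>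
  is an integer strictly below \<alpha> n.\<close>

lemma spanning_subgraph_kpartite:
  fixes V :: "nat \<Rightarrow> 'a set" and \<delta> \<alpha> :: real
  assumes k: "k \<ge> 3" and r: "r \<le> k" "1 \<le> r" and G: "spanning_subgraph_of_blowup k n V E"
    and n: "0 < n" and d: "real (delta_star k V E) \<ge> \<delta> * real n"
    and a: "real (alpha_star r k V E) < \<alpha> * real n"
  shows "kpartite k n V" "kpartite.min_nb_degree k n V E \<delta>" "\<delta> \<le> 1"
    "\<And>J. J \<subseteq> {1..k} \<Longrightarrow> card J = r \<Longrightarrow> kpartite.hole_free V E J (nat \<lceil>\<alpha> * n\<rceil>)"
proof -
  show kp: "kpartite k n V"
    using k G unfolding spanning_subgraph_of_blowup_def blowup_parts_def by unfold_locales auto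
  then interpret kpartite k n V E .
  have E: "E \<subseteq> blowup_edges k V" using G by (simp add: spanning_subgraph_of_blowup_def)
  show md: "min_nb_degree \<delta>" unfolding min_nb_degree_def
  proof (intro ballI impI)
    fix i j v assume "i \<in> {1..k}" "j \<in> {1..k}" "i \<noteq> j" "v \<in> V i"
    from delta_star_le_card_nb[OF E this] show "\<delta> * n \<le> real (card (nb j v))" using d by linarith
  qed
  have i: "1 \<in> {1..k}" "2 \<in> {1..k}" "(1::nat) \<noteq> 2" using k by auto
  obtain v where v: "v \<in> V 1" using cardV[OF i(1)] n by fastforce
  have "card (nb 2 v) \<le> n" using card_mono[OF finV[OF i(2)] nb_subset, of v] cardV[OF i(2)] by simp
  then have "\<delta> * n \<le> 1 * real n" using min_nb_degreeD[OF md i v] by linarith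
  then show "\<delta> \<le> 1" using n by (simp add: mult_le_cancel_right)
  have "alpha_star r k V E < nat \<lceil>\<alpha> * n\<rceil>" using a by linarith
  then show "hole_free J (nat \<lceil>\<alpha> * n\<rceil>)" if "J \<subseteq> {1..k}" "card J = r" for J
    using hole_free_of_alpha_star[OF that(1), of "nat \<lceil>\<alpha> * n\<rceil>"] that(2) r(2) by force
qed

theorem theorem1p3:
  fixes k r :: nat and \<delta> :: real
  assumes "k \<ge> 3" and "\<delta> > 0"
    and "(\<delta> > 1/2 \<and> r = k - 1) \<or> (\<delta> > 0 \<and> r = k)"
  shows "\<exists>\<alpha>::real. \<alpha> > 0 \<and>
    (\<forall>\<^sub>F n in sequentially. \<forall>(V :: nat \<Rightarrow> 'a set) E.
       spanning_subgraph_of_blowup k n V E \<longrightarrow>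
       real (delta_star k V E) \<ge> \<delta> * real n \<longrightarrow>
       real (alpha_star r k V E) < \<alpha> * real n \<longrightarrow>
       has_transversal_factor k V E)"
  using assms(3)
proof
  assume case1: "\<delta> > 1/2 \<and> r = k - 1"
  define \<theta> where "\<theta> = (\<delta> - 1/2) / 2"
  have \<theta>: "0 < \<theta>" using case1 by (simp add: \<theta>_def)
  obtain N :: nat where N: "real (5 * k + 5 * k * k + 120 * k * (k + k * k)) / \<theta> < N" "0 < N"
    using reals_Archimedean2[of "max 0 (real (5 * k + 5 * k * k + 120 * k * (k + k * k)) / \<theta>)"] by auto
  obtain q :: nat where q: "max 7 (56 * real k * real N / \<delta>) < q" using reals_Archimedean2 by blast
  obtain p :: nat where p: "max 0 (4 * real q / \<theta>) < p" using reals_Archimedean2 by blast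
  \<comment> \<open>Each upper bound on \<open>h\<close> in \<open>factor_of_large_degree\<close>
    has the form c n, and \<open>\<sigma>\<close> is the smallest of these c.\<close>
  define \<sigma> where "\<sigma> = min \<theta> (min (\<delta> / (4 * real N)) (\<theta> / (8 * real p * real q)))"
  have pq0: "0 < real p" "0 < real q" using p q unfolding max_less_iff_conj by linarith+
  have "0 < \<theta> / (8 * real p * real q)" using \<theta> pq0 by (intro divide_pos_pos mult_pos_pos) auto
  then have \<sigma>: "0 < \<sigma>" using \<theta> assms(2) N by (simp add: \<sigma>_def)
  have "\<forall>\<^sub>F n in sequentially. 1 \<le> \<sigma> / 2 * real n \<and> real (2 * k + k * k) \<le> \<theta> * n \<and> 4 * real N \<le> \<delta> * n \<and>
      32 * real k * real N / (\<delta> / (4 * real N * (real N + 2))) ^ 4 < n \<and>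
      real (k * q) + 1 \<le> \<delta> / (8 * real N) * n \<and> 4 \<le> \<theta> / (4 * real q) * n \<and>
      32 * real 2 * real p / (\<theta> / (real p * (real p + 2))) ^ 4 \<le> 1/2 * real n \<and>
      32 * real k * real q / (\<theta> / (4 * real q * (real q + 2))) ^ 4 \<le> 1/2 * real n"
    using \<sigma> \<theta> assms(2) N q by (intro eventually_conj eventually_le_linear eventually_less_linear) auto
  then have "\<forall>\<^sub>F n in sequentially. \<forall>(V :: nat \<Rightarrow> 'a set) E.
       spanning_subgraph_of_blowup k n V E \<longrightarrow> real (delta_star k V E) \<ge> \<delta> * real n \<longrightarrow>
       real (alpha_star r k V E) < \<sigma> / 2 * real n \<longrightarrow> has_transversal_factor k V E"
  proof (rule eventually_mono, intro allI impI)
    fix n and V :: "nat \<Rightarrow> 'a set" and E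
    assume n: "1 \<le> \<sigma> / 2 * real n \<and> real (2 * k + k * k) \<le> \<theta> * n \<and> 4 * real N \<le> \<delta> * n \<and>
      32 * real k * real N / (\<delta> / (4 * real N * (real N + 2))) ^ 4 < n \<and>
      real (k * q) + 1 \<le> \<delta> / (8 * real N) * n \<and> 4 \<le> \<theta> / (4 * real q) * n \<and>
      32 * real 2 * real p / (\<theta> / (real p * (real p + 2))) ^ 4 \<le> 1/2 * real n \<and>
      32 * real k * real q / (\<theta> / (4 * real q * (real q + 2))) ^ 4 \<le> 1/2 * real n"
      and G: "spanning_subgraph_of_blowup k n V E" "real (delta_star k V E) \<ge> \<delta> * real n"
        "real (alpha_star r k V E) < \<sigma> / 2 * real n"
    have n0: "0 < n" using n by (cases n) auto
    \<comment> \<open>The hole constant is only \<open>\<sigma> / 2\<close>: rounding up costs less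
      than 1, hence at most \<sigma> n / 2 for large \<open>n\<close>, so that \<open>h\<close>
      stays below \<sigma> n.\<close>
    define h where "h = nat \<lceil>\<sigma> / 2 * n\<rceil>"
    have h: "real h \<le> \<sigma> * n" "1 \<le> h" using n unfolding h_def by linarith+
    have h_le: "real h \<le> c * n" if "\<sigma> \<le> c" for c
      using h(1) mult_right_mono[OF that, of "real n"] by linarith
    have r: "r \<le> k" "1 \<le> r" using case1 assms(1) by auto
    note facts = spanning_subgraph_kpartite[OF assms(1) r G(1) n0 G(2,3)]
    interpret kpartite k n V E by (rule facts(1))
    have "\<forall>i\<in>{1..k}. hole_free ({1..k} - {i}) h" using facts(4) case1 unfolding h_def by auto
    then show "has_transversal_factor k V E"
    proof (rule factor_of_large_degree[OF _ h(2) facts(2) assms(2) facts(3) \<theta>_def \<theta>, where N = N and q = q and p = p])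
      show "real (5 * k + 5 * k * k + 120 * k * (k + k * k)) \<le> \<theta> * N"
        using N(1) \<theta> by (simp only: pos_divide_less_eq mult.commute less_imp_le)
      show "real h \<le> \<theta> * n" "real h \<le> \<delta> / (4 * real N) * n" "real h \<le> \<theta> / (8 * real p * real q) * n"
        by (rule h_le, simp add: \<sigma>_def)+
    qed (use N q p n in auto)
  qed
  then show ?thesis using \<sigma> by (intro exI[of _ "\<sigma> / 2"]) simp
next
  assume case2: "\<delta> > 0 \<and> r = k"
  define D where "D = \<delta> * \<delta> ^ (2 * (k - 1))"
  have D: "0 < D" using assms(2) by (simp add: D_def)
  define K where "K = 2 * k + 3 * k\<^sup>2 + 6 * k ^ 3 + 4 * k ^ 4 + 2"
  obtain N :: nat where N: "max 0 (real (5 * k + 5 * k * k + 120 * k * K) / (D / 64)) < N"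
    using reals_Archimedean2 by blast
  \<comment> \<open>The entry 1 guarantees \<open>h \<le> n\<close>, needed to pass from cliques on
    \<open>k\<close> parts to cliques on \<open>k - 1\<close> parts.\<close>
  define \<sigma> where "\<sigma> = min 1 (min (D / 64) (\<delta> / (8 * real N * real k)))"
  have "0 < real N" using N unfolding max_less_iff_conj by linarith
  then have "0 < \<delta> / (8 * real N * real k)"
    using assms(1,2) by (intro divide_pos_pos mult_pos_pos) auto
  then have \<sigma>: "0 < \<sigma>" using D by (simp add: \<sigma>_def)
  have "\<forall>\<^sub>F n in sequentially. 1 \<le> \<sigma> / 2 * real n \<and> real (5 * K + 2) \<le> D / 32 * n \<and> 4 * real N \<le> \<delta> * n \<and>
      8 * real N \<le> \<delta> * n \<and> 32 * real k * real N / (\<delta> / (4 * real N * (real N + 2))) ^ 4 < n"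
    using \<sigma> D assms(2) by (intro eventually_conj eventually_le_linear eventually_less_linear) auto
  then have "\<forall>\<^sub>F n in sequentially. \<forall>(V :: nat \<Rightarrow> 'a set) E.
       spanning_subgraph_of_blowup k n V E \<longrightarrow> real (delta_star k V E) \<ge> \<delta> * real n \<longrightarrow>
       real (alpha_star r k V E) < \<sigma> / 2 * real n \<longrightarrow> has_transversal_factor k V E"
  proof (rule eventually_mono, intro allI impI)
    fix n and V :: "nat \<Rightarrow> 'a set" and E
    assume n: "1 \<le> \<sigma> / 2 * real n \<and> real (5 * K + 2) \<le> D / 32 * n \<and> 4 * real N \<le> \<delta> * n \<and>
      8 * real N \<le> \<delta> * n \<and> 32 * real k * real N / (\<delta> / (4 * real N * (real N + 2))) ^ 4 < n"
      and G: "spanning_subgraph_of_blowup k n V E" "real (delta_star k V E) \<ge> \<delta> * real n"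
        "real (alpha_star r k V E) < \<sigma> / 2 * real n"
    have n0: "0 < n" using n by (cases n) auto
    define h where "h = nat \<lceil>\<sigma> / 2 * n\<rceil>"
    have h: "real h \<le> \<sigma> * n" using n unfolding h_def by linarith
    have h_le: "real h \<le> c * n" if "\<sigma> \<le> c" for c
      using h mult_right_mono[OF that, of "real n"] by linarith
    have r: "r \<le> k" "1 \<le> r" using case2 assms(1) by auto
    note facts = spanning_subgraph_kpartite[OF assms(1) r G(1) n0 G(2,3)]
    interpret kpartite k n V E by (rule facts(1))
    have "hole_free {1..k} h" using facts(4)[of "{1..k}"] case2 unfolding h_def by simp
    then show "has_transversal_factor k V E"
    proof (rule factor_of_hole_free[OF _ _ facts(2) assms(2) facts(3) D_def K_def, where N = N])
      show "h \<le> n" using h_le[of 1] by (simp add: \<sigma>_def)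
      show "0 < N" using N by simp
      show "real (5 * k + 5 * k * k + 120 * k * K) \<le> D / 64 * N"
      proof -
        have "real (5 * k + 5 * k * k + 120 * k * K) / (D / 64) < N" using N by simp
        then have "real (5 * k + 5 * k * k + 120 * k * K) < N * (D / 64)"
          using D by (subst (asm) pos_divide_less_eq) auto
        then show ?thesis by (simp only: mult.commute less_imp_le)
      qed
      show "real h \<le> D / 64 * n" "real h \<le> \<delta> / (8 * real N * real k) * n"
        by (rule h_le, simp add: \<sigma>_def)+
    qed (use n in auto)
  qed
  then show ?thesis using \<sigma> by (intro exI[of _ "\<sigma> / 2"]) simp
qed

end
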